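(* Assuming Schanuel's conjecture, the following is decidable: given two finitely ambiguous weighted automata $\mathcal{A},\mathcal{B}$ over the same alphabet $\Sigma$, decide whether $\mathcal{A}$ is big-O of $\mathcal{B}$, i.e. whether there is $C>0$ with $f_{\mathcal{A}}(w)\le C f_{\mathcal{B}}(w)$ for all $w\in\Sigma^*$.
   Context: A (non-negative) weighted automaton is $\langle Q,\Sigma,M,F\rangle$ with finite $Q$, $M:\Sigma\to\mathbb{Q}_{\ge0}^{Q\times Q}$, $F\subseteq Q$, here with a dedicated initial state $q_0$; $f_{\mathcal{A}}(a_1\cdots a_n)=\sum_{t\in F}(M(a_1)\cdots M(a_n))_{q_0,t}$. The NFA of the automaton has the same states, initial and final states, and a transition $q\xrightarrow{a}q'$ whenever $M(a)(q,q')>0$. The automaton is finitely ambiguous if there is a constant $k$ such that every word has at most $k$ accepting paths in this NFA. Schanuel's conjecture: for all $z_1,\dots,z_n\in\mathbb{C}$ linearly independent over $\mathbb{Q}$, $\mathbb{Q}(z_1,\dots,z_n,e^{z_1},\dots,e^{z_n})$ has transcendence degree at least $n$ over $\mathbb{Q}$. *)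

theory Defs
  imports Complex_Main "HOL-Library.Nat_Bijection"
begin

definition Q_lin_indep :: "complex list \<Rightarrow> bool" where
  "Q_lin_indep zs \<longleftrightarrow>
     (\<forall>qs :: rat list. length qs = length zs \<and>
        (\<Sum>i<length zs. of_rat (qs ! i) * zs ! i) = 0 \<longrightarrow> (\<forall>q\<in>set qs. q = 0))"

definition Q_alg_indep :: "complex list \<Rightarrow> bool" where
  "Q_alg_indep xs \<longleftrightarrow>
     (\<forall>(S :: nat list set) (c :: nat list \<Rightarrow> rat).
        finite S \<and> (\<forall>e\<in>S. length e = length xs) \<and>
        (\<Sum>e\<in>S. of_rat (c e) * (\<Prod>i<length xs. (xs ! i) ^ (e ! i))) = 0
        \<longrightarrow> (\<forall>e\<in>S. c e = 0))"

text \<open>Q(z_1..z_n,e^z_1..e^z_n) has transcendence degree at least n over Q iff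
  some n of its 2n generators are algebraically independent over Q.\<close>
definition schanuel_conjecture :: bool where
  "schanuel_conjecture \<longleftrightarrow>
     (\<forall>zs :: complex list. Q_lin_indep zs \<longrightarrow>
        (\<exists>is :: nat list. distinct is \<and> length is = length zs \<and>
           set is \<subseteq> {..<2 * length zs} \<and>
           Q_alg_indep (map (\<lambda>i. (zs @ map exp zs) ! i) is)))"

text \<open>A weighted automaton over the alphabet {0..<k}: number of states n
  (states {0..<n}, initial state 0), a list of weight entries (a, q, q', num, den)
  contributing num/den to M(a)(q,q'), and the list of final states.\<close>
type_synonym wa = "nat \<times> (nat \<times> nat \<times> nat \<times> nat \<times> nat) list \<times> nat list"

definition wa_nst :: "wa \<Rightarrow> nat" where "wa_nst A = fst A"
definition wa_entries :: "wa \<Rightarrow> (nat \<times> nat \<times> nat \<times> nat \<times> nat) list" where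
  "wa_entries A = fst (snd A)"
definition wa_final :: "wa \<Rightarrow> nat set" where "wa_final A = set (snd (snd A))"

definition wa_M :: "wa \<Rightarrow> nat \<Rightarrow> nat \<Rightarrow> nat \<Rightarrow> rat" where
  "wa_M A a q q' = sum_list (map (\<lambda>(b, p, p', m, d). of_nat m / of_nat d)
       (filter (\<lambda>(b, p, p', m, d). b = a \<and> p = q \<and> p' = q') (wa_entries A)))"

definition wa_wf :: "nat \<Rightarrow> wa \<Rightarrow> bool" where
  "wa_wf k A \<longleftrightarrow> 0 < wa_nst A \<and> wa_final A \<subseteq> {..<wa_nst A} \<and>
     (\<forall>(b, p, p', m, d) \<in> set (wa_entries A). b < k \<and> p < wa_nst A \<and> p' < wa_nst A \<and> 0 < d)"

fun wa_mat :: "wa \<Rightarrow> nat list \<Rightarrow> nat \<Rightarrow> nat \<Rightarrow> rat" where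
  "wa_mat A [] q q' = (if q = q' then 1 else 0)"
| "wa_mat A (a # w) q q' = (\<Sum>p<wa_nst A. wa_M A a q p * wa_mat A w p q')"

definition wa_fun :: "wa \<Rightarrow> nat list \<Rightarrow> real" where
  "wa_fun A w = of_rat (\<Sum>t\<in>wa_final A. wa_mat A w 0 t)"

definition wa_acc_paths :: "wa \<Rightarrow> nat list \<Rightarrow> nat list set" where
  "wa_acc_paths A w = {qs. length qs = length w \<and> set qs \<subseteq> {..<wa_nst A} \<and>
      (\<forall>i<length w. wa_M A (w ! i) ((0 # qs) ! i) (qs ! i) > 0) \<and>
      (0 # qs) ! length w \<in> wa_final A}"

definition finitely_ambiguous :: "nat \<Rightarrow> wa \<Rightarrow> bool" where
  "finitely_ambiguous k A \<longleftrightarrow>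
     (\<exists>c::nat. \<forall>w. set w \<subseteq> {..<k} \<longrightarrow> card (wa_acc_paths A w) \<le> c)"

definition big_O :: "nat \<Rightarrow> wa \<Rightarrow> wa \<Rightarrow> bool" where
  "big_O k A B \<longleftrightarrow>
     (\<exists>C::real. C > 0 \<and> (\<forall>w. set w \<subseteq> {..<k} \<longrightarrow> wa_fun A w \<le> C * wa_fun B w))"

definition enc_entry :: "nat \<times> nat \<times> nat \<times> nat \<times> nat \<Rightarrow> nat" where
  "enc_entry e = (case e of (a, p, p', m, d) \<Rightarrow>
      list_encode [a, p, p', m, d])"

definition enc_wa :: "wa \<Rightarrow> nat" where
  "enc_wa A = list_encode [wa_nst A, list_encode (map enc_entry (wa_entries A)),
                           list_encode (snd (snd A))]"

definition enc_instance :: "nat \<Rightarrow> wa \<Rightarrow> wa \<Rightarrow> nat" where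
  "enc_instance k A B = list_encode [k, enc_wa A, enc_wa B]"

datatype instr = INC nat nat | DEC nat nat nat | HALT

type_synonym config = "nat \<times> (nat \<Rightarrow> nat)"

definition cm_step :: "instr list \<Rightarrow> config \<Rightarrow> config" where
  "cm_step prog c = (case c of (pc, r) \<Rightarrow>
     (if pc < length prog then
        (case prog ! pc of
           INC i j \<Rightarrow> (j, r(i := Suc (r i)))
         | DEC i j l \<Rightarrow> (if r i = 0 then (l, r) else (j, r(i := r i - 1)))
         | HALT \<Rightarrow> (pc, r))
      else (pc, r)))"

definition cm_halted :: "instr list \<Rightarrow> config \<Rightarrow> bool" where
  "cm_halted prog c \<longleftrightarrow> fst c \<ge> length prog \<or> prog ! fst c = HALT"

definition cm_run :: "instr list \<Rightarrow> nat \<Rightarrow> nat \<Rightarrow> config" where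
  "cm_run prog x t = (cm_step prog ^^ t) (0, (\<lambda>_. 0)(0 := x))"

definition cm_computes :: "instr list \<Rightarrow> nat \<Rightarrow> nat \<Rightarrow> bool" where
  "cm_computes prog x y \<longleftrightarrow>
     (\<exists>t. cm_halted prog (cm_run prog x t) \<and> snd (cm_run prog x t) 0 = y)"

end

theory Submission
  imports Defs "HOL-Computational_Algebra.Primes"
begin

text \<open>Two kinds of finite certificates are enumerated in parallel. Let \<open>\<pi>\<close> be an accepting path of
  \<open>A\<close> and \<open>\<rho>\<^sub>1, \<dots>, \<rho>\<^sub>m\<close> all accepting paths of \<open>B\<close> on the same word. A cycle of their joint run
  has a gain vector, whose \<open>j\<close>-th entry is the logarithm of the ratio of the weights that \<open>\<pi>\<close> and
  \<open>\<rho>\<^sub>j\<close> collect along it. If some nonnegative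
  integer combination of cycles is positive in every coordinate, pumping these cycles refutes big-O;
  finite ambiguity of \<open>B\<close> forces every pumped cycle to act diagonally on the useful states, so no new
  accepting paths appear. Otherwise Gordan's alternative gives weights \<open>y \<ge> 0\<close>, \<open>y \<noteq> 0\<close>, for which
  all cycles have nonpositive gain, hence a potential on the joint runs, and the potentials of the
  finitely many joint runs bound \<open>A\<close> by \<open>B\<close>.

  Schanuel's conjecture enters only in the search for weights and potentials. They can be
  chosen in the ring generated by the logarithms of the primes, and the conjecture makes these
  logarithms algebraically independent: an inequality \<open>P \<le> 0\<close> in that ring is either a formal identity
  \<open>P = 0\<close> or strict, and a strict one is detected by rational approximation.\<close>

section \<open>Structured programs for counter machines\<close>

text \<open>A certificate must be checkable letter by letter, whereas tracked paths, weights and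
  potential depend on the whole word. A certificate for big-O is therefore a finite automaton whose
  states carry several tokens, each guessing states of \<open>B\<close>, weights and a potential.
  Tokens are justified backwards: every token after a letter has a predecessor before it, so each
  token at hand stands for genuine paths of \<open>B\<close>, and at the end one good token
  suffices. Finitely many tokens are enough because a run matters only through its initial vertex
  and its set of edges, and finite ambiguity of \<open>B\<close> bounds the number of tracked paths.
  Certificates against big-O contain no logarithms: the weights of pumped loops are rational matrix
  entries and are compared exactly. Gordan's alternative is proved over the field generated by the
  logarithms; clearing denominators then brings the weights into the ring. If \<open>B\<close> has
  no accepting path on a word accepted by \<open>A\<close>, the family of tracked paths is empty, no
  nonzero \<open>y\<close> exists, and the pumping certificate arises from a vacuous
  condition.\<close>

datatype com = Skip | Inc nat | Dec nat | Seq com com | Wh nat com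

text \<open>A loop decrements its register before each run of the body, and the body may raise it
  again. This matches \<open>DEC\<close>, the only conditional instruction of the machine.\<close>

inductive exec :: "com \<Rightarrow> (nat \<Rightarrow> nat) \<Rightarrow> (nat \<Rightarrow> nat) \<Rightarrow> bool" where
  Skip: "exec Skip r r"
| Inc: "exec (Inc i) r (r(i := Suc (r i)))"
| Dec: "exec (Dec i) r (r(i := r i - 1))"
| Seq: "exec c r r' \<Longrightarrow> exec d r' r'' \<Longrightarrow> exec (Seq c d) r r''"
| WhF: "r i = 0 \<Longrightarrow> exec (Wh i c) r r"
| WhT: "r i = Suc k \<Longrightarrow> exec c (r(i := k)) r' \<Longrightarrow> exec (Wh i c) r' r'' \<Longrightarrow> exec (Wh i c) r r''"

fun clen :: "com \<Rightarrow> nat" where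
  "clen Skip = 0"
| "clen (Inc i) = 1"
| "clen (Dec i) = 1"
| "clen (Seq c d) = clen c + clen d"
| "clen (Wh i c) = clen c + 3"

text \<open>The jump back at the end of a loop is an increment of register 0 followed by a decrement
  of it, both of whose branches lead to the head of the loop.\<close>
fun compile :: "com \<Rightarrow> nat \<Rightarrow> instr list" where
  "compile Skip p = []"
| "compile (Inc i) p = [INC i (Suc p)]"
| "compile (Dec i) p = [DEC i (Suc p) (Suc p)]"
| "compile (Seq c d) p = compile c p @ compile d (p + clen c)"
| "compile (Wh i c) p = DEC i (Suc p) (p + clen c + 3) # compile c (Suc p)
     @ [INC 0 (p + clen c + 2), DEC 0 p p]"

lemma length_compile [simp]: "length (compile c p) = clen c"
  by (induction c arbitrary: p) auto

lemma steps_trans: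
  "(cm_step P ^^ s) c = c' \<Longrightarrow> (cm_step P ^^ t) c' = c'' \<Longrightarrow> (cm_step P ^^ (t + s)) c = c''"
  by (simp add: funpow_add)

lemma cm_step_INC:
  "p < length P \<Longrightarrow> P ! p = INC i j \<Longrightarrow> cm_step P (p, r) = (j, r(i := Suc (r i)))"
  by (simp add: cm_step_def)

lemma cm_step_DEC:
  "p < length P \<Longrightarrow> P ! p = DEC i j l \<Longrightarrow>
     cm_step P (p, r) = (if r i = 0 then (l, r) else (j, r(i := r i - 1)))"
  by (simp add: cm_step_def)

text \<open>Jump targets are absolute, so the code is considered at its position inside a
  surrounding program: \<open>pre\<close> fixes the offset, \<open>post\<close> is whatever
  follows.\<close>

lemma exec_compile:
  assumes "exec c r r'" and "P = pre @ compile c (length pre) @ post"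
  shows "\<exists>t. (cm_step P ^^ t) (length pre, r) = (length pre + clen c, r')"
  using assms
proof (induction arbitrary: pre post rule: exec.induct)
  case (Skip r)
  show ?case by (intro exI[of _ 0]) simp
next
  case (Inc i r)
  have "P ! length pre = INC i (Suc (length pre))" "length pre < length P" using Inc by simp_all
  then show ?case by (intro exI[of _ 1]) (simp add: cm_step_INC fun_upd_def)
next
  case (Dec i r)
  have "P ! length pre = DEC i (Suc (length pre)) (Suc (length pre))" "length pre < length P"
    using Dec by simp_all
  then show ?case by (intro exI[of _ 1]) (auto simp: cm_step_DEC fun_eq_iff)
next
  case (Seq c r r' d r'')
  obtain s where s: "(cm_step P ^^ s) (length pre, r) = (length pre + clen c, r')"
    using Seq.IH(1)[of pre "compile d (length pre + clen c) @ post"] Seq.prems by auto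
  obtain t where t: "(cm_step P ^^ t) (length pre + clen c, r') = (length pre + clen c + clen d, r'')"
    using Seq.IH(2)[of "pre @ compile c (length pre)" post] Seq.prems by auto
  show ?case using steps_trans[OF s t] by (auto simp: add.assoc)
next
  case (WhF r i c)
  have "P ! length pre = DEC i (Suc (length pre)) (length pre + clen c + 3)" "length pre < length P"
    using WhF by simp_all
  then show ?case using WhF by (intro exI[of _ 1]) (simp add: cm_step_DEC)
next
  case (WhT r i k c r' r'')
  let ?p = "length pre"
  have P: "P ! ?p = DEC i (Suc ?p) (?p + clen c + 3)" "?p < length P"
    "P ! (?p + clen c + 1) = INC 0 (?p + clen c + 2)" "?p + clen c + 1 < length P"
    "P ! (?p + clen c + 2) = DEC 0 ?p ?p" "?p + clen c + 2 < length P"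
    using WhT.prems by (simp_all add: nth_append)
  have s: "(cm_step P ^^ 1) (?p, r) = (Suc ?p, r(i := k))"
    using P WhT.hyps by (simp add: cm_step_DEC)
  obtain t where t: "(cm_step P ^^ t) (Suc ?p, r(i := k)) = (Suc ?p + clen c, r')"
    using WhT.IH(1)[of "pre @ [DEC i (Suc ?p) (?p + clen c + 3)]"
        "[INC 0 (?p + clen c + 2), DEC 0 ?p ?p] @ post"] WhT.prems by (auto simp: fun_upd_def)
  have u: "(cm_step P ^^ 2) (Suc ?p + clen c, r') = (?p, r')"
    using P by (simp add: numeral_2_eq_2 cm_step_INC cm_step_DEC)
  obtain v where v: "(cm_step P ^^ v) (?p, r') = (?p + clen (Wh i c), r'')"
    using WhT.IH(2)[of pre post] WhT.prems by auto
  show ?case using steps_trans[OF steps_trans[OF steps_trans[OF s t] u] v] by blast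
qed

lemma exec_cm_computes:
  assumes "exec c ((\<lambda>_. 0)(0 := x)) r" and "r 0 = y"
  shows "cm_computes (compile c 0) x y"
proof -
  obtain t where "(cm_step (compile c 0) ^^ t) (0, (\<lambda>_. 0)(0 := x)) = (clen c, r)"
    using exec_compile[OF assms(1), of "compile c 0" "[]" "[]"] by auto
  then show ?thesis
    unfolding cm_computes_def cm_run_def cm_halted_def
    using assms(2) by (intro exI[of _ t]) simp
qed

fun incs :: "nat list \<Rightarrow> com" where
  "incs [] = Skip"
| "incs (j # js) = Seq (Inc j) (incs js)"

lemma exec_incs:
  "distinct js \<Longrightarrow> exec (incs js) r (\<lambda>x. if x \<in> set js then Suc (r x) else r x)"
proof (induction js arbitrary: r)
  case Nil
  then show ?case using exec.Skip[of r] by simp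
next
  case (Cons j js)
  have "exec (incs js) (r(j := Suc (r j)))
     (\<lambda>x. if x \<in> set js then Suc ((r(j := Suc (r j))) x) else (r(j := Suc (r j))) x)"
    using Cons by simp
  moreover have "(\<lambda>x. if x \<in> set js then Suc ((r(j := Suc (r j))) x) else (r(j := Suc (r j))) x)
    = (\<lambda>x. if x \<in> set (j # js) then Suc (r x) else r x)"
    using Cons.prems by auto
  ultimately show ?case using exec.Seq[OF exec.Inc] by simp
qed

text \<open>Registers can only be read by counting them down, so a copy is a move to two targets
  followed by a move back; \<open>js = []\<close> clears register \<open>i\<close>.\<close>

definition move :: "nat \<Rightarrow> nat list \<Rightarrow> com" where
  "move i js = Wh i (incs js)"

lemma exec_move:
  assumes "distinct js" "i \<notin> set js"
  shows "exec (move i js) r (\<lambda>x. if x = i then 0 else if x \<in> set js then r x + r i else r x)"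
proof -
  have "exec (Wh i (incs js)) r (\<lambda>x. if x = i then 0 else if x \<in> set js then r x + k else r x)"
    if "r i = k" for k
    using that
  proof (induction k arbitrary: r)
    case 0
    have "(\<lambda>x. if x = i then 0 else if x \<in> set js then r x + 0 else r x) = r"
      using 0 by auto
    then show ?case using exec.WhF[of r i "incs js"] 0 by simp
  next
    case (Suc k)
    let ?r' = "\<lambda>x. if x \<in> set js then Suc ((r(i := k)) x) else (r(i := k)) x"
    have "?r' i = k" using assms by simp
    from exec.WhT[OF Suc.prems exec_incs[OF assms(1)] Suc.IH[of ?r', OF this]]
    show ?case
      by (rule back_subst[of "exec (Wh i (incs js)) r"]) (use assms in auto)
  qed
  then show ?thesis by (simp add: move_def)
qed

lemma exec_eqI: "exec c r r' \<Longrightarrow> r' = r'' \<Longrightarrow> exec c r r''"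
  by simp

lemma exec_eqI2: "exec c r r' \<Longrightarrow> r = s \<Longrightarrow> r' = s' \<Longrightarrow> exec c s s'"
  by simp

lemma exec_move':
  "distinct js \<Longrightarrow> i \<notin> set js \<Longrightarrow>
    (\<lambda>x. if x = i then 0 else if x \<in> set js then r x + r i else r x) = r' \<Longrightarrow> exec (move i js) r r'"
  using exec_move by blast

text \<open>Registers above \<open>b\<close> are scratch space: zero before and after the computation.\<close>
definition cfun :: "(nat \<Rightarrow> nat) \<Rightarrow> bool" where
  "cfun f \<longleftrightarrow> (\<forall>b. \<exists>c. \<forall>r. (\<forall>j>b. r j = 0) \<longrightarrow> exec c r (r(b := f (r b))))"

lemma cfunI:
  "(\<And>b. \<exists>c. \<forall>r. (\<forall>j>b. r j = 0) \<longrightarrow> exec c r (r(b := f (r b)))) \<Longrightarrow> cfun f"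
  by (simp add: cfun_def)

lemma cfunD:
  "cfun f \<Longrightarrow> \<exists>c. \<forall>r. (\<forall>j>b. r j = 0) \<longrightarrow> exec c r (r(b := f (r b)))"
  unfolding cfun_def by blast

lemma cfun_id: "cfun (\<lambda>x. x)"
proof (rule cfunI)
  fix b
  show "\<exists>c. \<forall>r. (\<forall>j>b. r j = 0) \<longrightarrow> exec c r (r(b := r b))"
    by (intro exI[of _ Skip]) (simp add: exec.Skip)
qed

lemma cfun_Suc: "cfun Suc"
  unfolding cfun_def using exec.Inc by blast

lemma cfun_zero: "cfun (\<lambda>_. 0)"
proof (rule cfunI)
  fix b
  show "\<exists>c. \<forall>r. (\<forall>j>b. r j = 0) \<longrightarrow> exec c r (r(b := 0))"
    by (intro exI[of _ "move b []"] allI impI exec_move') auto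
qed

lemma cfun_comp:
  assumes "cfun f" "cfun g" shows "cfun (\<lambda>x. f (g x))"
proof (rule cfunI)
  fix b
  obtain c where c: "\<And>r. (\<forall>j>b. r j = 0) \<Longrightarrow> exec c r (r(b := f (r b)))"
    using cfunD[OF assms(1), of "b"] by blast
  obtain d where d: "\<And>r. (\<forall>j>b. r j = 0) \<Longrightarrow> exec d r (r(b := g (r b)))"
    using cfunD[OF assms(2), of "b"] by blast
  have "exec (Seq d c) r (r(b := f (g (r b))))" if "\<forall>j>b. r j = 0" for r
    using exec.Seq[OF d[OF that] c] that by simp
  then show "\<exists>c. \<forall>r. (\<forall>j>b. r j = 0) \<longrightarrow> exec c r (r(b := f (g (r b))))" by blast
qed

text \<open>Sums \<open>k + ... + 1\<close> for the content \<open>k\<close> of \<open>b+2\<close>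
  into \<open>b+3\<close>: each round adds the current counter, which is restored from its copy in
  \<open>b+4\<close>.\<close>

definition triloop :: "nat \<Rightarrow> com" where
  "triloop b = Wh (b+2) (Seq (Inc (b+3)) (Seq (move (b+2) [b+3, b+4]) (move (b+4) [b+2])))"

text \<open>Cantor's formula \<open>prod_encode (m, n) = triangle (m + n) + m\<close>, with
  \<open>m\<close> in register \<open>b+1\<close> and \<open>n\<close> in \<open>b\<close>.\<close>

definition pairc :: "nat \<Rightarrow> com" where
  "pairc b = Seq (move (b+1) [b+2, b+3]) (Seq (move b [b+2])
     (Seq (triloop b) (move (b+3) [b])))"

lemma exec_triloop:
  assumes "r (b+4) = 0"
  shows "exec (triloop b) r (r(b+2 := 0, b+3 := r (b+3) + triangle (r (b+2))))"
proof -
  have "exec (triloop b) r (r(b+2 := 0, b+3 := r (b+3) + triangle k))"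
    if "r (b+2) = k" "r (b+4) = 0" for k
    using that
  proof (induction k arbitrary: r)
    case 0
    show ?case unfolding triloop_def
      by (rule exec_eqI[OF exec.WhF]) (use 0 in \<open>auto simp: fun_eq_iff\<close>)
  next
    case (Suc k)
    let ?r1 = "r(b+2 := k)"
    let ?r2 = "?r1(b+3 := Suc (?r1 (b+3)))"
    let ?r3 = "?r2(b+2 := 0, b+3 := ?r2 (b+3) + k, b+4 := k)"
    let ?r4 = "r(b+2 := k, b+3 := r (b+3) + Suc k)"
    have e1: "exec (Inc (b+3)) ?r1 ?r2" by (rule exec.Inc)
    have e2: "exec (move (b+2) [b+3, b+4]) ?r2 ?r3"
      by (rule exec_move') (use Suc.prems in auto)
    have e3: "exec (move (b+4) [b+2]) ?r3 ?r4"
      by (rule exec_move') (use Suc.prems in \<open>auto simp: fun_eq_iff\<close>)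
    have "exec (triloop b) ?r4 (?r4(b+2 := 0, b+3 := ?r4 (b+3) + triangle k))"
      by (rule Suc.IH) (use Suc.prems in auto)
    from exec.WhT[of r "b+2", OF Suc.prems(1) exec.Seq[OF e1 exec.Seq[OF e2 e3]]
        this[unfolded triloop_def]]
    show ?case unfolding triloop_def
      by (rule exec_eqI) (auto simp: fun_eq_iff)
  qed
  then show ?thesis using assms by blast
qed

lemma exec_pairc:
  assumes "\<forall>j>b+1. r j = 0"
  shows "exec (pairc b) r (r(b := prod_encode (r (b+1), r b), b+1 := 0))"
proof -
  let ?m = "r (b+1)" and ?n = "r b"
  let ?r1 = "r(b+1 := 0, b+2 := ?m, b+3 := ?m)"
  let ?r2 = "r(b := 0, b+1 := 0, b+2 := ?m + ?n, b+3 := ?m)"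
  let ?r3 = "?r2(b+2 := 0, b+3 := ?r2 (b+3) + triangle (?r2 (b+2)))"
  have e1: "exec (move (b+1) [b+2, b+3]) r ?r1"
    by (rule exec_move') (use assms in \<open>auto simp: fun_eq_iff\<close>)
  have e2: "exec (move b [b+2]) ?r1 ?r2"
    by (rule exec_move') (use assms in \<open>auto simp: fun_eq_iff\<close>)
  have e3: "exec (triloop b) ?r2 ?r3"
    by (rule exec_triloop) (use assms in auto)
  have e4: "exec (move (b+3) [b]) ?r3 (r(b := prod_encode (r (b+1), r b), b+1 := 0))"
    by (rule exec_move') (use assms in \<open>auto simp: fun_eq_iff prod_encode_def\<close>)
  show ?thesis unfolding pairc_def
    using exec.Seq[OF e1 exec.Seq[OF e2 exec.Seq[OF e3 e4]]] .
qed

text \<open>Both components are computed at register \<open>b+1\<close>, so that the value parked in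
  \<open>b\<close>, first the input and then \<open>g x\<close>, lies below the registers that the
  subprogram touches.\<close>

lemma cfun_pair:
  assumes "cfun f" "cfun g" shows "cfun (\<lambda>x. prod_encode (f x, g x))"
proof (rule cfunI)
  fix b
  obtain c where c: "\<And>r. (\<forall>j>b+1. r j = 0) \<Longrightarrow> exec c r (r(b+1 := f (r (b+1))))"
    using cfunD[OF assms(1), of "b+1"] by blast
  obtain d where d: "\<And>r. (\<forall>j>b+1. r j = 0) \<Longrightarrow> exec d r (r(b+1 := g (r (b+1))))"
    using cfunD[OF assms(2), of "b+1"] by blast
  let ?c = "Seq (move b [b+1, b+2]) (Seq (move (b+2) [b]) (Seq d (Seq (move b [b+2])
     (Seq (move (b+1) [b]) (Seq (move (b+2) [b+1]) (Seq c (pairc b)))))))"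
  have "exec ?c r (r(b := prod_encode (f (r b), g (r b))))" if z: "\<forall>j>b. r j = 0" for r
  proof -
    let ?x = "r b"
    let ?r2 = "r(b+1 := ?x)"
    let ?r3 = "r(b+1 := g ?x)"
    let ?r6 = "r(b := g ?x, b+1 := ?x)"
    let ?r7 = "r(b := g ?x, b+1 := f ?x)"
    have e1: "exec (move b [b+1, b+2]) r (r(b := 0, b+1 := ?x, b+2 := ?x))"
      by (rule exec_move') (use z in \<open>auto simp: fun_eq_iff\<close>)
    have e2: "exec (move (b+2) [b]) (r(b := 0, b+1 := ?x, b+2 := ?x)) ?r2"
      by (rule exec_move') (use z in \<open>auto simp: fun_eq_iff\<close>)
    have e3: "exec d ?r2 ?r3"
      by (rule exec_eqI[OF d]) (use z in \<open>auto simp: fun_eq_iff\<close>)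
    have e4: "exec (move b [b+2]) ?r3 (?r3(b := 0, b+2 := ?x))"
      by (rule exec_move') (use z in \<open>auto simp: fun_eq_iff\<close>)
    have e5: "exec (move (b+1) [b]) (?r3(b := 0, b+2 := ?x)) (r(b := g ?x, b+1 := 0, b+2 := ?x))"
      by (rule exec_move') (use z in \<open>auto simp: fun_eq_iff\<close>)
    have e6: "exec (move (b+2) [b+1]) (r(b := g ?x, b+1 := 0, b+2 := ?x)) ?r6"
      by (rule exec_move') (use z in \<open>auto simp: fun_eq_iff\<close>)
    have e7: "exec c ?r6 ?r7"
      by (rule exec_eqI[OF c]) (use z in \<open>auto simp: fun_eq_iff\<close>)
    have e8: "exec (pairc b) ?r7 (r(b := prod_encode (f ?x, g ?x)))"
      by (rule exec_eqI[OF exec_pairc]) (use z in \<open>auto simp: fun_eq_iff\<close>)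
    show ?thesis
      using exec.Seq[OF e1 exec.Seq[OF e2 exec.Seq[OF e3 exec.Seq[OF e4 exec.Seq[OF e5
        exec.Seq[OF e6 exec.Seq[OF e7 e8]]]]]]] .
  qed
  then show "\<exists>c. \<forall>r. (\<forall>j>b. r j = 0) \<longrightarrow> exec c r (r(b := prod_encode (f (r b), g (r b))))"
    by blast
qed

text \<open>The Cantor enumeration follows antidiagonals and starts the next one when
  \<open>n\<close> is 0. Decoding thus needs only a counter that steps through the
  enumeration.\<close>

lemma prod_decode_Suc:
  "prod_decode (Suc x) = (case prod_decode x of (m, n) \<Rightarrow> if n = 0 then (0, Suc m) else (Suc m, n - 1))"
proof -
  obtain m n where mn: "prod_decode x = (m, n)" by fastforce
  then have x: "x = prod_encode (m, n)" by (metis prod_decode_inverse)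
  show ?thesis
  proof (cases n)
    case 0
    have "Suc x = prod_encode (0, Suc m)" using 0 x by (simp add: prod_encode_def)
    then show ?thesis using mn 0 by (simp add: prod_encode_inverse)
  next
    case (Suc k)
    have "Suc x = prod_encode (Suc m, k)" using Suc x by (simp add: prod_encode_def)
    then show ?thesis using mn Suc by (simp add: prod_encode_inverse)
  qed
qed

text \<open>Steps through the enumeration of pairs: register \<open>b\<close> counts down while \<open>(b + 1, b + 2)\<close>
  advances; \<open>b + 4\<close> and \<open>b + 5\<close> are the flags for \<open>n = 0\<close> and \<open>n > 0\<close>.\<close>
definition unpairbody :: "nat \<Rightarrow> com" where
  "unpairbody b = Seq (Inc (b+4)) (Seq (Wh (b+2) (Seq (Inc (b+3)) (Seq (move (b+4) [])
     (Seq (move (b+5) []) (Inc (b+5)))))) (Seq (move (b+3) [b+2])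
     (Seq (Wh (b+5) (Seq (Dec (b+2)) (Inc (b+1))))
       (Wh (b+4) (Seq (move (b+1) [b+2]) (Inc (b+2)))))))"

lemma exec_unpairbody:
  assumes z: "\<forall>j>b+2. r j = 0"
  shows "exec (unpairbody b) r
     (if r (b+2) = 0 then r(b+1 := 0, b+2 := Suc (r (b+1))) else r(b+1 := Suc (r (b+1)), b+2 := r (b+2) - 1))"
proof -
  let ?c = "Seq (Inc (b+3)) (Seq (move (b+4) []) (Seq (move (b+5) []) (Inc (b+5))))"
  \<comment> \<open>This loop is the zero test: a single round already turns the flag
    \<open>b+4\<close> off and \<open>b+5\<close> on, while the content of \<open>b+2\<close> is
    saved in \<open>b+3\<close>.\<close>
  have loop: "exec (Wh (b+2) ?c) s
      (if k = 0 then s else s(b+2 := 0, b+3 := s (b+3) + k, b+4 := 0, b+5 := 1))" if "s (b+2) = k" for s k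
    using that
  proof (induction k arbitrary: s)
    case 0
    then show ?case using exec.WhF by simp
  next
    case (Suc k)
    let ?s1 = "s(b+2 := k)"
    let ?s4 = "s(b+2 := k, b+3 := Suc (s (b+3)), b+4 := 0, b+5 := 1)"
    have e1: "exec (Inc (b+3)) ?s1 (?s1(b+3 := Suc (?s1 (b+3))))" by (rule exec.Inc)
    have e2: "exec (move (b+4) []) (?s1(b+3 := Suc (?s1 (b+3)))) (?s1(b+3 := Suc (?s1 (b+3)), b+4 := 0))"
      by (rule exec_move') auto
    have e3: "exec (move (b+5) []) (?s1(b+3 := Suc (?s1 (b+3)), b+4 := 0))
       (?s1(b+3 := Suc (?s1 (b+3)), b+4 := 0, b+5 := 0))"
      by (rule exec_move') auto
    have e4: "exec (Inc (b+5)) (?s1(b+3 := Suc (?s1 (b+3)), b+4 := 0, b+5 := 0)) ?s4"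
      by (rule exec_eqI[OF exec.Inc]) (auto simp: fun_eq_iff)
    have "exec (Wh (b+2) ?c) ?s4 (if k = 0 then ?s4 else ?s4(b+2 := 0, b+3 := ?s4 (b+3) + k, b+4 := 0, b+5 := 1))"
      by (rule Suc.IH) simp
    from exec.WhT[of s "b+2", OF Suc.prems exec.Seq[OF e1 exec.Seq[OF e2 exec.Seq[OF e3 e4]]] this]
    show ?case by (rule exec_eqI) (auto simp: fun_eq_iff)
  qed
  let ?m = "r (b+1)" and ?n = "r (b+2)"
  let ?r1 = "r(b+4 := 1)"
  have e1: "exec (Inc (b+4)) r ?r1" by (rule exec_eqI[OF exec.Inc]) (use z in \<open>auto simp: fun_eq_iff\<close>)
  show ?thesis
  proof (cases "?n = 0")
    case True
    have e2: "exec (Wh (b+2) ?c) ?r1 ?r1" using loop[of ?r1 0] True by simp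
    have e3: "exec (move (b+3) [b+2]) ?r1 ?r1"
      by (rule exec_move') (use z True in \<open>auto simp: fun_eq_iff\<close>)
    have e4: "exec (Wh (b+5) (Seq (Dec (b+2)) (Inc (b+1)))) ?r1 ?r1"
      by (rule exec.WhF) (use z in auto)
    let ?r5 = "r(b+1 := 0, b+2 := Suc ?m)"
    have e5a: "exec (move (b+1) [b+2]) (?r1(b+4 := 0)) (r(b+1 := 0, b+2 := ?m))"
      by (rule exec_move') (use z True in \<open>auto simp: fun_eq_iff\<close>)
    have e5b: "exec (Inc (b+2)) (r(b+1 := 0, b+2 := ?m)) ?r5"
      by (rule exec_eqI[OF exec.Inc]) (auto simp: fun_eq_iff)
    have "exec (Wh (b+4) (Seq (move (b+1) [b+2]) (Inc (b+2)))) ?r5 ?r5"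
      by (rule exec.WhF) (use z in auto)
    then have e5: "exec (Wh (b+4) (Seq (move (b+1) [b+2]) (Inc (b+2)))) ?r1 ?r5"
      by (rule exec.WhT[where k=0, OF _ exec.Seq[OF e5a e5b], rotated]) simp
    show ?thesis unfolding unpairbody_def using True
        exec.Seq[OF e1 exec.Seq[OF e2 exec.Seq[OF e3 exec.Seq[OF e4 e5]]]] by simp
  next
    case False
    let ?r2 = "r(b+2 := 0, b+3 := ?n, b+5 := 1)"
    have e2: "exec (Wh (b+2) ?c) ?r1 ?r2"
      by (rule exec_eqI[OF loop[of ?r1 ?n]]) (use z False in \<open>auto simp: fun_eq_iff\<close>)
    have e3: "exec (move (b+3) [b+2]) ?r2 (r(b+5 := 1))"
      by (rule exec_move') (use z False in \<open>auto simp: fun_eq_iff\<close>)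
    let ?r5 = "r(b+1 := Suc ?m, b+2 := ?n - 1)"
    have e4a: "exec (Dec (b+2)) (r(b+5 := 1, b+5 := 0)) (r(b+2 := ?n - 1))"
      by (rule exec_eqI[OF exec.Dec]) (use z in \<open>auto simp: fun_eq_iff\<close>)
    have e4b: "exec (Inc (b+1)) (r(b+2 := ?n - 1)) ?r5"
      by (rule exec_eqI[OF exec.Inc]) (auto simp: fun_eq_iff)
    have "exec (Wh (b+5) (Seq (Dec (b+2)) (Inc (b+1)))) ?r5 ?r5"
      by (rule exec.WhF) (use z in auto)
    then have e4: "exec (Wh (b+5) (Seq (Dec (b+2)) (Inc (b+1)))) (r(b+5 := 1)) ?r5"
      by (rule exec.WhT[where k=0, OF _ exec.Seq[OF e4a e4b], rotated]) simp
    have e5: "exec (Wh (b+4) (Seq (move (b+1) [b+2]) (Inc (b+2)))) ?r5 ?r5"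
      by (rule exec.WhF) (use z in auto)
    show ?thesis unfolding unpairbody_def using False
        exec.Seq[OF e1 exec.Seq[OF e2 exec.Seq[OF e3 exec.Seq[OF e4 e5]]]] by simp
  qed
qed

lemma exec_unpair:
  assumes "\<forall>j>b. r j = 0"
  shows "exec (Wh b (unpairbody b)) r
     (r(b := 0, b+1 := fst (prod_decode (r b)), b+2 := snd (prod_decode (r b))))"
proof -
  have d0: "prod_decode 0 = (0, 0)"
    using prod_encode_inverse[of "(0,0)"] by (simp add: prod_encode_def)
  \<comment> \<open>Generalised to a start at an arbitrary pair \<open>prod_decode x\<close>, since
    each round leaves the enumeration one position further.\<close>
  have "exec (Wh b (unpairbody b))
      (r(b := k, b+1 := fst (prod_decode x), b+2 := snd (prod_decode x)))
      (r(b := 0, b+1 := fst (prod_decode (x + k)), b+2 := snd (prod_decode (x + k))))" for k x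
  proof (induction k arbitrary: x)
    case 0
    then show ?case using exec.WhF by simp
  next
    case (Suc k)
    let ?s = "r(b := k, b+1 := fst (prod_decode x), b+2 := snd (prod_decode x))"
    have z: "\<forall>j>b+2. ?s j = 0" using assms by auto
    have e: "exec (unpairbody b) (r(b := Suc k, b+1 := fst (prod_decode x), b+2 := snd (prod_decode x), b := k))
       (r(b := k, b+1 := fst (prod_decode (Suc x)), b+2 := snd (prod_decode (Suc x))))"
      by (rule exec_eqI2[OF exec_unpairbody[OF z]])
        (auto simp: fun_eq_iff prod_decode_Suc split: prod.splits)
    show ?case by (rule exec_eqI[OF exec.WhT[OF _ e Suc.IH]]) auto
  qed
  from this[of "r b" 0] show ?thesis
    by (rule exec_eqI2) (use assms d0 in \<open>auto simp: fun_eq_iff\<close>)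
qed

lemma cfun_fst: "cfun (\<lambda>x. fst (prod_decode x))"
proof (rule cfunI)
  fix b
  have "exec (Seq (Wh b (unpairbody b)) (Seq (move (b+1) [b]) (move (b+2) []))) r (r(b := fst (prod_decode (r b))))"
    if z: "\<forall>j>b. r j = 0" for r
  proof -
    let ?m = "fst (prod_decode (r b))" and ?n = "snd (prod_decode (r b))"
    have e2: "exec (move (b+1) [b]) (r(b := 0, b+1 := ?m, b+2 := ?n)) (r(b := ?m, b+2 := ?n))"
      by (rule exec_move') (use z in \<open>auto simp: fun_eq_iff\<close>)
    have e3: "exec (move (b+2) []) (r(b := ?m, b+2 := ?n)) (r(b := ?m))"
      by (rule exec_move') (use z in \<open>auto simp: fun_eq_iff\<close>)
    show ?thesis using exec.Seq[OF exec_unpair[OF z] exec.Seq[OF e2 e3]] .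
  qed
  then show "\<exists>c. \<forall>r. (\<forall>j>b. r j = 0) \<longrightarrow> exec c r (r(b := fst (prod_decode (r b))))" by blast
qed

lemma cfun_snd: "cfun (\<lambda>x. snd (prod_decode x))"
proof (rule cfunI)
  fix b
  have "exec (Seq (Wh b (unpairbody b)) (Seq (move (b+2) [b]) (move (b+1) []))) r (r(b := snd (prod_decode (r b))))"
    if z: "\<forall>j>b. r j = 0" for r
  proof -
    let ?m = "fst (prod_decode (r b))" and ?n = "snd (prod_decode (r b))"
    have e2: "exec (move (b+2) [b]) (r(b := 0, b+1 := ?m, b+2 := ?n)) (r(b := ?n, b+1 := ?m))"
      by (rule exec_move') (use z in \<open>auto simp: fun_eq_iff\<close>)
    have e3: "exec (move (b+1) []) (r(b := ?n, b+1 := ?m)) (r(b := ?n))"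
      by (rule exec_move') (use z in \<open>auto simp: fun_eq_iff\<close>)
    show ?thesis using exec.Seq[OF exec_unpair[OF z] exec.Seq[OF e2 e3]] .
  qed
  then show "\<exists>c. \<forall>r. (\<forall>j>b. r j = 0) \<longrightarrow> exec c r (r(b := snd (prod_decode (r b))))" by blast
qed

text \<open>Iteration with the count as part of the input is the one recursion scheme provided;
  arithmetic and list recursion are reduced to it below.\<close>

lemma cfun_iter:
  assumes "cfun f" shows "cfun (\<lambda>x. (f ^^ fst (prod_decode x)) (snd (prod_decode x)))"
proof (rule cfunI)
  fix b
  obtain c where c: "\<And>r. (\<forall>j>b+1. r j = 0) \<Longrightarrow> exec c r (r(b+1 := f (r (b+1))))"
    using cfunD[OF assms, of "b+1"] by blast
  have loop: "exec (Wh b c) r (r(b := 0, b+1 := (f ^^ k) (r (b+1))))"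
    if "r b = k" "\<forall>j>b+1. r j = 0" for r k
    using that
  proof (induction k arbitrary: r)
    case 0
    show ?case by (rule exec_eqI[OF exec.WhF]) (use 0 in \<open>auto simp: fun_eq_iff\<close>)
  next
    case (Suc k)
    let ?r1 = "r(b := k, b+1 := f (r (b+1)))"
    have e: "exec c (r(b := k)) ?r1"
      by (rule exec_eqI[OF c]) (use Suc.prems in auto)
    have "exec (Wh b c) ?r1 (?r1(b := 0, b+1 := (f ^^ k) (?r1 (b+1))))"
      by (rule Suc.IH) (use Suc.prems in auto)
    from exec.WhT[OF Suc.prems(1) e this] show ?case
      by (rule exec_eqI) (auto simp: funpow_swap1 fun_eq_iff)
  qed
  let ?c = "Seq (Wh b (unpairbody b)) (Seq (move (b+1) [b]) (Seq (move (b+2) [b+1])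
      (Seq (Wh b c) (move (b+1) [b]))))"
  have "exec ?c r (r(b := (f ^^ fst (prod_decode (r b))) (snd (prod_decode (r b)))))"
    if z: "\<forall>j>b. r j = 0" for r
  proof -
    let ?m = "fst (prod_decode (r b))" and ?n = "snd (prod_decode (r b))"
    let ?v = "(f ^^ ?m) ?n"
    have e2: "exec (move (b+1) [b]) (r(b := 0, b+1 := ?m, b+2 := ?n)) (r(b := ?m, b+2 := ?n))"
      by (rule exec_move') (use z in \<open>auto simp: fun_eq_iff\<close>)
    have e3: "exec (move (b+2) [b+1]) (r(b := ?m, b+2 := ?n)) (r(b := ?m, b+1 := ?n))"
      by (rule exec_move') (use z in \<open>auto simp: fun_eq_iff\<close>)
    have e4: "exec (Wh b c) (r(b := ?m, b+1 := ?n)) (r(b := 0, b+1 := ?v))"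
      by (rule exec_eqI[OF loop[of _ ?m]]) (use z in auto)
    have e5: "exec (move (b+1) [b]) (r(b := 0, b+1 := ?v)) (r(b := ?v))"
      by (rule exec_move') (use z in \<open>auto simp: fun_eq_iff\<close>)
    show ?thesis
      using exec.Seq[OF exec_unpair[OF z] exec.Seq[OF e2 exec.Seq[OF e3 exec.Seq[OF e4 e5]]]] .
  qed
  then show "\<exists>c. \<forall>r. (\<forall>j>b. r j = 0) \<longrightarrow>
      exec c r (r(b := (f ^^ fst (prod_decode (r b))) (snd (prod_decode (r b)))))" by blast
qed

text \<open>Minimisation. The first zero \<open>t\<close> of \<open>g\<close> is handed to
  \<open>f\<close>, so a single program finds a certificate and reads the verdict off it. Nothing is
  claimed if there is no zero.\<close>

lemma cfun_search:
  assumes g: "cfun g" and f: "cfun f"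
  shows "\<exists>P. \<forall>x t. g (prod_encode (x, t)) = 0 \<and> (\<forall>s<t. g (prod_encode (x, s)) \<noteq> 0)
            \<longrightarrow> cm_computes P x (f (prod_encode (x, t)))"
proof -
  have i: "cfun (\<lambda>x. prod_encode (x, 0))" by (intro cfun_pair cfun_id cfun_zero)
  have n: "cfun (\<lambda>y. prod_encode (fst (prod_decode y), Suc (snd (prod_decode y))))"
    by (intro cfun_pair cfun_fst cfun_comp[OF cfun_Suc] cfun_snd)
  obtain ci where ci: "\<And>r. (\<forall>j>0. r j = 0) \<Longrightarrow> exec ci r (r(0 := prod_encode (r 0, 0)))"
    using cfunD[OF i, of "0"] by blast
  obtain cn where cn: "\<And>r. (\<forall>j>0. r j = 0) \<Longrightarrow>
     exec cn r (r(0 := prod_encode (fst (prod_decode (r 0)), Suc (snd (prod_decode (r 0))))))"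
    using cfunD[OF n, of "0"] by blast
  obtain cf where cf: "\<And>r. (\<forall>j>0. r j = 0) \<Longrightarrow> exec cf r (r(0 := f (r 0)))"
    using cfunD[OF f, of "0"] by blast
  obtain cg where cg: "\<And>r. (\<forall>j>1. r j = 0) \<Longrightarrow> exec cg r (r(1 := g (r 1)))"
    using cfunD[OF g, of "1"] by blast
  define test where "test = Seq (move 0 [1, 2]) (Seq (move 2 [0]) cg)"
  define st where "st x y = (\<lambda>_ :: nat. 0 :: nat)(0 := x, 1 := y)" for x y
  have test: "exec test (st x 0) (st x (g x))" for x
  proof -
    have e1: "exec (move 0 [1, 2]) (st x 0) ((\<lambda>_. 0)(1 := x, 2 := x))"
      by (rule exec_move') (auto simp: fun_eq_iff st_def)
    have e2: "exec (move 2 [0]) ((\<lambda>_. 0)(1 := x, 2 := x)) (st x x)"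
      by (rule exec_move') (auto simp: fun_eq_iff st_def)
    have e3: "exec cg (st x x) (st x (g x))"
      by (rule exec_eqI[OF cg]) (auto simp: fun_eq_iff st_def)
    show ?thesis unfolding test_def using exec.Seq[OF e1 exec.Seq[OF e2 e3]] .
  qed
  define body where "body = Seq (move 1 []) (Seq cn test)"
  have body: "exec body (st (prod_encode (x, t)) y)
      (st (prod_encode (x, Suc t)) (g (prod_encode (x, Suc t))))" for x t y
  proof -
    have e1: "exec (move 1 []) (st (prod_encode (x, t)) y) (st (prod_encode (x, t)) 0)"
      by (rule exec_move') (auto simp: fun_eq_iff st_def)
    have e2: "exec cn (st (prod_encode (x, t)) 0) (st (prod_encode (x, Suc t)) 0)"
      by (rule exec_eqI[OF cn]) (auto simp: fun_eq_iff st_def prod_encode_inverse)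
    show ?thesis unfolding body_def using exec.Seq[OF e1 exec.Seq[OF e2 test]] .
  qed
  \<comment> \<open>Induction runs backwards, from the successful \<open>t\<close> to smaller
    starting points \<open>s\<close>.\<close>
  have loop: "exec (Wh 1 body) (st (prod_encode (x, s)) (g (prod_encode (x, s)))) (st (prod_encode (x, t)) 0)"
    if "g (prod_encode (x, t)) = 0" "\<forall>s<t. g (prod_encode (x, s)) \<noteq> 0" "s \<le> t" for x s t
    using that(3)
  proof (induction rule: inc_induct)
    case base
    have "st (prod_encode (x, t)) 0 1 = 0" by (simp add: st_def)
    then show ?case unfolding that(1) by (rule exec.WhF)
  next
    case (step s)
    have "g (prod_encode (x, s)) \<noteq> 0" using step that(2) by blast
    then obtain k where k: "g (prod_encode (x, s)) = Suc k" by (meson not0_implies_Suc)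
    have u: "(st (prod_encode (x, s)) (g (prod_encode (x, s))))(1 := k) = st (prod_encode (x, s)) k"
      by (auto simp: st_def)
    have "st (prod_encode (x, s)) (g (prod_encode (x, s))) 1 = Suc k" using k by (simp add: st_def)
    moreover have "exec body ((st (prod_encode (x, s)) (g (prod_encode (x, s))))(1 := k))
        (st (prod_encode (x, Suc s)) (g (prod_encode (x, Suc s))))"
      unfolding u by (rule body)
    ultimately show ?case using step.IH by (rule exec.WhT)
  qed
  let ?P = "Seq ci (Seq test (Seq (Wh 1 body) cf))"
  have "cm_computes (compile ?P 0) x (f (prod_encode (x, t)))"
    if t: "g (prod_encode (x, t)) = 0" "\<forall>s<t. g (prod_encode (x, s)) \<noteq> 0" for x t
  proof -
    have e1: "exec ci ((\<lambda>_. 0)(0 := x)) (st (prod_encode (x, 0)) 0)"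
      by (rule exec_eqI[OF ci]) (auto simp: fun_eq_iff st_def)
    have e4: "exec cf (st (prod_encode (x, t)) 0) (st (f (prod_encode (x, t))) 0)"
      by (rule exec_eqI[OF cf]) (auto simp: fun_eq_iff st_def)
    have "exec ?P ((\<lambda>_. 0)(0 := x)) (st (f (prod_encode (x, t))) 0)"
      using exec.Seq[OF e1 exec.Seq[OF test exec.Seq[OF loop[OF t] e4]]] by simp
    from exec_cm_computes[OF this] show ?thesis by (simp add: st_def)
  qed
  then show ?thesis by blast
qed

section \<open>Computable functions on encodable types\<close>

text \<open>Bijectivity, and not merely injectivity: every number is the code of a value, so
  counting through the naturals enumerates all certificates without a test for valid codes.\<close>

class enc =
  fixes enc :: "'a \<Rightarrow> nat"
  assumes bij_enc: "bij enc"

instantiation nat :: enc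
begin
definition enc_nat :: "nat \<Rightarrow> nat" where "enc_nat n = n"
instance by standard (simp add: enc_nat_def[abs_def] bij_def)
end

instantiation prod :: (enc, enc) enc
begin
definition enc_prod :: "'a \<times> 'b \<Rightarrow> nat" where
  "enc_prod p = prod_encode (enc (fst p), enc (snd p))"
instance
proof
  have "(enc :: 'a \<times> 'b \<Rightarrow> nat) = prod_encode \<circ> map_prod enc enc"
    by (auto simp: enc_prod_def fun_eq_iff)
  moreover have "bij (map_prod (enc :: 'a \<Rightarrow> nat) (enc :: 'b \<Rightarrow> nat))"
    by (rule bijI) (rule prod.inj_map map_prod_surj; rule bij_is_inj bij_is_surj; rule bij_enc)+
  ultimately show "bij (enc :: 'a \<times> 'b \<Rightarrow> nat)" using bij_comp bij_prod_encode by metis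
qed
end

lemma bij_map: "bij f \<Longrightarrow> bij (map f)"
  unfolding bij_def by (metis list.inj_map lists_UNIV lists_image)

instantiation list :: (enc) enc
begin
definition enc_list :: "'a list \<Rightarrow> nat" where "enc_list xs = list_encode (map enc xs)"
instance
proof
  have "(enc :: 'a list \<Rightarrow> nat) = list_encode \<circ> map enc" by (auto simp: enc_list_def fun_eq_iff)
  then show "bij (enc :: 'a list \<Rightarrow> nat)"
    using bij_comp[OF bij_map[OF bij_enc[where 'a='a]] bij_list_encode] by simp
qed
end

lemma enc_inject [simp]: "enc x = enc y \<longleftrightarrow> x = y"
  using bij_enc by (metis bij_def inj_def)

lemma enc_Nil [simp]: "enc [] = 0" by (simp add: enc_list_def)
lemma enc_Cons [simp]: "enc (x # xs) = Suc (prod_encode (enc x, enc xs))"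
  by (simp add: enc_list_def)
lemma enc_Pair [simp]: "enc (x, y) = prod_encode (enc x, enc y)" by (simp add: enc_prod_def)
lemma enc_nat_eq [simp]: "enc (n :: nat) = n" by (simp add: enc_nat_def)

definition computable :: "('a::enc \<Rightarrow> 'b::enc) \<Rightarrow> bool" where
  "computable f \<longleftrightarrow> (\<exists>g. cfun g \<and> (\<forall>x. enc (f x) = g (enc x)))"

definition decidable :: "('a::enc \<Rightarrow> bool) \<Rightarrow> bool" where
  "decidable P \<longleftrightarrow> computable (\<lambda>x. of_bool (P x) :: nat)"

lemma computableI: "cfun g \<Longrightarrow> (\<And>x. enc (f x) = g (enc x)) \<Longrightarrow> computable f"
  unfolding computable_def by blast

lemma computableE:
  assumes "computable f" obtains g where "cfun g" "\<And>x. enc (f x) = g (enc x)"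
  using assms unfolding computable_def by blast

lemma computable_nat: "computable f \<longleftrightarrow> cfun f" for f :: "nat \<Rightarrow> nat"
  unfolding computable_def enc_nat_eq by (metis ext)

lemma cfun_const: "cfun (\<lambda>_. c)"
  by (induction c) (auto intro: cfun_zero cfun_comp[OF cfun_Suc])

lemma computable_id: "computable (\<lambda>x. x)"
  by (rule computableI[OF cfun_id]) simp

lemma computable_const: "computable (\<lambda>x. c)"
  by (rule computableI[OF cfun_const]) simp

lemma computable_comp: "computable f \<Longrightarrow> computable g \<Longrightarrow> computable (\<lambda>x. f (g x))"
  unfolding computable_def using cfun_comp by metis

lemma computable_Pair: "computable f \<Longrightarrow> computable g \<Longrightarrow> computable (\<lambda>x. (f x, g x))"
  by (elim computableE, rule computableI[OF cfun_pair]) auto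

lemma computable_fst: "computable f \<Longrightarrow> computable (\<lambda>x. fst (f x))"
  by (erule computableE, rule computableI[OF cfun_comp[OF cfun_fst]])
    (assumption, metis enc_prod_def prod_encode_inverse fst_conv)

lemma computable_snd: "computable f \<Longrightarrow> computable (\<lambda>x. snd (f x))"
  by (erule computableE, rule computableI[OF cfun_comp[OF cfun_snd]])
    (assumption, metis enc_prod_def prod_encode_inverse snd_conv)

lemma computable_enc: "computable f \<Longrightarrow> computable (\<lambda>x. enc (f x))"
  by (erule computableE, rule computableI) auto

lemma enc_inv_enc [simp]: "enc (inv enc n :: 'a::enc) = n"
  using bij_enc[where 'a='a] by (simp add: bij_def surj_f_inv_f)

lemma inv_enc_enc [simp]: "inv enc (enc x) = (x :: 'a::enc)"
  using bij_enc[where 'a='a] by (simp add: bij_def)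

lemma computable_inv_enc: "computable f \<Longrightarrow> computable (\<lambda>x. inv enc (f x :: nat))"
  by (erule computableE, rule computableI) auto

lemma list_decode_inv_enc: "list_decode = (inv enc :: nat \<Rightarrow> nat list)"
proof
  fix n
  have "map enc xs = xs" for xs :: "nat list" by (induction xs) auto
  then have "enc (list_decode n) = n" by (simp add: enc_list_def)
  then show "list_decode n = inv enc n" using inv_enc_enc by metis
qed

lemma computable_list_decode: "computable f \<Longrightarrow> computable (\<lambda>x. list_decode (f x))"
  unfolding list_decode_inv_enc by (rule computable_inv_enc)

text \<open>The parameter \<open>x\<close> travels inside the iterated state, because the plain
  scheme iterates a function without parameters.\<close>

lemma computable_iter:
  fixes F :: "'a::enc \<Rightarrow> 'b::enc \<Rightarrow> 'b"
  assumes "computable (\<lambda>p. F (fst p) (snd p))" "computable n" "computable a"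
  shows "computable (\<lambda>x. (F x ^^ n x) (a x))"
proof -
  obtain gF where gF: "cfun gF" "\<And>p. enc (F (fst p) (snd p)) = gF (enc p)"
    using computableE[OF assms(1)] by auto
  obtain gn where gn: "cfun gn" "\<And>x. n x = gn (enc x)"
    using computableE[OF assms(2)] by auto
  obtain ga where ga: "cfun ga" "\<And>x. enc (a x) = ga (enc x)"
    using computableE[OF assms(3)] by auto
  define G where "G c = prod_encode (fst (prod_decode c), gF c)" for c
  have "cfun G" unfolding G_def by (intro cfun_pair cfun_fst gF)
  moreover have "(G ^^ k) (prod_encode (enc x, enc s)) = prod_encode (enc x, enc ((F x ^^ k) s))" for k x s
    by (induction k) (use gF(2)[of "(x, _)"] in \<open>auto simp: G_def prod_encode_inverse\<close>)
  ultimately show ?thesis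
    by (intro computableI[where g="\<lambda>X. snd (prod_decode ((\<lambda>z. (G ^^ fst (prod_decode z)) (snd (prod_decode z)))
            (prod_encode (gn X, prod_encode (X, ga X)))))"]
          cfun_comp[OF cfun_snd] cfun_comp[OF cfun_iter] cfun_pair gn(1) ga(1) cfun_id)
      (simp_all add: prod_encode_inverse ga(1) flip: ga(2) gn(2))
qed

lemma computable_Suc: "computable f \<Longrightarrow> computable (\<lambda>x. Suc (f x))"
  by (rule computable_comp[where f=Suc]) (simp_all add: computable_nat cfun_Suc)

lemmas comp_basic = computable_id computable_const computable_Pair computable_fst computable_snd computable_Suc

section \<open>Arithmetic and propositional connectives\<close>

lemma computable_add: "computable f \<Longrightarrow> computable g \<Longrightarrow> computable (\<lambda>x. f x + g x :: nat)"
proof -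
  have "(Suc ^^ m) n = n + m" for m n by (induction m) auto
  moreover assume "computable f" "computable g"
  then have "computable (\<lambda>x. (Suc ^^ g x) (f x))" by (intro computable_iter comp_basic)
  ultimately show ?thesis by (simp add: add.commute)
qed

lemma computable_pred: "computable f \<Longrightarrow> computable (\<lambda>x. f x - 1 :: nat)"
proof -
  \<comment> \<open>Iterating on pairs keeps the previous value of the counter, which is the
    predecessor.\<close>
  have "((\<lambda>p. (Suc (fst p), fst p)) ^^ m) (0, 0 :: nat) = (m, m - 1)" for m by (induction m) auto
  moreover assume "computable f"
  then have "computable (\<lambda>x. snd (((\<lambda>p. (Suc (fst p), fst p)) ^^ f x) (0::nat, 0::nat)))"
    by (intro computable_iter comp_basic)
  ultimately show ?thesis by simp
qed

lemma computable_diff: "computable f \<Longrightarrow> computable g \<Longrightarrow> computable (\<lambda>x. f x - g x :: nat)"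
proof -
  have "((\<lambda>n. n - 1) ^^ m) n = n - m" for m n :: nat by (induction m) auto
  moreover assume "computable f" "computable g"
  then have "computable (\<lambda>x. ((\<lambda>n. n - 1) ^^ g x) (f x))"
    by (intro computable_iter comp_basic computable_pred)
  ultimately show ?thesis by simp
qed

lemma computable_mult: "computable f \<Longrightarrow> computable g \<Longrightarrow> computable (\<lambda>x. f x * g x :: nat)"
proof -
  have "((\<lambda>n. n + k) ^^ m) 0 = k * m" for m k :: nat by (induction m) auto
  moreover assume "computable f" "computable g"
  then have "computable (\<lambda>x. ((\<lambda>n. n + f x) ^^ g x) 0)"
    by (intro computable_iter comp_basic computable_add) (auto intro: computable_comp[OF _ computable_fst[OF computable_id]])
  ultimately show ?thesis by simp
qed

text \<open>A conditional is a constant function iterated zero times or once.\<close>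

lemma computable_If:
  assumes "decidable P" "computable f" "computable g"
  shows "computable (\<lambda>x. if P x then f x else g x)"
proof -
  have "computable (\<lambda>x. ((\<lambda>_. f x) ^^ of_bool (P x)) (g x))"
    using assms unfolding decidable_def
    by (intro computable_iter) (auto intro: computable_comp[OF _ computable_fst[OF computable_id]])
  then show ?thesis by (rule back_subst[of computable]) (auto simp: fun_eq_iff)
qed

lemma decidable_not: "decidable P \<Longrightarrow> decidable (\<lambda>x. \<not> P x)"
proof -
  have *: "of_bool (\<not> b) = 1 - (of_bool b :: nat)" for b by simp
  show "decidable P \<Longrightarrow> decidable (\<lambda>x. \<not> P x)"
    unfolding decidable_def * by (intro computable_diff comp_basic)
qed

lemma decidable_conj: "decidable P \<Longrightarrow> decidable Q \<Longrightarrow> decidable (\<lambda>x. P x \<and> Q x)"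
  unfolding decidable_def of_bool_conj by (rule computable_mult)

lemma decidable_disj: "decidable P \<Longrightarrow> decidable Q \<Longrightarrow> decidable (\<lambda>x. P x \<or> Q x)"
  using decidable_not[OF decidable_conj[OF decidable_not decidable_not]] by fastforce

lemma decidable_imp: "decidable P \<Longrightarrow> decidable Q \<Longrightarrow> decidable (\<lambda>x. P x \<longrightarrow> Q x)"
  using decidable_disj[OF decidable_not] by fastforce

lemma decidable_le:
  assumes "computable f" "computable g" shows "decidable (\<lambda>x. f x \<le> (g x :: nat))"
proof -
  have "computable (\<lambda>x. 1 - (f x - g x))" by (intro computable_diff comp_basic assms)
  moreover have "(\<lambda>x. 1 - (f x - g x)) = (\<lambda>x. of_bool (f x \<le> g x))" by (auto simp: fun_eq_iff)
  ultimately show ?thesis unfolding decidable_def by simp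
qed

lemma decidable_less: "computable f \<Longrightarrow> computable g \<Longrightarrow> decidable (\<lambda>x. f x < (g x :: nat))"
  using decidable_le[OF computable_Suc] by (simp add: less_eq_Suc_le)

lemma decidable_eq: "computable f \<Longrightarrow> computable g \<Longrightarrow> decidable (\<lambda>x. f x = g x)"
proof -
  assume "computable f" "computable g"
  then have "decidable (\<lambda>x. enc (f x) \<le> enc (g x) \<and> enc (g x) \<le> enc (f x))"
    by (intro decidable_conj decidable_le computable_enc)
  moreover have "enc (f x) \<le> enc (g x) \<and> enc (g x) \<le> enc (f x) \<longleftrightarrow> f x = g x" for x
    by (metis enc_inject order_antisym order_refl)
  ultimately show ?thesis by simp
qed

text \<open>The empty list has code 0 and a nonempty one the successor of the code of the pair of
  head and tail, so the case distinction is a zero test followed by a predecessor.\<close>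

lemma computable_case_list:
  assumes "computable l" "computable a" "computable (\<lambda>p. F (fst p) (fst (snd p)) (snd (snd p)))"
  shows "computable (\<lambda>x. case l x of [] \<Rightarrow> a x | y # ys \<Rightarrow> F x y ys)"
proof -
  obtain gF where gF: "cfun gF" "\<And>p. enc (F (fst p) (fst (snd p)) (snd (snd p))) = gF (enc p)"
    using computableE[OF assms(3)] by auto
  obtain gl where gl: "cfun gl" "\<And>x. enc (l x) = gl (enc x)"
    using computableE[OF assms(1)] by auto
  obtain ga where ga: "cfun ga" "\<And>x. enc (a x) = ga (enc x)"
    using computableE[OF assms(2)] by auto
  have "computable (\<lambda>X :: nat. if gl X = 0 then ga X else gF (prod_encode (X, gl X - 1)))"
    by (intro computable_If decidable_eq computable_const)
      (auto simp: computable_nat gl ga intro!: cfun_comp[OF gF(1)] cfun_pair cfun_id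
         computable_pred[of gl, unfolded computable_nat, simplified])
  moreover have "enc (case l x of [] \<Rightarrow> a x | y # ys \<Rightarrow> F x y ys) =
     (if gl (enc x) = 0 then ga (enc x) else gF (prod_encode (enc x, gl (enc x) - 1)))" for x
    using gF(2)[of "(x, _, _)"] ga(2)[of x] by (cases "l x") (simp_all flip: gl(2))
  ultimately show ?thesis unfolding computable_nat by (rule computableI)
qed

section \<open>Computable operations on lists\<close>

lemma computable_Cons: "computable f \<Longrightarrow> computable g \<Longrightarrow> computable (\<lambda>x. f x # g x)"
  by (elim computableE, rule computableI[OF cfun_comp[OF cfun_Suc cfun_pair]]) auto

text \<open>Supplies an iteration bound for list recursion before lengths are known to be
  computable.\<close>

lemma length_le_enc: "length xs \<le> enc xs"
  by (induction xs) (auto intro: order_trans[OF _ le_prod_encode_2])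

text \<open>One iteration consumes one element and idles on the empty list, so any number of
  iterations at least as large as the length gives the fold; the code of the list is such a
  number.\<close>

lemma computable_foldl:
  assumes F: "computable (\<lambda>p. F (fst p) (fst (snd p)) (snd (snd p)))"
    and a: "computable a" and l: "computable l"
  shows "computable (\<lambda>x. foldl (F x) (a x) (l x))"
proof -
  define step where "step x p = (case snd p of [] \<Rightarrow> (fst p, []) | y # ys \<Rightarrow> (F x (fst p) y, ys))"
    for x p
  have nil: "(step x ^^ n) (s, []) = (s, [])" for x n s
    by (induction n) (auto simp: step_def)
  have "(step x ^^ (length ys + n)) (s, ys) = (foldl (F x) s ys, [])" for x n s ys
  proof (induction ys arbitrary: s)
    case (Cons y ys)
    have "(step x ^^ (length (y # ys) + n)) (s, y # ys) = (step x ^^ (length ys + n)) (step x (s, y # ys))"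
      by (simp add: funpow_swap1)
    also have "step x (s, y # ys) = (F x s y, ys)" by (simp add: step_def)
    finally show ?case using Cons by simp
  qed (simp add: nil)
  then have "fst ((step x ^^ enc (l x)) (a x, l x)) = foldl (F x) (a x) (l x)" for x
    using length_le_enc[of "l x"] by (metis le_add_diff_inverse fst_conv)
  moreover have "computable (\<lambda>x. fst ((step x ^^ enc (l x)) (a x, l x)))"
    unfolding step_def
    by (intro computable_fst computable_iter computable_case_list computable_enc comp_basic l a
        F[THEN computable_comp, of "\<lambda>p. (fst (fst p), fst (snd (fst p)), fst (snd p))", simplified])
  ultimately show ?thesis by simp
qed

lemma computable_rev: "computable l \<Longrightarrow> computable (\<lambda>x. rev (l x))"
proof -
  have "foldl (\<lambda>a y. y # a) ys xs = rev xs @ ys" for xs ys :: "'b list"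
    by (induction xs arbitrary: ys) auto
  moreover assume "computable l"
  then have "computable (\<lambda>x. foldl (\<lambda>a y. y # a) [] (l x))"
    by (intro computable_foldl computable_Cons comp_basic)
  ultimately show ?thesis by simp
qed

lemma computable_append:
  "computable f \<Longrightarrow> computable g \<Longrightarrow> computable (\<lambda>x. f x @ g x)"
proof -
  have "foldl (\<lambda>a y. y # a) ys xs = rev xs @ ys" for xs ys :: "'b list"
    by (induction xs arbitrary: ys) auto
  moreover assume "computable f" "computable g"
  then have "computable (\<lambda>x. foldl (\<lambda>a y. y # a) (g x) (rev (f x)))"
    by (intro computable_foldl computable_rev computable_Cons comp_basic)
  ultimately show ?thesis by simp
qed

lemma computable_map:
  assumes F: "computable (\<lambda>p. F (fst p) (snd p))" and l: "computable l"
  shows "computable (\<lambda>x. map (F x) (l x))"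
proof -
  have "foldl (\<lambda>a y. G y # a) ys xs = rev (map G xs) @ ys" for xs ys and G :: "'b \<Rightarrow> 'c"
    by (induction xs arbitrary: ys) auto
  moreover have "computable (\<lambda>x. rev (foldl (\<lambda>a y. F x y # a) [] (l x)))"
    by (intro computable_foldl computable_Cons computable_rev comp_basic l
        F[THEN computable_comp, of "\<lambda>p. (fst p, snd (snd p))", simplified])
  ultimately show ?thesis by simp
qed

lemma computable_filter:
  assumes P: "decidable (\<lambda>p. P (fst p) (snd p))" and l: "computable l"
  shows "computable (\<lambda>x. filter (P x) (l x))"
proof -
  have "foldl (\<lambda>a y. if G y then y # a else a) ys xs = rev (filter G xs) @ ys" for xs ys and G :: "'b \<Rightarrow> bool"
    by (induction xs arbitrary: ys) auto
  moreover have "decidable (\<lambda>p. P (fst p) (snd (snd p)))"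
    unfolding decidable_def
    by (rule P[unfolded decidable_def, THEN computable_comp, of "\<lambda>p. (fst p, snd (snd p))", simplified])
      (intro comp_basic)
  then have "computable (\<lambda>x. rev (foldl (\<lambda>a y. if P x y then y # a else a) [] (l x)))"
    by (intro computable_foldl computable_Cons computable_rev computable_If comp_basic l)
  ultimately show ?thesis by simp
qed

lemma computable_concat: "computable l \<Longrightarrow> computable (\<lambda>x. concat (l x))"
proof -
  have "foldl (@) ys xs = ys @ concat xs" for xs and ys :: "'b list"
    by (induction xs arbitrary: ys) auto
  moreover assume "computable l"
  then have "computable (\<lambda>x. foldl (@) [] (l x))"
    by (intro computable_foldl computable_append comp_basic)
  ultimately show ?thesis by simp
qed

lemma computable_length: "computable l \<Longrightarrow> computable (\<lambda>x. length (l x))"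
proof -
  have "foldl (\<lambda>n _. Suc n) k xs = k + length xs" for k and xs :: "'b list"
    by (induction xs arbitrary: k) auto
  moreover assume "computable l"
  then have "computable (\<lambda>x. foldl (\<lambda>n _. Suc n) 0 (l x))"
    by (intro computable_foldl comp_basic)
  ultimately show ?thesis by simp
qed

lemma computable_prod_list: "computable l \<Longrightarrow> computable (\<lambda>x. prod_list (l x) :: nat)"
proof -
  have "foldl (\<lambda>n m. n * m) k xs = k * prod_list xs" for k and xs :: "nat list"
    by (induction xs arbitrary: k) (auto simp: mult.assoc)
  moreover assume "computable l"
  then have "computable (\<lambda>x. foldl (\<lambda>n m. n * m) 1 (l x))"
    by (intro computable_foldl computable_mult comp_basic)
  ultimately show ?thesis by simp
qed

lemma decidable_ball:
  assumes P: "decidable (\<lambda>p. P (fst p) (snd p))" and l: "computable l"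
  shows "decidable (\<lambda>x. \<forall>y\<in>set (l x). P x y)"
proof -
  have "decidable (\<lambda>x. filter (\<lambda>y. \<not> P x y) (l x) = [])"
    by (intro decidable_eq computable_filter decidable_not P l computable_const)
  then show ?thesis by (simp add: filter_empty_conv)
qed

lemma decidable_bex:
  assumes P: "decidable (\<lambda>p. P (fst p) (snd p))" and l: "computable l"
  shows "decidable (\<lambda>x. \<exists>y\<in>set (l x). P x y)"
proof -
  have "decidable (\<lambda>x. filter (P x) (l x) \<noteq> [])"
    by (intro decidable_eq decidable_not computable_filter P l computable_const)
  then show ?thesis by (simp add: filter_empty_conv)
qed

lemma computable_upt:
  assumes "computable f" "computable g" shows "computable (\<lambda>x. [f x..<g x])"
proof -
  have "((\<lambda>l. l @ [length l]) ^^ n) [] = [0..<n]" for n by (induction n) auto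
  moreover have "computable (\<lambda>x. map ((\<lambda>x y. y + f x) x) (((\<lambda>l. l @ [length l]) ^^ (g x - f x)) []))"
    by (intro computable_map computable_iter computable_append computable_Cons computable_diff
        computable_add computable_length comp_basic assms
        assms(1)[THEN computable_comp])
  moreover have "map (\<lambda>y. y + f x) [0..<g x - f x] = [f x..<g x]" for x
    by (cases "f x \<le> g x") (simp_all add: map_add_upt)
  ultimately show ?thesis by simp
qed

lemma decidable_all_less:
  fixes n :: "'a::enc \<Rightarrow> nat"
  assumes P: "decidable (\<lambda>p. P (fst p) (snd p))" and n: "computable n"
  shows "decidable (\<lambda>x. \<forall>i<n x. P x i)"
proof -
  have "decidable (\<lambda>x. \<forall>i\<in>set [0..<n x]. P x i)"
    by (intro decidable_ball computable_upt computable_const assms)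
  then show ?thesis by (simp add: Ball_def)
qed

lemma computable_zip:
  fixes f :: "'a::enc \<Rightarrow> 'c::enc list" and g :: "'a \<Rightarrow> 'b::enc list"
  assumes "computable f" "computable g" shows "computable (\<lambda>x. zip (f x) (g x))"
proof -
  define S :: "('c \<times> 'b) list \<times> 'b list \<Rightarrow> 'c \<Rightarrow> ('c \<times> 'b) list \<times> 'b list" where
    "S a y = (case snd a of [] \<Rightarrow> (fst a, []) | z # zs \<Rightarrow> ((y, z) # fst a, zs))" for a y
  have nil: "fst (foldl S (ps, []) xs) = ps" for xs ps
    by (induction xs) (auto simp: S_def)
  have "fst (foldl S (ps, ys) xs) = rev (zip xs ys) @ ps" for xs ys ps
  proof (induction xs arbitrary: ys ps)
    case (Cons x xs)
    then show ?case by (cases ys) (auto simp: S_def nil)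
  qed simp
  moreover have "computable (\<lambda>x. rev (fst (foldl S ([], g x) (f x))))"
    unfolding S_def[abs_def]
    by (intro computable_rev computable_foldl computable_case_list computable_Cons comp_basic assms)
  ultimately show ?thesis by simp
qed

text \<open>Total indexing: outside the list \<open>!\<close> has an unspecified value, about which
  no computability statement could be proved.\<close>

definition nth_or :: "'a \<Rightarrow> 'a list \<Rightarrow> nat \<Rightarrow> 'a" where
  "nth_or d l i = (case drop i l of [] \<Rightarrow> d | y # _ \<Rightarrow> y)"

lemma nth_or_nth [simp]: "i < length l \<Longrightarrow> nth_or d l i = l ! i"
  by (simp add: nth_or_def flip: Cons_nth_drop_Suc)

lemma computable_tl: "computable l \<Longrightarrow> computable (\<lambda>x. tl (l x))"
  unfolding tl_def by (intro computable_case_list comp_basic)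

lemma computable_nth_or:
  fixes l :: "'a::enc \<Rightarrow> 'z::enc list"
  assumes "computable d" "computable l" "computable i"
  shows "computable (\<lambda>x. nth_or (d x) (l x) (i x))"
proof -
  have "(tl ^^ n) xs = drop n xs" for n and xs :: "'z list"
    by (induction n) (simp_all add: drop_Suc tl_drop)
  moreover have "computable (\<lambda>x. case (tl ^^ i x) (l x) of [] \<Rightarrow> d x | y # _ \<Rightarrow> y)"
    by (intro computable_case_list computable_iter computable_tl comp_basic assms)
  ultimately show ?thesis by (simp add: nth_or_def)
qed

lemmas comp_intros = comp_basic computable_add computable_mult computable_diff
  computable_If computable_Cons computable_rev computable_append computable_map computable_filter
  computable_concat computable_length computable_prod_list computable_upt computable_zip computable_nth_or computable_tl
  decidable_not decidable_conj decidable_disj decidable_imp decidable_le decidable_less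
  decidable_eq decidable_ball decidable_bex decidable_all_less computable_foldl

section \<open>Fractions and polynomials in logarithms\<close>

text \<open>Fractions stay unreduced, and a denominator may be 0 as far as the type goes; positivity
  of \<open>snd\<close> is therefore a side condition.\<close>

type_synonym frac = "nat \<times> nat"

definition fval :: "frac \<Rightarrow> 'a::field_char_0" where
  "fval p = of_nat (fst p) / of_nat (snd p)"

definition fadd :: "frac \<Rightarrow> frac \<Rightarrow> frac" where
  "fadd p q = (fst p * snd q + fst q * snd p, snd p * snd q)"

definition fmul :: "frac \<Rightarrow> frac \<Rightarrow> frac" where
  "fmul p q = (fst p * fst q, snd p * snd q)"

definition fless :: "frac \<Rightarrow> frac \<Rightarrow> bool" where
  "fless p q \<longleftrightarrow> fst p * snd q < fst q * snd p"

definition fsum :: "frac list \<Rightarrow> frac" where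
  "fsum l = foldl fadd (0, 1) l"

definition fprod :: "frac list \<Rightarrow> frac" where
  "fprod l = foldl fmul (1, 1) l"

lemma fval_fadd: "snd p > 0 \<Longrightarrow> snd q > 0 \<Longrightarrow> fval (fadd p q) = fval p + fval q"
  by (simp add: fval_def fadd_def field_simps)

lemma fval_fmul: "fval (fmul p q) = fval p * fval q"
  by (simp add: fval_def fmul_def)

lemma fless_iff:
  "snd p > 0 \<Longrightarrow> snd q > 0 \<Longrightarrow> fless p q \<longleftrightarrow> fval p < (fval q :: 'a::linordered_field)"
  by (simp add: fval_def fless_def field_simps flip: of_nat_mult)

lemma fval_nonneg [simp]: "0 \<le> (fval p :: 'a::linordered_field)"
  by (simp add: fval_def)

lemma fval_pos_iff: "snd p > 0 \<Longrightarrow> 0 < (fval p :: 'a::linordered_field) \<longleftrightarrow> fst p > 0"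
  by (simp add: fval_def zero_less_divide_iff)

lemma foldl_fadd:
  "snd p > 0 \<Longrightarrow> \<forall>q\<in>set l. snd q > 0 \<Longrightarrow>
    snd (foldl fadd p l) > 0 \<and> fval (foldl fadd p l) = fval p + sum_list (map fval l)"
proof (induction l arbitrary: p)
  case (Cons q l)
  then have "snd (fadd p q) > 0" by (simp add: fadd_def)
  with Cons show ?case by (simp add: fval_fadd add.assoc)
qed simp

lemma foldl_fmul:
  "snd p > 0 \<Longrightarrow> \<forall>q\<in>set l. snd q > 0 \<Longrightarrow>
    snd (foldl fmul p l) > 0 \<and> fval (foldl fmul p l) = fval p * prod_list (map fval l)"
proof (induction l arbitrary: p)
  case (Cons q l)
  then have "snd (fmul p q) > 0" by (simp add: fmul_def)
  with Cons show ?case by (simp add: fval_fmul mult.assoc)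
qed simp

lemma fsum: "\<forall>q\<in>set l. snd q > 0 \<Longrightarrow> snd (fsum l) > 0"
  "\<forall>q\<in>set l. snd q > 0 \<Longrightarrow> (fval (fsum l) :: 'a::linordered_field) = sum_list (map fval l)"
  using foldl_fadd[of "(0, 1)" l, where 'a=real] foldl_fadd[of "(0, 1)" l, where 'a='a]
  by (simp_all add: fsum_def fval_def[of "(0, Suc 0)"])

lemma fprod: "\<forall>q\<in>set l. snd q > 0 \<Longrightarrow> snd (fprod l) > 0"
  "\<forall>q\<in>set l. snd q > 0 \<Longrightarrow> (fval (fprod l) :: 'a::linordered_field) = prod_list (map fval l)"
  using foldl_fmul[of "(1, 1)" l, where 'a=real] foldl_fmul[of "(1, 1)" l, where 'a='a]
  by (simp_all add: fprod_def fval_def[of "(Suc 0, Suc 0)"])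

text \<open>For \<open>b > 0\<close> this is the right-endpoint sum of \<open>1/x\<close> over the
  interval from \<open>n\<close> to \<open>b * n\<close>, whose integral is \<open>ln b\<close>;
  \<open>ln_hi\<close> is the left-endpoint sum.\<close>

definition ln_lo :: "nat \<Rightarrow> nat \<Rightarrow> frac" where
  "ln_lo n b = fsum (map (\<lambda>k. (1, k)) [n + 1..<b * n + 1])"

definition ln_hi :: "nat \<Rightarrow> nat \<Rightarrow> frac" where
  "ln_hi n b = fsum (map (\<lambda>k. (1, k)) [n..<b * n])"

lemma snd_ln_lo: "snd (ln_lo n b) > 0"
  unfolding ln_lo_def by (rule fsum) (auto simp del: upt_Suc)

lemma snd_ln_hi: "n > 0 \<Longrightarrow> snd (ln_hi n b) > 0"
  unfolding ln_hi_def by (rule fsum) auto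

text \<open>One induction for all three claims: \<open>ln (m+1) - ln m\<close> lies between
  \<open>1/(m+1)\<close> and \<open>1/m\<close>, which are the new terms of the lower and the upper
  sum, and the difference of the sums telescopes.\<close>

lemma harmonic_ln_bounds:
  assumes "n > 0" "n \<le> m"
  shows "(\<Sum>k\<leftarrow>[n + 1..<m + 1]. 1 / real k) \<le> ln m - ln n"
    and "ln m - ln n \<le> (\<Sum>k\<leftarrow>[n..<m]. 1 / real k)"
    and "(\<Sum>k\<leftarrow>[n..<m]. 1 / real k) - (\<Sum>k\<leftarrow>[n + 1..<m + 1]. 1 / real k) = 1 / n - 1 / m"
  using assms(2)
proof (induction rule: dec_induct)
  case base
  { case 1 show ?case by simp next case 2 show ?case by simp next case 3 show ?case by simp }
next
  case (step m)
  then have m: "m > 0" using assms by simp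
  have a: "ln (real (Suc m)) - ln m \<le> 1 / m"
  proof -
    have "ln (real (Suc m)) - ln m = ln (1 + 1 / real m)"
      using m ln_div[of "real (Suc m)" m] by (simp add: add_divide_distrib add.commute)
    then show ?thesis using ln_add_one_self_le_self[of "1 / real m"] by simp
  qed
  have b: "1 / real (Suc m) \<le> ln (real (Suc m)) - ln m"
  proof -
    have "ln m - ln (real (Suc m)) = ln (m / real (Suc m))"
      using m by (simp add: ln_div)
    also have "\<dots> \<le> m / real (Suc m) - 1" using m by (intro ln_le_minus_one) simp
    finally show ?thesis by (simp add: field_simps)
  qed
  { case 1 show ?case using step(3) step(1) b by (simp add: add.commute)
  next case 2 show ?case using step(4) step(1) a by simp
  next case 3 show ?case using step(5) step(1) by simp }
qed

lemma fval_ln_lo: "fval (ln_lo n b) = (\<Sum>k\<leftarrow>[n + 1..<b * n + 1]. 1 / real k)"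
  unfolding ln_lo_def by (subst fsum) (auto simp: fval_def comp_def simp del: upt_Suc)

lemma fval_ln_hi: "n > 0 \<Longrightarrow> fval (ln_hi n b) = (\<Sum>k\<leftarrow>[n..<b * n]. 1 / real k)"
  unfolding ln_hi_def by (subst fsum) (auto simp: fval_def comp_def)

lemma ln_bounds:
  assumes "n > 0"
  shows "fval (ln_lo n b) \<le> ln (real b)" "ln (real b) \<le> fval (ln_hi n b)"
    "fval (ln_hi n b) - fval (ln_lo n b) \<le> (1 / real n :: real)"
proof -
  have "fval (ln_lo n b) \<le> ln (real b) \<and> ln (real b) \<le> fval (ln_hi n b)
     \<and> fval (ln_hi n b) - fval (ln_lo n b) \<le> (1 / real n :: real)"
  proof (cases "b = 0")
    \<comment> \<open>Here \<open>ln 0 = 0\<close> by convention, and both sums are empty.\<close>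
    case True
    then show ?thesis using assms by (simp add: fval_ln_lo fval_ln_hi)
  next
    case False
    then have "n \<le> b * n" by simp
    from harmonic_ln_bounds[OF assms this] False assms show ?thesis
      by (simp add: fval_ln_lo fval_ln_hi ln_mult del: upt_Suc)
  qed
  then show "fval (ln_lo n b) \<le> ln (real b)" "ln (real b) \<le> fval (ln_hi n b)"
    "fval (ln_hi n b) - fval (ln_lo n b) \<le> (1 / real n :: real)" by simp_all
qed

lemma fval_ln_tendsto:
  "(\<lambda>n. fval (ln_lo n b)) \<longlonglongrightarrow> ln (real b)" "(\<lambda>n. fval (ln_hi n b)) \<longlonglongrightarrow> ln (real b)"
proof -
  have l: "(\<lambda>n. ln (real b) - 1 / real n) \<longlonglongrightarrow> ln (real b) - 0"
    and u: "(\<lambda>n. ln (real b) + 1 / real n) \<longlonglongrightarrow> ln (real b) + 0"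
    by (intro tendsto_intros lim_1_over_n)+
  have e: "eventually (\<lambda>n::nat. n > 0) sequentially" by (rule eventually_gt_at_top)
  show "(\<lambda>n. fval (ln_lo n b)) \<longlonglongrightarrow> ln (real b)"
    by (rule tendsto_sandwich[OF _ _ l[simplified] tendsto_const]; rule eventually_mono[OF e])
      (use ln_bounds[of _ b] in \<open>auto simp: algebra_simps\<close>, smt (verit) ln_bounds)
  show "(\<lambda>n. fval (ln_hi n b)) \<longlonglongrightarrow> ln (real b)"
    by (rule tendsto_sandwich[OF _ _ tendsto_const u[simplified]]; rule eventually_mono[OF e])
      (use ln_bounds[of _ b] in \<open>auto simp: algebra_simps\<close>, smt (verit) ln_bounds)
qed

text \<open>A polynomial with natural coefficients in the logarithms of natural numbers is a list of
  monomials, each of which is a list of arguments of the logarithm.\<close>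
type_synonym poly = "nat list list"
text \<open>A formal difference of two polynomials, because the coefficients of \<open>poly\<close>
  are natural numbers.\<close>

type_synonym elem = "poly \<times> poly"

definition pval :: "poly \<Rightarrow> real" where
  "pval P = (\<Sum>m\<leftarrow>P. \<Prod>b\<leftarrow>m. ln (real b))"

definition eval :: "elem \<Rightarrow> real" where
  "eval e = pval (fst e) - pval (snd e)"

definition pmul :: "poly \<Rightarrow> poly \<Rightarrow> poly" where
  "pmul P Q = concat (map (\<lambda>m. map (\<lambda>m'. m @ m') Q) P)"

definition eadd :: "elem \<Rightarrow> elem \<Rightarrow> elem" where
  "eadd e f = (fst e @ fst f, snd e @ snd f)"

definition eneg :: "elem \<Rightarrow> elem" where
  "eneg e = (snd e, fst e)"

definition emul :: "elem \<Rightarrow> elem \<Rightarrow> elem" where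
  "emul e f = (pmul (fst e) (fst f) @ pmul (snd e) (snd f), pmul (fst e) (snd f) @ pmul (snd e) (fst f))"

definition esum :: "elem list \<Rightarrow> elem" where
  "esum l = foldl eadd ([], []) l"

lemma pval_simps [simp]: "pval [] = 0" "pval (m # P) = (\<Prod>b\<leftarrow>m. ln (real b)) + pval P"
  "pval (P @ Q) = pval P + pval Q"
  by (simp_all add: pval_def)

lemma pval_pmul [simp]: "pval (pmul P Q) = pval P * pval Q"
proof -
  have "pval (map ((@) m) Q) = (\<Prod>b\<leftarrow>m. ln (real b)) * pval Q" for m
    by (induction Q) (simp_all add: algebra_simps)
  then show ?thesis
    by (induction P) (simp_all add: pmul_def algebra_simps)
qed

lemma eval_simps [simp]:
  "eval (eadd e f) = eval e + eval f" "eval (eneg e) = - eval e" "eval (emul e f) = eval e * eval f"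
  by (simp_all add: eval_def eadd_def eneg_def emul_def algebra_simps)

lemma eval_esum [simp]: "eval (esum l) = sum_list (map eval l)"
proof -
  have "eval (foldl eadd e l) = eval e + sum_list (map eval l)" for e
    by (induction l arbitrary: e) (simp_all add: algebra_simps)
  then show ?thesis by (simp add: esum_def eval_def)
qed

definition peval :: "(nat \<Rightarrow> frac) \<Rightarrow> poly \<Rightarrow> frac" where
  "peval f P = fsum (map (\<lambda>m. fprod (map f m)) P)"

lemma peval:
  assumes "\<And>b. snd (f b) > 0"
  shows "snd (peval f P) > 0" "fval (peval f P) = (\<Sum>m\<leftarrow>P. \<Prod>b\<leftarrow>m. fval (f b) :: 'a::linordered_field)"
proof -
  have f: "\<forall>q\<in>set (map f m). snd q > 0" for m using assms by simp
  then have p: "\<forall>q\<in>set (map (\<lambda>m. fprod (map f m)) P). snd q > 0" by (simp add: fprod(1))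
  then show "snd (peval f P) > 0" unfolding peval_def by (rule fsum)
  show "fval (peval f P) = (\<Sum>m\<leftarrow>P. \<Prod>b\<leftarrow>m. fval (f b) :: 'a)"
    unfolding peval_def fsum(2)[OF p] by (simp add: fprod(2)[OF f] comp_def)
qed

text \<open>Both parts are monotone in nonnegative arguments: upper bounds of the logarithms go into
  the positive part and lower bounds into the negative part.\<close>

definition eneg_check :: "nat \<Rightarrow> elem \<Rightarrow> bool" where
  "eneg_check n e \<longleftrightarrow> fless (peval (ln_hi n) (fst e)) (peval (ln_lo n) (snd e))"

lemma prod_list_mono:
  fixes f g :: "'b \<Rightarrow> 'a::linordered_idom"
  assumes "\<And>b. 0 \<le> f b" "\<And>b. f b \<le> g b"
  shows "prod_list (map f m) \<le> prod_list (map g m) \<and> 0 \<le> prod_list (map f m)"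
  by (induction m) (auto intro!: mult_mono mult_nonneg_nonneg assms order_trans[OF assms])

lemma eneg_check_sound:
  assumes "eneg_check n e" "n > 0" shows "eval e < 0"
proof -
  have ln: "0 \<le> ln (real b)" for b by (cases "b = 0") auto
  have "pval (fst e) \<le> fval (peval (ln_hi n) (fst e))"
    unfolding peval(2)[of "ln_hi n", OF snd_ln_hi[OF assms(2)]] pval_def
    by (intro sum_list_mono prod_list_mono[THEN conjunct1] ln ln_bounds assms)
  also have "\<dots> < fval (peval (ln_lo n) (snd e))"
    using assms by (simp add: eneg_check_def fless_iff[where 'a=real] peval snd_ln_hi snd_ln_lo)
  also have "\<dots> \<le> pval (snd e)"
    unfolding peval(2)[of "ln_lo n", OF snd_ln_lo] pval_def
    by (intro sum_list_mono prod_list_mono[THEN conjunct1] ln_bounds fval_nonneg assms)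
  finally show ?thesis by (simp add: eval_def)
qed

text \<open>The approximations converge, so a strict inequality is seen at all sufficiently large
  \<open>n\<close>. That it persists lets one precision serve finitely many checks at once.\<close>

lemma eneg_check_complete:
  assumes "eval e < 0" shows "eventually (\<lambda>n. eneg_check n e) sequentially"
proof -
  have prod: "(\<lambda>n. \<Prod>b\<leftarrow>m. f n b) \<longlonglongrightarrow> (\<Prod>b\<leftarrow>m. ln (real b))"
    if "\<And>b. (\<lambda>n. f n b) \<longlonglongrightarrow> ln (real b)" for m and f :: "nat \<Rightarrow> nat \<Rightarrow> real"
    by (induction m) (auto intro!: tendsto_intros that)
  have sum: "(\<lambda>n. \<Sum>m\<leftarrow>P. \<Prod>b\<leftarrow>m. f n b) \<longlonglongrightarrow> pval P"
    if "\<And>b. (\<lambda>n. f n b) \<longlonglongrightarrow> ln (real b)" for P and f :: "nat \<Rightarrow> nat \<Rightarrow> real"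
    by (induction P) (auto intro!: tendsto_intros prod that)
  have "(\<lambda>n. (\<Sum>m\<leftarrow>fst e. \<Prod>b\<leftarrow>m. fval (ln_hi n b)) - (\<Sum>m\<leftarrow>snd e. \<Prod>b\<leftarrow>m. fval (ln_lo n b)))
     \<longlonglongrightarrow> eval e"
    unfolding eval_def by (intro tendsto_diff sum fval_ln_tendsto)
  from order_tendstoD(2)[OF this assms] eventually_gt_at_top[of "0::nat"]
  show ?thesis
    by eventually_elim
      (simp add: eneg_check_def fless_iff[where 'a=real] peval snd_ln_hi snd_ln_lo)
qed

definition cnt :: "nat \<Rightarrow> nat list \<Rightarrow> nat" where
  "cnt b m = length (filter (\<lambda>c. c = b) m)"

definition meq :: "nat list \<Rightarrow> nat list \<Rightarrow> bool" where
  "meq m m' \<longleftrightarrow> (\<forall>b\<in>set (m @ m'). cnt b m = cnt b m')"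

definition pcnt :: "nat list \<Rightarrow> poly \<Rightarrow> nat" where
  "pcnt m P = length (filter (\<lambda>m'. meq m' m) P)"

text \<open>Equality of formal polynomials, that is of multisets of multisets, expressed by counting
  only the members that occur so that it is a finite check.\<close>

definition peq :: "poly \<Rightarrow> poly \<Rightarrow> bool" where
  "peq P Q \<longleftrightarrow> (\<forall>m\<in>set (P @ Q). pcnt m P = pcnt m Q)"

lemma length_filter_eq_count: "length (filter (\<lambda>c. c = b) m) = count (mset m) b"
  by (induction m) auto

lemma mset_eq_iff_ball:
  "mset xs = mset ys \<longleftrightarrow> (\<forall>b\<in>set (xs @ ys). count (mset xs) b = count (mset ys) b)"
proof
  assume *: "\<forall>b\<in>set (xs @ ys). count (mset xs) b = count (mset ys) b"
  show "mset xs = mset ys"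
  proof (rule multiset_eqI)
    fix b show "count (mset xs) b = count (mset ys) b"
    proof (cases "b \<in> set (xs @ ys)")
      case False
      then have "count (mset xs) b = 0" "count (mset ys) b = 0" by (simp_all add: count_eq_zero_iff)
      then show ?thesis by metis
    qed (use * in blast)
  qed
qed simp

lemma meq_iff: "meq m m' \<longleftrightarrow> mset m = mset m'"
  unfolding meq_def cnt_def length_filter_eq_count mset_eq_iff_ball ..

lemma pcnt: "pcnt m P = count (mset (map mset P)) (mset m)"
  unfolding pcnt_def meq_iff by (induction P) auto

lemma peq_iff: "peq P Q \<longleftrightarrow> mset (map mset P) = mset (map mset Q)"
  unfolding peq_def pcnt mset_eq_iff_ball[of "map mset P"] by auto

lemma peq_sound: "peq P Q \<Longrightarrow> pval P = pval Q"
proof -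
  have "pval P = sum_mset (image_mset (\<lambda>M. prod_mset (image_mset (\<lambda>b. ln (real b)) M)) (mset (map mset P)))" for P
    by (simp add: pval_def comp_def multiset.map_comp flip: prod_mset_prod_list sum_mset_sum_list)
  then show "peq P Q \<Longrightarrow> pval P = pval Q" by (simp only: peq_iff)
qed

text \<open>Sound at every positive precision. Completeness is where the conjecture and prime
  arguments come in: they make value 0 force formal equality.\<close>

definition ele_check :: "nat \<Rightarrow> elem \<Rightarrow> bool" where
  "ele_check n e \<longleftrightarrow> peq (fst e) (snd e) \<or> eneg_check n e"

lemma ele_check_sound: "ele_check n e \<Longrightarrow> n > 0 \<Longrightarrow> eval e \<le> 0"
  using peq_sound[of "fst e" "snd e"] eneg_check_sound[of n e] by (auto simp: ele_check_def eval_def)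

section \<open>Algebraic independence of logarithms of primes\<close>

text \<open>Unique factorisation: moving the negative coefficients to the other side and
  exponentiating gives two equal products of prime powers. Comparing multiplicities yields
  \<open>nat (z p) = nat (- z p)\<close>, which only 0 satisfies.\<close>

lemma ln_prime_combination_zero:
  fixes z :: "nat \<Rightarrow> int"
  assumes S: "finite S" "\<And>p. p \<in> S \<Longrightarrow> prime p" and sum: "(\<Sum>p\<in>S. z p * ln (real p)) = 0" and p: "p \<in> S"
  shows "z p = 0"
proof -
  have pos: "real q > 0" if "q \<in> S" for q using S(2)[OF that] by (simp add: prime_gt_0_nat)
  have split: "real_of_int (z q) = real (nat (z q)) - real (nat (- z q))" for q by (cases "z q \<ge> 0") auto
  have ln: "ln (real (\<Prod>q\<in>S. q ^ n q)) = (\<Sum>q\<in>S. n q * ln (real q))" for n :: "nat \<Rightarrow> nat"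
    using pos by (simp add: ln_prod ln_realpow S(1))
  have "(\<Sum>q\<in>S. nat (z q) * ln (real q)) = (\<Sum>q\<in>S. nat (- z q) * ln (real q))"
    using sum by (simp add: split left_diff_distrib sum_subtractf)
  then have "ln (real (\<Prod>q\<in>S. q ^ nat (z q))) = ln (real (\<Prod>q\<in>S. q ^ nat (- z q)))"
    by (simp only: ln)
  moreover have "real (\<Prod>q\<in>S. q ^ n q) > 0" for n :: "nat \<Rightarrow> nat"
    using pos by (simp add: prod_pos)
  ultimately have "(\<Prod>q\<in>S. q ^ nat (z q)) = (\<Prod>q\<in>S. q ^ nat (- z q))"
    using ln_inj_iff of_nat_eq_iff by metis
  then have "multiplicity p (\<Prod>q\<in>S. q ^ nat (z q)) = multiplicity p (\<Prod>q\<in>S. q ^ nat (- z q))"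
    by simp
  then have "nat (z p) = nat (- z p)"
    using S p by (simp add: multiplicity_prod_prime_powers)
  then show ?thesis by simp
qed

lemma common_denominator:
  assumes "finite S"
  shows "\<exists>D::int. D > 0 \<and> (\<forall>x\<in>S. \<exists>z. of_int D * q x = (of_int z :: rat))"
  using assms
proof induction
  case empty
  show ?case by (intro exI[of _ 1]) simp
next
  case (insert x S)
  then obtain D where D: "D > 0" "\<And>y. y \<in> S \<Longrightarrow> \<exists>z. of_int D * q y = of_int z" by auto
  obtain a b where ab: "quotient_of (q x) = (a, b)" by fastforce
  then have b: "b > 0" "q x = of_int a / of_int b"
    by (simp_all add: quotient_of_denom_pos quotient_of_div)
  have "\<exists>z. of_int (D * b) * q y = of_int z" if "y \<in> insert x S" for y
  proof (cases "y = x")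
    case True
    then show ?thesis using b by (intro exI[of _ "D * a"]) simp
  next
    case False
    then have "y \<in> S" using that by simp
    then obtain z where "of_int D * q y = of_int z" using D(2) by blast
    then show ?thesis by (intro exI[of _ "b * z"]) (simp add: mult.assoc mult.left_commute)
  qed
  then show ?case using D(1) b(1) by (intro exI[of _ "D * b"]) simp
qed

lemma of_real_rat: "of_real (of_rat q) = (of_rat q :: complex)"
proof -
  obtain a b where ab: "quotient_of q = (a, b)" by fastforce
  then have "q = of_int a / of_int b" by (rule quotient_of_div)
  then show ?thesis by (simp add: of_rat_divide)
qed

text \<open>A common denominator turns a rational relation into an integral one.\<close>

lemma Q_lin_indep_ln_primes:
  assumes "distinct ps" "\<And>p. p \<in> set ps \<Longrightarrow> prime p"
  shows "Q_lin_indep (map (\<lambda>p. of_real (ln (real p))) ps)"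
  unfolding Q_lin_indep_def
proof (intro allI impI, elim conjE, intro ballI)
  fix qs q
  assume len: "length qs = length (map (\<lambda>p. of_real (ln (real p)) :: complex) ps)"
    and sum: "(\<Sum>i<length (map (\<lambda>p. of_real (ln (real p)) :: complex) ps).
       of_rat (qs ! i) * map (\<lambda>p. of_real (ln (real p)) :: complex) ps ! i) = 0"
    and q: "q \<in> set qs"
  define r where "r p = qs ! inv_into {..<length ps} ((!) ps) p" for p
  have bij: "bij_betw ((!) ps) {..<length ps} (set ps)" by (rule bij_betw_nth) (use assms in auto)
  have r: "r (ps ! i) = qs ! i" if "i < length ps" for i
    unfolding r_def using bij that by (simp add: bij_betw_inv_into_left)
  have "complex_of_real (\<Sum>p\<in>set ps. of_rat (r p) * ln (real p)) =
      (\<Sum>i<length ps. of_rat (r (ps ! i)) * of_real (ln (real (ps ! i))))"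
    unfolding sum.reindex_bij_betw[OF bij, symmetric] by (simp add: of_real_rat)
  also have "\<dots> = 0" using sum by (simp add: r)
  finally have sum: "(\<Sum>p\<in>set ps. of_rat (r p) * ln (real p)) = 0" by (simp only: of_real_eq_0_iff)
  obtain D where D: "D > 0" "\<And>p. p \<in> set ps \<Longrightarrow> \<exists>z. of_int D * r p = of_int z"
    using common_denominator[of "set ps" r] by auto
  then obtain z where z: "\<And>p. p \<in> set ps \<Longrightarrow> of_int D * r p = of_int (z p)" by metis
  have "(\<Sum>p\<in>set ps. z p * ln (real p)) = (\<Sum>p\<in>set ps. of_int D * (of_rat (r p) * ln (real p)))"
  proof (rule sum.cong)
    fix p assume "p \<in> set ps"
    then have "of_rat (of_int D * r p) = (of_int (z p) :: real)" by (simp add: z)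
    then show "z p * ln (real p) = of_int D * (of_rat (r p) * ln (real p))"
      by (simp add: of_rat_mult)
  qed simp
  also have "\<dots> = 0" using sum by (simp flip: sum_distrib_left)
  finally have "z p = 0" if "p \<in> set ps" for p
    using ln_prime_combination_zero[of "set ps" z p] assms that by auto
  then have r0: "r p = 0" if "p \<in> set ps" for p using z[OF that] D(1) that by simp
  obtain i where "i < length qs" "q = qs ! i" using q by (metis in_set_conv_nth)
  then show "q = 0" using r[of i] r0[of "ps ! i"] len by simp
qed

text \<open>An entry equal to \<open>n\<close> is a root of \<open>X - n\<close>. This rules out the
  exponentials of the logarithms of primes, which are the primes themselves.\<close>

lemma alg_indep_not_nat:
  assumes "Q_alg_indep xs" "j < length xs" shows "xs ! j \<noteq> of_nat n"
proof
  assume xj: "xs ! j = of_nat n"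
  \<comment> \<open>Exponent vectors of the monomials \<open>1\<close> and \<open>X_j\<close>, the
    two terms of \<open>X_j - n\<close>.\<close>
  define e0 where "e0 = replicate (length xs) (0 :: nat)"
  define e1 where "e1 = e0[j := 1]"
  have ne: "e0 \<noteq> e1" using assms(2) by (metis e0_def e1_def length_replicate nth_list_update_eq nth_replicate zero_neq_one)
  have p0: "(\<Prod>i<length xs. (xs ! i) ^ (e0 ! i)) = 1" by (simp add: e0_def)
  have "(\<Prod>i<length xs. (xs ! i) ^ (e1 ! i)) = (\<Prod>i<length xs. if i = j then xs ! j else 1)"
    by (rule prod.cong) (auto simp: e0_def e1_def nth_list_update)
  then have p1: "(\<Prod>i<length xs. (xs ! i) ^ (e1 ! i)) = of_nat n" using assms(2) xj by simp
  define c where "c e = (if e = e1 then 1 else - of_nat n :: rat)" for e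
  have "(\<Sum>e\<in>{e0, e1}. of_rat (c e) * (\<Prod>i<length xs. (xs ! i) ^ (e ! i))) = 0"
    using ne by (simp add: p0 p1 c_def of_rat_minus)
  moreover have "\<forall>e\<in>{e0, e1}. length e = length xs" by (simp add: e0_def e1_def)
  ultimately have "\<forall>e\<in>{e0, e1}. c e = 0"
    using assms(1)[unfolded Q_alg_indep_def, rule_format, of "{e0, e1}" c] by blast
  then show False by (simp add: c_def)
qed

text \<open>Of the \<open>2 n\<close> generators in the conjecture, the last \<open>n\<close> are
  natural numbers and cannot belong to an independent family. The \<open>n\<close> selected ones are
  therefore exactly the logarithms, in the order given by the selection.\<close>

lemma ln_primes_alg_indep:
  assumes "schanuel_conjecture" "finite S" "\<And>p. p \<in> S \<Longrightarrow> prime p"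
  shows "\<exists>ps. distinct ps \<and> set ps = S \<and> Q_alg_indep (map (\<lambda>p. of_real (ln (real p))) ps)"
proof -
  obtain ps where ps: "distinct ps" "set ps = S" using finite_distinct_list[OF assms(2)] by blast
  let ?zs = "map (\<lambda>p. of_real (ln (real p)) :: complex) ps"
  have "Q_lin_indep ?zs" using ps assms(3) by (intro Q_lin_indep_ln_primes) auto
  then obtain js where js: "distinct js" "length js = length ps" "set js \<subseteq> {..<2 * length ps}"
    "Q_alg_indep (map (\<lambda>i. (?zs @ map exp ?zs) ! i) js)"
    using assms(1) unfolding schanuel_conjecture_def by fastforce
  have lt: "i < length ps" if i: "i \<in> set js" for i
  proof (rule ccontr)
    assume "\<not> i < length ps"
    moreover have "i < 2 * length ps" using js(3) i by auto
    ultimately have *: "(?zs @ map exp ?zs) ! i = of_nat (ps ! (i - length ps))"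
      and "i - length ps < length ps"
      using assms(3)[of "ps ! (i - length ps)"] ps(2) nth_mem[of "i - length ps" ps]
      by (auto simp: nth_append exp_of_real prime_gt_0_nat)
    obtain k where "k < length js" "js ! k = i" using i by (metis in_set_conv_nth)
    then show False using alg_indep_not_nat[OF js(4), of k] * by auto
  qed
  have "set js = {..<length ps}"
    by (rule card_subset_eq) (use lt js(1,2) in \<open>auto simp: distinct_card\<close>)
  moreover have "inj_on ((!) ps) {..<length ps}" using ps(1) by (auto simp: inj_on_def nth_eq_iff_index_eq)
  ultimately have "distinct (map ((!) ps) js)" "set (map ((!) ps) js) = S"
    using js(1) ps bij_betw_imp_surj_on[OF bij_betw_nth[OF ps(1) refl refl]]
    by (simp_all add: distinct_map)
  moreover have "map (\<lambda>i. (?zs @ map exp ?zs) ! i) js = map (\<lambda>p. of_real (ln (real p))) (map ((!) ps) js)"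
    using lt by (auto simp: nth_append)
  ultimately show ?thesis using js(4) by metis
qed

lemma sum_list_eq_sum_count:
  fixes g :: "'b \<Rightarrow> 'a::comm_ring_1"
  assumes "finite T" "set l \<subseteq> T"
  shows "sum_list (map g l) = (\<Sum>e\<in>T. of_nat (count (mset l) e) * g e)"
  using assms(2)
proof (induction l)
  case (Cons x l)
  have "(\<Sum>e\<in>T. of_nat (count (mset (x # l)) e) * g e)
     = (\<Sum>e\<in>T. of_nat (count (mset l) e) * g e + (if e = x then g x else 0))"
    by (rule sum.cong) (auto simp: algebra_simps)
  also have "\<dots> = (\<Sum>e\<in>T. of_nat (count (mset l) e) * g e) + g x"
    using Cons.prems assms(1) by (simp add: sum.distrib)
  finally show ?case using Cons by (simp add: add.commute)
qed simp

lemma prod_list_eq_prod_count: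
  fixes g :: "'b \<Rightarrow> 'a::comm_ring_1"
  assumes "finite T" "set l \<subseteq> T"
  shows "prod_list (map g l) = (\<Prod>e\<in>T. g e ^ count (mset l) e)"
  using assms(2)
proof (induction l)
  case (Cons x l)
  have "(\<Prod>e\<in>T. g e ^ count (mset (x # l)) e)
     = (\<Prod>e\<in>T. g e ^ count (mset l) e * (if e = x then g x else 1))"
    by (rule prod.cong) auto
  also have "\<dots> = (\<Prod>e\<in>T. g e ^ count (mset l) e) * g x"
    using Cons.prems assms(1) by (simp add: prod.distrib)
  finally show ?case using Cons by (simp add: mult.commute)
qed simp

text \<open>Equal values give a polynomial relation among independent logarithms, with differences
  of monomial multiplicities as coefficients. All of them vanish, so the multisets of exponent
  vectors agree, and these determine the monomials.\<close>

lemma pval_eq_imp_peq: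
  assumes "schanuel_conjecture" and prime: "\<And>m b. m \<in> set P \<union> set Q \<Longrightarrow> b \<in> set m \<Longrightarrow> prime b"
    and eq: "pval P = pval Q"
  shows "peq P Q"
proof -
  let ?S = "\<Union> (set ` (set P \<union> set Q))"
  have "finite ?S" "\<And>p. p \<in> ?S \<Longrightarrow> prime p" using prime by auto
  from ln_primes_alg_indep[OF assms(1) this] obtain ps where ps: "distinct ps" "set ps = ?S"
    "Q_alg_indep (map (\<lambda>p. of_real (ln (real p))) ps)" by auto
  define vec where "vec M = map (count M) ps" for M :: "nat multiset"
  define val where "val e = (\<Prod>i<length ps. complex_of_real (ln (real (ps ! i))) ^ (e ! i))" for e :: "nat list"
  have val: "val (vec (mset m)) = of_real (\<Prod>b\<leftarrow>m. ln (real b))" if "m \<in> set P \<union> set Q" for m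
  proof -
    have "(\<Prod>b\<leftarrow>m. ln (real b)) = (\<Prod>b\<in>?S. ln (real b) ^ count (mset m) b)"
      by (rule prod_list_eq_prod_count) (use that in auto)
    also have "\<dots> = (\<Prod>i<length ps. ln (real (ps ! i)) ^ count (mset m) (ps ! i))"
      unfolding ps(2)[symmetric]
      by (rule prod.reindex_bij_betw[OF bij_betw_nth, symmetric]) (use ps(1) in auto)
    finally show ?thesis by (simp add: val_def vec_def)
  qed
  define L where "L P = map vec (map mset P)" for P :: poly
  have L: "of_real (pval R) = sum_list (map val (L R))" if "set R \<subseteq> set P \<union> set Q" for R
    using that by (induction R) (auto simp: L_def val)
  let ?T = "set (L P) \<union> set (L Q)"
  define c where "c e = of_nat (count (mset (L P)) e) - (of_nat (count (mset (L Q)) e) :: rat)" for e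
  have "(\<Sum>e\<in>?T. of_rat (c e) * val e) = sum_list (map val (L P)) - sum_list (map val (L Q))"
    unfolding c_def
    by (subst (1 2) sum_list_eq_sum_count[of ?T])
      (auto simp: of_rat_diff left_diff_distrib sum_subtractf)
  also have "\<dots> = 0" using L[of P] L[of Q] eq by simp
  finally have "(\<Sum>e\<in>?T. of_rat (c e) * val e) = 0" .
  moreover have "\<forall>e\<in>?T. length e = length ps" by (auto simp: L_def vec_def)
  ultimately have c: "\<forall>e\<in>?T. c e = 0"
    using ps(3)[unfolded Q_alg_indep_def, rule_format, of ?T c] by (simp add: val_def)
  have "mset (L P) = mset (L Q)"
    unfolding mset_eq_iff_ball using c by (auto simp: c_def)
  then have im: "image_mset vec (mset (map mset P)) = image_mset vec (mset (map mset Q))"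
    unfolding L_def mset_map .
  \<comment> \<open>Every monomial involved has its factors in \<open>?S\<close>, and
    \<open>ps\<close> lists all of \<open>?S\<close>, so no multiplicity escapes the exponent
    vector.\<close>
  have inj: "inj_on vec (mset ` (set P \<union> set Q))"
  proof (rule inj_onI)
    fix M N assume M: "M \<in> mset ` (set P \<union> set Q)" and N: "N \<in> mset ` (set P \<union> set Q)" and e: "vec M = vec N"
    show "M = N"
    proof (rule multiset_eqI)
      fix b
      show "count M b = count N b"
      proof (cases "b \<in> ?S")
        case True
        then show ?thesis using e ps(2) unfolding vec_def by (metis map_eq_conv)
      next
        case False
        then have "b \<notin># M" "b \<notin># N" using M N by auto
        then show ?thesis by (simp add: not_in_iff)
      qed
    qed
  qed
  have "image_mset (inv_into (mset ` (set P \<union> set Q)) vec) (image_mset vec (mset (map mset R))) = mset (map mset R)"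
    if "set R \<subseteq> set P \<union> set Q" for R
    using that by (induction R) (auto simp: inv_into_f_f[OF inj])
  from this[of P] this[of Q] show ?thesis unfolding peq_iff im by simp
qed

definition poly_over_primes :: "poly \<Rightarrow> bool" where
  "poly_over_primes P \<longleftrightarrow> (\<forall>m\<in>set P. \<forall>b\<in>set m. prime b)"

definition elem_over_primes :: "elem \<Rightarrow> bool" where
  "elem_over_primes e \<longleftrightarrow> poly_over_primes (fst e) \<and> poly_over_primes (snd e)"

lemma ele_check_complete:
  assumes "schanuel_conjecture" "elem_over_primes e" "eval e \<le> 0"
  shows "eventually (\<lambda>n. ele_check n e) sequentially"
proof (cases "eval e = 0")
  case True
  then have "peq (fst e) (snd e)"
    using assms by (intro pval_eq_imp_peq) (auto simp: elem_over_primes_def poly_over_primes_def eval_def)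
  then show ?thesis by (simp add: ele_check_def)
next
  case False
  then show ?thesis using assms(3) eneg_check_complete[of e]
    by (auto simp: ele_check_def elim: eventually_mono)
qed

section \<open>An alternative of Gordan over an ordered subfield\<close>

type_synonym row = "bool \<times> (nat \<Rightarrow> real)"

definition dot :: "nat \<Rightarrow> (nat \<Rightarrow> real) \<Rightarrow> (nat \<Rightarrow> real) \<Rightarrow> real" where
  "dot m a y = (\<Sum>j<m. a j * y j)"

definition sat :: "nat \<Rightarrow> (nat \<Rightarrow> real) \<Rightarrow> row \<Rightarrow> bool" where
  "sat m y r \<longleftrightarrow> dot m (snd r) y \<le> 0 \<and> (fst r \<longrightarrow> dot m (snd r) y < 0)"

text \<open>Consequences by positive combination; one strict member makes the combination strict. A
  strict row with zero coefficients is the contradiction \<open>0 < 0\<close>.\<close>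

inductive_set cone :: "row set \<Rightarrow> row set" for R where
  base: "r \<in> R \<Longrightarrow> r \<in> cone R"
| add: "(s, a) \<in> cone R \<Longrightarrow> (t, b) \<in> cone R \<Longrightarrow> c > 0 \<Longrightarrow> d > 0 \<Longrightarrow>
    (s \<or> t, \<lambda>j. c * a j + d * b j) \<in> cone R"

lemma cone_subset: "r \<in> cone R' \<Longrightarrow> R' \<subseteq> cone R \<Longrightarrow> r \<in> cone R"
  by (induction rule: cone.induct) (auto intro: cone.add)

definition subfield :: "real set \<Rightarrow> bool" where
  "subfield K \<longleftrightarrow> 0 \<in> K \<and> 1 \<in> K \<and> (\<forall>x\<in>K. \<forall>y\<in>K. x + y \<in> K \<and> x - y \<in> K \<and> x * y \<in> K \<and> x / y \<in> K)"

lemma subfield_sum: "subfield K \<Longrightarrow> (\<And>i. i \<in> I \<Longrightarrow> f i \<in> K) \<Longrightarrow> sum f I \<in> K"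
  by (induction I rule: infinite_finite_induct) (auto simp: subfield_def)

text \<open>The solution is the midpoint of the tightest bounds, or one unit beyond the only
  tightest bound, and thus stays in \<open>K\<close>. The flags \<open>sp\<close> and
  \<open>sn\<close> mark strict bounds.\<close>

lemma between_bounds:
  fixes U L :: "'b \<Rightarrow> real"
  assumes K: "subfield K" and fin: "finite P" "finite N"
    and UK: "\<And>p. p \<in> P \<Longrightarrow> U p \<in> K" and LK: "\<And>n. n \<in> N \<Longrightarrow> L n \<in> K"
    and LU: "\<And>p n. p \<in> P \<Longrightarrow> n \<in> N \<Longrightarrow> L n \<le> U p \<and> (sp p \<or> sn n \<longrightarrow> L n < U p)"
  shows "\<exists>t\<in>K. (\<forall>p\<in>P. t \<le> U p \<and> (sp p \<longrightarrow> t < U p)) \<and> (\<forall>n\<in>N. L n \<le> t \<and> (sn n \<longrightarrow> L n < t))"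
proof -
  have K1: "x \<in> K \<Longrightarrow> y \<in> K \<Longrightarrow> (x + y) / 2 \<in> K" "x \<in> K \<Longrightarrow> x + 1 \<in> K" "x \<in> K \<Longrightarrow> x - 1 \<in> K" for x y
  proof -
    have "1 + 1 \<in> K" using K unfolding subfield_def by blast
    then have "2 \<in> K" by simp
    then show "x \<in> K \<Longrightarrow> y \<in> K \<Longrightarrow> (x + y) / 2 \<in> K" "x \<in> K \<Longrightarrow> x + 1 \<in> K" "x \<in> K \<Longrightarrow> x - 1 \<in> K"
      using K unfolding subfield_def by blast+
  qed
  have P: "\<exists>p\<in>P. \<forall>q\<in>P. U p \<le> U q" if "P \<noteq> {}"
    using arg_min_least[OF fin(1) that, of _ U] arg_min_if_finite(1)[OF fin(1) that, of U] by auto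
  have N: "\<exists>n\<in>N. \<forall>q\<in>N. L q \<le> L n" if "N \<noteq> {}"
    using arg_min_least[OF fin(2) that, of _ "\<lambda>n. - L n"] arg_min_if_finite(1)[OF fin(2) that, of "\<lambda>n. - L n"]
    by auto
  consider "P = {}" "N = {}" | "P = {}" "N \<noteq> {}" | "P \<noteq> {}" "N = {}" | "P \<noteq> {}" "N \<noteq> {}" by blast
  then show ?thesis
  proof cases
    case 1
    then show ?thesis using K by (auto simp: subfield_def)
  next
    case 2
    then obtain n where n: "n \<in> N" "\<forall>q\<in>N. L q \<le> L n" using N by blast
    then show ?thesis using 2 K1(2)[OF LK[OF n(1)]] by (intro bexI[of _ "L n + 1"]) auto
  next
    case 3
    then obtain p where p: "p \<in> P" "\<forall>q\<in>P. U p \<le> U q" using P by blast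
    then show ?thesis using 3 K1(3)[OF UK[OF p(1)]] by (intro bexI[of _ "U p - 1"]) auto
  next
    case 4
    then obtain n where n: "n \<in> N" "\<forall>q\<in>N. L q \<le> L n" using N by blast
    obtain p where p: "p \<in> P" "\<forall>q\<in>P. U p \<le> U q" using P 4 by blast
    let ?t = "(L n + U p) / 2"
    have "\<forall>q\<in>P. ?t \<le> U q \<and> (sp q \<longrightarrow> ?t < U q)"
    proof
      fix q assume q: "q \<in> P"
      show "?t \<le> U q \<and> (sp q \<longrightarrow> ?t < U q)" using p(2) q LU[OF q n(1)] by (auto simp: field_simps)
    qed
    moreover have "\<forall>q\<in>N. L q \<le> ?t \<and> (sn q \<longrightarrow> L q < ?t)"
    proof
      fix q assume q: "q \<in> N"
      show "L q \<le> ?t \<and> (sn q \<longrightarrow> L q < ?t)" using n(2) q LU[OF p(1) q] by (auto simp: field_simps)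
    qed
    ultimately show ?thesis using K1(1)[OF LK[OF n(1)] UK[OF p(1)]] by blast
  qed
qed

text \<open>Two rows with opposite signs at the last variable are replaced by the positive
  combination in which it cancels. A solution of the remaining system extends by
  \<open>between_bounds\<close>; a contradiction derived from combinations is also one from
  \<open>R\<close>. Only field operations occur, which keeps the solution in
  \<open>K\<close>.\<close>

lemma fourier_motzkin:
  assumes K: "subfield K" and "finite R" "\<And>r j. r \<in> R \<Longrightarrow> j < m \<Longrightarrow> snd r j \<in> K"
  shows "(\<exists>y. (\<forall>j<m. y j \<in> K) \<and> (\<forall>r\<in>R. sat m y r)) \<or> (\<exists>z. (True, z) \<in> cone R \<and> (\<forall>j<m. z j = 0))"
  using assms(2,3)
proof (induction m arbitrary: R)
  case 0
  show ?case
  proof (cases "\<exists>r\<in>R. fst r")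
    case True
    then obtain z where "(True, z) \<in> R" by (metis prod.collapse)
    then show ?thesis by (auto intro: cone.base)
  qed (auto simp: sat_def dot_def)
next
  case (Suc m)
  define P where "P = {r \<in> R. snd r m > 0}"
  define N where "N = {r \<in> R. snd r m < 0}"
  define comb :: "row \<Rightarrow> row \<Rightarrow> row" where
    "comb p n = (fst p \<or> fst n, \<lambda>j. (- snd n m) * snd p j + snd p m * snd n j)" for p n
  define R' where "R' = {r \<in> R. snd r m = 0} \<union> (\<lambda>(p, n). comb p n) ` (P \<times> N)"
  have fin: "finite P" "finite N" using Suc.prems(1) by (auto simp: P_def N_def)
  then have "finite R'" using Suc.prems(1) by (auto simp: R'_def)
  moreover have "snd r j \<in> K" if "r \<in> R'" "j < m" for r j
  proof -
    have "snd (comb p n) j \<in> K" if "p \<in> P" "n \<in> N" for p n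
    proof -
      have "snd p j \<in> K" "snd n j \<in> K" "snd p m \<in> K" "snd n m \<in> K"
        using that \<open>j < m\<close> Suc.prems(2) by (auto simp: P_def N_def)
      moreover from this K have "0 - snd n m \<in> K" unfolding subfield_def by blast
      ultimately show ?thesis using K unfolding subfield_def comb_def by simp
    qed
    moreover have "snd r j \<in> K" if "r \<in> R" for r using Suc.prems(2)[OF that, of j] \<open>j < m\<close> by simp
    moreover have "r \<in> R \<or> (\<exists>p\<in>P. \<exists>n\<in>N. r = comb p n)" using that by (force simp: R'_def)
    ultimately show ?thesis by metis
  qed
  ultimately consider y where "\<forall>j<m. y j \<in> K" "\<forall>r\<in>R'. sat m y r"
    | z where "(True, z) \<in> cone R'" "\<forall>j<m. z j = 0" using Suc.IH by blast
  then show ?case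
  proof cases
    case 2
    have "comb p n \<in> cone R" if "p \<in> P" "n \<in> N" for p n
      using cone.add[of "fst p" "snd p" R "fst n" "snd n" "- snd n m" "snd p m"] that
      by (auto simp: P_def N_def comb_def intro: cone.base)
    then have "R' \<subseteq> cone R" unfolding R'_def by (auto intro: cone.base)
    then have "(True, z) \<in> cone R" by (rule cone_subset[OF 2(1)])
    moreover have "snd r m = 0" if "r \<in> cone R'" for r
      using that by induction (auto simp: R'_def comb_def)
    then have "z m = 0" using 2(1) by fastforce
    ultimately show ?thesis using 2(2) less_Suc_eq by auto
  next
    case (1 y)
    \<comment> \<open>The row solved for the last variable: an upper bound on it if the coefficient
      is positive, a lower bound if it is negative.\<close>
    define U where "U r = - dot m (snd r) y / snd r m" for r :: row
    have UK: "U r \<in> K" if "r \<in> R" for r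
    proof -
      have "dot m (snd r) y \<in> K" unfolding dot_def
        by (rule subfield_sum[OF K]) (use K 1(1) Suc.prems(2) that in \<open>auto simp: subfield_def\<close>)
      moreover have "0 \<in> K" using K by (simp add: subfield_def)
      ultimately have "0 - dot m (snd r) y \<in> K" using K unfolding subfield_def by blast
      then have "(0 - dot m (snd r) y) / snd r m \<in> K"
        using K Suc.prems(2)[OF that, of m] unfolding subfield_def by blast
      then show ?thesis by (simp add: U_def)
    qed
    have "\<exists>t\<in>K. (\<forall>p\<in>P. t \<le> U p \<and> (fst p \<longrightarrow> t < U p)) \<and> (\<forall>n\<in>N. U n \<le> t \<and> (fst n \<longrightarrow> U n < t))"
    proof (rule between_bounds[OF K fin])
      fix p n assume p: "p \<in> P" and n: "n \<in> N"
      have "sat m y (comb p n)" using 1(2) p n by (auto simp: R'_def)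
      moreover have "dot m (snd (comb p n)) y = - snd n m * dot m (snd p) y + snd p m * dot m (snd n) y"
        by (simp add: dot_def comb_def sum.distrib sum_distrib_left algebra_simps sum_negf sum_subtractf)
      ultimately show "U n \<le> U p \<and> (fst p \<or> fst n \<longrightarrow> U n < U p)"
        using p n by (auto simp: sat_def U_def P_def N_def comb_def field_simps)
    qed (use UK in \<open>auto simp: P_def N_def\<close>)
    then obtain t where t: "t \<in> K" "\<And>p. p \<in> P \<Longrightarrow> t \<le> U p \<and> (fst p \<longrightarrow> t < U p)"
      "\<And>n. n \<in> N \<Longrightarrow> U n \<le> t \<and> (fst n \<longrightarrow> U n < t)" by blast
    let ?y = "y(m := t)"
    have dot: "dot (Suc m) a ?y = dot m a y + a m * t" for a by (simp add: dot_def)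
    have "sat (Suc m) ?y r" if r: "r \<in> R" for r
    proof -
      consider "snd r m = 0" | "r \<in> P" | "r \<in> N" using r by (auto simp: P_def N_def) (meson linorder_neqE_linordered_idom)
      then show ?thesis
      proof cases
        case a: 1
        then have "sat m y r" using 1(2) r by (auto simp: R'_def)
        then show ?thesis using a by (simp add: sat_def dot)
      next
        case 2
        then show ?thesis using t(2)[OF 2] by (auto simp: sat_def dot U_def P_def field_simps)
      next
        case 3
        then show ?thesis using t(3)[OF 3] by (auto simp: sat_def dot U_def N_def field_simps)
      qed
    qed
    moreover have "\<forall>j<Suc m. ?y j \<in> K" using 1(1) t(1) by (auto simp: less_Suc_eq)
    ultimately show ?thesis by blast
  qed
qed

lemma gordan:
  fixes V :: "'i \<Rightarrow> nat \<Rightarrow> real"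
  assumes K: "subfield K" and I: "finite I" and VK: "\<And>i j. i \<in> I \<Longrightarrow> j < m \<Longrightarrow> V i j \<in> K"
  obtains (functional) y where "\<And>j. j < m \<Longrightarrow> y j \<in> K" "\<And>j. j < m \<Longrightarrow> y j \<ge> 0" "\<exists>j<m. y j > 0"
      "\<And>i. i \<in> I \<Longrightarrow> (\<Sum>j<m. V i j * y j) \<le> 0"
  | (combination) n :: "'i \<Rightarrow> nat" where "\<And>j. j < m \<Longrightarrow> (\<Sum>i\<in>I. n i * V i j) > 0"
proof -
  \<comment> \<open>The rows \<open>V i\<close>, then nonnegativity of each \<open>y j\<close>, then
    strict positivity of their sum, which excludes \<open>y = 0\<close>.\<close>
  define R :: "row set" where "R = (\<lambda>i. (False, V i)) ` I \<union>
    (\<lambda>j. (False, \<lambda>k. if k = j then -1 else 0)) ` {..<m} \<union> {(True, \<lambda>_. -1)}"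
  have m1: "-1 \<in> K" "0 \<in> K"
  proof -
    have "0 - 1 \<in> K" using K unfolding subfield_def by blast
    then show "-1 \<in> K" "0 \<in> K" using K by (simp_all add: subfield_def)
  qed
  have "finite R" using I by (simp add: R_def)
  moreover have "snd r j \<in> K" if "r \<in> R" "j < m" for r j
    using that VK m1 by (auto simp: R_def)
  ultimately consider y where "\<forall>j<m. y j \<in> K" "\<forall>r\<in>R. sat m y r"
    | z where "(True, z) \<in> cone R" "\<forall>j<m. z j = 0" using fourier_motzkin[OF K] by blast
  then show ?thesis
  proof cases
    case (1 y)
    have nn: "y j \<ge> 0" if "j < m" for j
    proof -
      have "sat m y (False, \<lambda>k. if k = j then -1 else 0)" using 1(2) that by (auto simp: R_def)
      moreover have "dot m (\<lambda>k. if k = j then -1 else 0) y = (\<Sum>k<m. if k = j then - y j else 0)"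
        unfolding dot_def by (rule sum.cong) auto
      ultimately show ?thesis using that by (simp add: sat_def)
    qed
    have "sat m y (True, \<lambda>_. -1)" using 1(2) by (auto simp: R_def)
    then have "(\<Sum>j<m. y j) > 0" by (simp add: sat_def dot_def sum_negf)
    then have "\<exists>j<m. y j > 0" using sum_nonpos[of "{..<m}" y] by (meson lessThan_iff not_le)
    moreover have "(\<Sum>j<m. V i j * y j) \<le> 0" if "i \<in> I" for i
    proof -
      have "sat m y (False, V i)" using 1(2) that by (auto simp: R_def)
      then show ?thesis by (simp add: sat_def dot_def)
    qed
    ultimately show ?thesis using functional 1(1) nn by blast
  next
    case (2 z)
    \<comment> \<open>Every derivable row is dominated by a nonnegative combination of the
      \<open>V i\<close>, as the other rows of \<open>R\<close> have no positive entry. Applied to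
      the strict zero row this is the desired strict positivity.\<close>
    have "\<exists>x. (\<forall>i\<in>I. x i \<ge> 0) \<and> (\<forall>j<m. snd r j \<le> (\<Sum>i\<in>I. x i * V i j) \<and>
       (fst r \<longrightarrow> snd r j < (\<Sum>i\<in>I. x i * V i j)))" if "r \<in> cone R" for r
      using that
    proof induction
      case (base r)
      show ?case
      proof (cases "r \<in> (\<lambda>i. (False, V i)) ` I")
        case True
        then obtain i where i: "i \<in> I" "r = (False, V i)" by auto
        have "(\<Sum>k\<in>I. of_bool (k = i) * V k j) = (\<Sum>k\<in>I. if k = i then V i j else 0)" for j
          by (rule sum.cong) auto
        then show ?thesis using i I by (intro exI[of _ "\<lambda>k. of_bool (k = i)"]) simp
      next
        case False
        then show ?thesis using base by (intro exI[of _ "\<lambda>_. 0"]) (auto simp: R_def)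
      qed
    next
      case (add s a t b c d)
      obtain x where x: "\<forall>i\<in>I. x i \<ge> 0" "\<forall>j<m. a j \<le> (\<Sum>i\<in>I. x i * V i j) \<and> (s \<longrightarrow> a j < (\<Sum>i\<in>I. x i * V i j))"
        using add.IH(1) by auto
      obtain x' where x': "\<forall>i\<in>I. x' i \<ge> 0" "\<forall>j<m. b j \<le> (\<Sum>i\<in>I. x' i * V i j) \<and> (t \<longrightarrow> b j < (\<Sum>i\<in>I. x' i * V i j))"
        using add.IH(2) by auto
      have e: "(\<Sum>i\<in>I. (c * x i + d * x' i) * V i j) = c * (\<Sum>i\<in>I. x i * V i j) + d * (\<Sum>i\<in>I. x' i * V i j)" for j
        by (simp add: sum_distrib_left sum.distrib algebra_simps)
      show ?case
      proof (intro exI[of _ "\<lambda>i. c * x i + d * x' i"] conjI ballI allI impI)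
        fix i assume "i \<in> I"
        then show "0 \<le> c * x i + d * x' i" using x x' add.hyps by simp
      next
        fix j assume "j < m"
        then have le: "c * a j \<le> c * (\<Sum>i\<in>I. x i * V i j)" "d * b j \<le> d * (\<Sum>i\<in>I. x' i * V i j)"
          "s \<Longrightarrow> c * a j < c * (\<Sum>i\<in>I. x i * V i j)" "t \<Longrightarrow> d * b j < d * (\<Sum>i\<in>I. x' i * V i j)"
          using x x' add.hyps by simp_all
        show "snd (s \<or> t, \<lambda>j. c * a j + d * b j) j \<le> (\<Sum>i\<in>I. (c * x i + d * x' i) * V i j)"
          using le by (simp add: e)
        show "snd (s \<or> t, \<lambda>j. c * a j + d * b j) j < (\<Sum>i\<in>I. (c * x i + d * x' i) * V i j)"
          if "fst (s \<or> t, \<lambda>j. c * a j + d * b j)"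
          using le that by (auto simp: e)
      qed
    qed
    from this[OF 2(1)] 2(2) obtain x where x: "\<And>i. i \<in> I \<Longrightarrow> x i \<ge> 0" "\<And>j. j < m \<Longrightarrow> (\<Sum>i\<in>I. x i * V i j) > 0"
      by auto
    \<comment> \<open>Preparation for rounding: replacing \<open>N * x i\<close> by its floor
      changes each coefficient by at most 1, hence each sum by at most the sum of the absolute
      values, which a large \<open>N\<close> outweighs.\<close>
    have "eventually (\<lambda>N. \<forall>j\<in>{..<m}. (\<Sum>i\<in>I. \<bar>V i j\<bar>) < real N * (\<Sum>i\<in>I. x i * V i j)) sequentially"
    proof (rule eventually_ball_finite)
      show "\<forall>j\<in>{..<m}. eventually (\<lambda>N. (\<Sum>i\<in>I. \<bar>V i j\<bar>) < real N * (\<Sum>i\<in>I. x i * V i j)) sequentially"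
      proof
        fix j assume "j \<in> {..<m}"
        then have p: "(\<Sum>i\<in>I. x i * V i j) > 0" using x by simp
        obtain N0 :: nat where "(\<Sum>i\<in>I. \<bar>V i j\<bar>) / (\<Sum>i\<in>I. x i * V i j) < real N0"
          using reals_Archimedean2 by blast
        then show "eventually (\<lambda>N. (\<Sum>i\<in>I. \<bar>V i j\<bar>) < real N * (\<Sum>i\<in>I. x i * V i j)) sequentially"
          using p unfolding eventually_sequentially
          by (intro exI[of _ N0]) (auto simp: field_simps intro: less_le_trans mult_left_mono)
      qed
    qed simp
    then obtain N :: nat where N: "\<And>j. j < m \<Longrightarrow> (\<Sum>i\<in>I. \<bar>V i j\<bar>) < real N * (\<Sum>i\<in>I. x i * V i j)"
      by (auto simp: eventually_sequentially)
    define n where "n i = nat \<lfloor>real N * x i\<rfloor>" for i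
    have "(\<Sum>i\<in>I. n i * V i j) > 0" if "j < m" for j
    proof -
      have "\<bar>real N * x i - n i\<bar> \<le> 1" if "i \<in> I" for i
        using x(1)[OF that] unfolding n_def by (simp add: of_nat_nat) linarith
      then have "(real N * x i - n i) * V i j \<le> \<bar>V i j\<bar>" if "i \<in> I" for i
        using that mult_right_mono[of "\<bar>real N * x i - n i\<bar>" 1 "\<bar>V i j\<bar>"]
        by (simp flip: abs_mult)
      then have "(\<Sum>i\<in>I. (real N * x i - n i) * V i j) \<le> (\<Sum>i\<in>I. \<bar>V i j\<bar>)" by (rule sum_mono)
      moreover have "(\<Sum>i\<in>I. (real N * x i - n i) * V i j) = real N * (\<Sum>i\<in>I. x i * V i j) - (\<Sum>i\<in>I. n i * V i j)"
        by (simp add: sum_distrib_left sum_subtractf algebra_simps)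
      ultimately show ?thesis using N[OF that] by linarith
    qed
    then show ?thesis by (rule combination)
  qed
qed

section \<open>The ring and the field generated by logarithms of primes\<close>

definition ln_ring :: "real set" where
  "ln_ring = {eval e |e. elem_over_primes e}"

lemma elem_over_primes_ops:
  "elem_over_primes e \<Longrightarrow> elem_over_primes f \<Longrightarrow> elem_over_primes (eadd e f)"
  "elem_over_primes e \<Longrightarrow> elem_over_primes (eneg e)"
  "elem_over_primes e \<Longrightarrow> elem_over_primes f \<Longrightarrow> elem_over_primes (emul e f)"
  by (auto simp: elem_over_primes_def poly_over_primes_def eadd_def eneg_def emul_def pmul_def)

lemma ln_ring_closed:
  "0 \<in> ln_ring" "1 \<in> ln_ring" "x \<in> ln_ring \<Longrightarrow> y \<in> ln_ring \<Longrightarrow> x + y \<in> ln_ring"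
  "x \<in> ln_ring \<Longrightarrow> - x \<in> ln_ring" "x \<in> ln_ring \<Longrightarrow> y \<in> ln_ring \<Longrightarrow> x * y \<in> ln_ring"
proof -
  show "0 \<in> ln_ring"
    unfolding ln_ring_def
    by (rule CollectI, rule exI[of _ "([], [])"]) (simp add: eval_def elem_over_primes_def poly_over_primes_def)
  show "1 \<in> ln_ring"
    unfolding ln_ring_def
    by (rule CollectI, rule exI[of _ "([[]], [])"]) (simp add: eval_def elem_over_primes_def poly_over_primes_def)
  show "x \<in> ln_ring \<Longrightarrow> y \<in> ln_ring \<Longrightarrow> x + y \<in> ln_ring"
    unfolding ln_ring_def by clarify (metis elem_over_primes_ops(1) eval_simps(1))
  show "x \<in> ln_ring \<Longrightarrow> - x \<in> ln_ring"
    unfolding ln_ring_def by clarify (metis elem_over_primes_ops(2) eval_simps(2))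
  show "x \<in> ln_ring \<Longrightarrow> y \<in> ln_ring \<Longrightarrow> x * y \<in> ln_ring"
    unfolding ln_ring_def by clarify (metis elem_over_primes_ops(3) eval_simps(3))
qed

text \<open>A denominator 0 does no harm: the quotient is then 0, which lies in the ring.\<close>

definition ln_field :: "real set" where
  "ln_field = {x / y |x y. x \<in> ln_ring \<and> y \<in> ln_ring}"

lemma ln_fieldI: "x = a / b \<Longrightarrow> a \<in> ln_ring \<Longrightarrow> b \<in> ln_ring \<Longrightarrow> x \<in> ln_field"
  unfolding ln_field_def by blast

lemma ln_ring_subset_ln_field: "x \<in> ln_ring \<Longrightarrow> x \<in> ln_field"
  by (rule ln_fieldI[of x x 1]) (simp_all add: ln_ring_closed)

lemma subfield_ln_field: "subfield ln_field"
proof -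
  have uminus: "- y \<in> ln_field" if y: "y \<in> ln_field" for y
  proof -
    obtain c d where cd: "y = c / d" "c \<in> ln_ring" "d \<in> ln_ring" using y unfolding ln_field_def by blast
    then show ?thesis by (intro ln_fieldI[of "- y" "- c" d]) (simp_all add: ln_ring_closed)
  qed
  have add: "x + y \<in> ln_field" if xy: "x \<in> ln_field" "y \<in> ln_field" for x y
  proof -
    obtain a b where ab: "x = a / b" "a \<in> ln_ring" "b \<in> ln_ring" using xy(1) unfolding ln_field_def by blast
    obtain c d where cd: "y = c / d" "c \<in> ln_ring" "d \<in> ln_ring" using xy(2) unfolding ln_field_def by blast
    show ?thesis
    proof (cases "b = 0 \<or> d = 0")
      case True
      then show ?thesis using xy ab cd by auto
    next
      case False
      then show ?thesis using ab cd
        by (intro ln_fieldI[of "x + y" "a * d + c * b" "b * d"])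
          (auto simp: add_divide_distrib intro: ln_ring_closed)
    qed
  qed
  have mult: "x * y \<in> ln_field" "x / y \<in> ln_field" if xy: "x \<in> ln_field" "y \<in> ln_field" for x y
  proof -
    obtain a b where ab: "x = a / b" "a \<in> ln_ring" "b \<in> ln_ring" using xy(1) unfolding ln_field_def by blast
    obtain c d where cd: "y = c / d" "c \<in> ln_ring" "d \<in> ln_ring" using xy(2) unfolding ln_field_def by blast
    show "x * y \<in> ln_field"
      by (rule ln_fieldI[of "x * y" "a * c" "b * d"]) (use ab cd in \<open>simp_all add: ln_ring_closed\<close>)
    show "x / y \<in> ln_field"
      by (rule ln_fieldI[of "x / y" "a * d" "b * c"]) (use ab cd in \<open>simp_all add: ln_ring_closed\<close>)
  qed
  have "x - y \<in> ln_field" if "x \<in> ln_field" "y \<in> ln_field" for x y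
    using add[OF that(1) uminus[OF that(2)]] by simp
  with add mult show ?thesis
    unfolding subfield_def by (simp add: ln_ring_subset_ln_field ln_ring_closed(1,2))
qed

lemma ln_field_common_denominator:
  assumes "finite T" "T \<subseteq> ln_field"
  shows "\<exists>D\<in>ln_ring. D > 0 \<and> (\<forall>x\<in>T. D * x \<in> ln_ring)"
  using assms
proof induction
  case empty
  show ?case using ln_ring_closed(2) by (intro bexI[of _ 1]) auto
next
  case (insert x T)
  then obtain D where D: "D \<in> ln_ring" "D > 0" "\<forall>x\<in>T. D * x \<in> ln_ring" by auto
  obtain a b where ab: "x = a / b" "a \<in> ln_ring" "b \<in> ln_ring" using insert.prems by (auto simp: ln_field_def)
  show ?case
  proof (cases "b = 0")
    case True
    then show ?thesis using D ab ln_ring_closed(1) by (intro bexI[of _ D]) auto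
  next
    case False
    \<comment> \<open>The factor \<open>b * b\<close> instead of \<open>b\<close> keeps the common
      denominator positive.\<close>
    have "D * (b * b) * x = (D * b) * a" using ab False by simp
    moreover have "D * (b * b) * y = (b * b) * (D * y)" for y by simp
    ultimately have "\<forall>y\<in>insert x T. D * (b * b) * y \<in> ln_ring"
      using D(1,3) ab ln_ring_closed(5) by (metis insert_iff)
    moreover have "D * (b * b) > 0" using D(2) False by (simp add: zero_less_mult_iff) linarith
    ultimately show ?thesis using D(1) ab(3) ln_ring_closed(5) by blast
  qed
qed

section \<open>Certificates for big-O\<close>

fun path :: "wa \<Rightarrow> nat \<Rightarrow> nat list \<Rightarrow> nat list \<Rightarrow> bool" where
  "path A q [] qs \<longleftrightarrow> qs = []"
| "path A q (a # w) [] \<longleftrightarrow> False"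
| "path A q (a # w) (p # qs) \<longleftrightarrow> p < wa_nst A \<and> wa_M A a q p > 0 \<and> path A p w qs"

fun pweight :: "wa \<Rightarrow> nat \<Rightarrow> nat list \<Rightarrow> nat list \<Rightarrow> rat" where
  "pweight A q (a # w) (p # qs) = wa_M A a q p * pweight A p w qs"
| "pweight A q _ _ = 1"

lemma wa_M_nonneg: "wa_M A a q p \<ge> 0"
  unfolding wa_M_def by (intro sum_list_nonneg) auto

lemma path_length: "path A q w qs \<Longrightarrow> length qs = length w"
  by (induction A q w qs rule: path.induct) auto

lemma path_set: "path A q w qs \<Longrightarrow> set qs \<subseteq> {..<wa_nst A}"
  by (induction A q w qs rule: path.induct) auto

lemma path_last: "path A q w qs \<Longrightarrow> q < wa_nst A \<Longrightarrow> last (q # qs) < wa_nst A"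
  by (induction A q w qs rule: path.induct) auto

lemma finite_paths: "finite {qs. path A q w qs}"
  by (rule finite_subset[OF _ finite_lists_length_eq[of "{..<wa_nst A}" "length w"]])
    (auto dest: path_length path_set)

lemma path_iff_nth:
  "path A q w qs \<longleftrightarrow> length qs = length w \<and> set qs \<subseteq> {..<wa_nst A} \<and>
     (\<forall>i<length w. wa_M A (w ! i) ((q # qs) ! i) (qs ! i) > 0)"
proof (induction A q w qs rule: path.induct)
  case (3 A q a w p qs)
  have "(\<forall>i<length (a # w). wa_M A ((a # w) ! i) ((q # p # qs) ! i) ((p # qs) ! i) > 0) \<longleftrightarrow>
    wa_M A a q p > 0 \<and> (\<forall>i<length w. wa_M A (w ! i) ((p # qs) ! i) (qs ! i) > 0)"
    by (auto simp: less_Suc_eq_0_disj)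
  with 3 show ?case by auto
qed auto

lemma wa_acc_paths_eq: "wa_acc_paths A w = {qs. path A 0 w qs \<and> last (0 # qs) \<in> wa_final A}"
proof -
  have "(0 # qs) ! length w = last (0 # qs)" if "length qs = length w" for qs :: "nat list"
    using that last_conv_nth[of "0 # qs"] by simp
  then show ?thesis unfolding wa_acc_paths_def path_iff_nth by auto
qed

lemma pweight_pos: "path A q w qs \<Longrightarrow> pweight A q w qs > 0"
  by (induction A q w qs rule: path.induct) auto

lemma path_append:
  "length ps = length u \<Longrightarrow> path A q (u @ v) (ps @ qs) \<longleftrightarrow> path A q u ps \<and> path A (last (q # ps)) v qs"
  by (induction A q u ps rule: path.induct) auto

lemma pweight_append:
  "length ps = length u \<Longrightarrow> pweight A q (u @ v) (ps @ qs) = pweight A q u ps * pweight A (last (q # ps)) v qs"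
  by (induction A q u ps rule: path.induct) auto

lemma path_appendE:
  assumes "path A q (u @ v) rs"
  obtains ps qs where "rs = ps @ qs" "path A q u ps" "path A (last (q # ps)) v qs"
proof -
  have l: "length (take (length u) rs) = length u" using path_length[OF assms] by simp
  have "path A q (u @ v) (take (length u) rs @ drop (length u) rs)" using assms by simp
  then have "path A q u (take (length u) rs) \<and> path A (last (q # take (length u) rs)) v (drop (length u) rs)"
    unfolding path_append[OF l] .
  then show ?thesis using that[of "take (length u) rs" "drop (length u) rs"] by simp
qed

text \<open>\<open>path\<close> admits only transitions of positive weight; the others contribute 0
  to the matrix product. Positivity of an entry therefore means that a run exists.\<close>

lemma wa_mat_paths:
  "wa_mat A w q q' = (\<Sum>qs | path A q w qs \<and> last (q # qs) = q'. pweight A q w qs)"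
proof (induction w arbitrary: q)
  case Nil
  have "{qs. path A q [] qs \<and> last (q # qs) = q'} = (if q = q' then {[]} else {})" by auto
  then show ?case by simp
next
  case (Cons a w)
  let ?P = "\<lambda>p. {qs. path A p w qs \<and> last (p # qs) = q'}"
  have fin: "finite (?P p)" for p by (rule finite_subset[OF _ finite_paths[of A p w]]) auto
  let ?S = "Sigma {p. p < wa_nst A \<and> wa_M A a q p > 0} ?P"
  have "{qs. path A q (a # w) qs \<and> last (q # qs) = q'} = (\<lambda>(p, qs). p # qs) ` ?S"
  proof (intro set_eqI iffI)
    fix qs assume "qs \<in> {qs. path A q (a # w) qs \<and> last (q # qs) = q'}"
    then show "qs \<in> (\<lambda>(p, qs). p # qs) ` ?S" by (cases qs) (auto simp: image_iff)
  qed auto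
  moreover have "inj_on (\<lambda>(p, qs). p # qs) ?S" by (auto simp: inj_on_def)
  ultimately have "(\<Sum>qs | path A q (a # w) qs \<and> last (q # qs) = q'. pweight A q (a # w) qs)
      = (\<Sum>(p, qs)\<in>?S. wa_M A a q p * pweight A p w qs)"
    by (simp add: sum.reindex case_prod_unfold)
  also have "\<dots> = (\<Sum>p | p < wa_nst A \<and> wa_M A a q p > 0. wa_M A a q p * wa_mat A w p q')"
    by (subst sum.Sigma[symmetric]) (use fin in \<open>auto simp: Cons sum_distrib_left simp del: last.simps\<close>)
  also have "\<dots> = (\<Sum>p<wa_nst A. wa_M A a q p * wa_mat A w p q')"
    by (rule sum.mono_neutral_left) (auto simp: order_less_le wa_M_nonneg)
  finally show ?case by simp
qed

lemma wa_mat_nonneg: "wa_mat A w q q' \<ge> 0"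
  by (induction w arbitrary: q) (auto intro!: sum_nonneg mult_nonneg_nonneg wa_M_nonneg)

lemma finite_paths_to: "finite {qs. path A q w qs \<and> last (q # qs) = q'}"
  by (rule finite_subset[OF _ finite_paths[of A q w]]) auto

lemma pweight_le_wa_mat: "path A q w qs \<Longrightarrow> pweight A q w qs \<le> wa_mat A w q (last (q # qs))"
  unfolding wa_mat_paths
  by (rule member_le_sum) (auto simp: finite_paths_to less_imp_le[OF pweight_pos] simp del: last.simps)

lemma wa_mat_pos_iff: "wa_mat A w q q' > 0 \<longleftrightarrow> (\<exists>qs. path A q w qs \<and> last (q # qs) = q')"
proof
  assume "wa_mat A w q q' > 0"
  then have "{qs. path A q w qs \<and> last (q # qs) = q'} \<noteq> {}" unfolding wa_mat_paths by (metis less_irrefl sum.empty)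
  then show "\<exists>qs. path A q w qs \<and> last (q # qs) = q'" by blast
next
  assume "\<exists>qs. path A q w qs \<and> last (q # qs) = q'"
  then obtain qs where "path A q w qs" "last (q # qs) = q'" by blast
  then show "wa_mat A w q q' > 0" using pweight_le_wa_mat pweight_pos less_le_trans by metis
qed

lemma wa_mat_append:
  assumes "q < wa_nst A"
  shows "wa_mat A (u @ v) q q' = (\<Sum>p<wa_nst A. wa_mat A u q p * wa_mat A v p q')"
  using assms
proof (induction u arbitrary: q)
  case Nil
  have "(\<Sum>p<wa_nst A. wa_mat A [] q p * wa_mat A v p q') = (\<Sum>p<wa_nst A. if p = q then wa_mat A v q q' else 0)"
    by (rule sum.cong) auto
  then show ?case using Nil by simp
next
  case (Cons a u)
  then show ?case
    by (simp add: sum_distrib_left sum_distrib_right mult.assoc) (rule sum.swap)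
qed

lemma wa_fun_paths: "wa_fun A w = of_rat (\<Sum>qs\<in>wa_acc_paths A w. pweight A 0 w qs)"
proof -
  have "(\<Sum>t\<in>wa_final A. wa_mat A w 0 t) =
     (\<Sum>(t, qs)\<in>(SIGMA t:wa_final A. {qs. path A 0 w qs \<and> last (0 # qs) = t}). pweight A 0 w qs)"
    unfolding wa_mat_paths
    by (rule sum.Sigma) (auto simp: wa_final_def finite_paths_to simp del: last.simps)
  also have "\<dots> = (\<Sum>qs\<in>wa_acc_paths A w. pweight A 0 w qs)"
    by (rule sum.reindex_bij_witness[of _ "\<lambda>qs. (last (0 # qs), qs)" snd])
      (auto simp: wa_acc_paths_eq simp del: last.simps)
  finally show ?thesis by (simp add: wa_fun_def)
qed

lemma finite_acc_paths: "finite (wa_acc_paths A w)"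
  unfolding wa_acc_paths_eq by (rule finite_subset[OF _ finite_paths[of A 0 w]]) auto

lemma acc_path_pweight_le: "qs \<in> wa_acc_paths A w \<Longrightarrow> of_rat (pweight A 0 w qs) \<le> wa_fun A w"
  unfolding wa_fun_paths of_rat_less_eq
  by (rule member_le_sum) (use finite_acc_paths in \<open>auto simp: wa_acc_paths_eq less_imp_le[OF pweight_pos] simp del: last.simps\<close>)

definition fM :: "wa \<Rightarrow> nat \<Rightarrow> nat \<Rightarrow> nat \<Rightarrow> frac" where
  "fM A a q p = fsum (map (\<lambda>e. snd (snd (snd e)))
     (filter (\<lambda>e. fst e = a \<and> fst (snd e) = q \<and> fst (snd (snd e)) = p) (fst (snd A))))"

lemma fM:
  assumes "wa_wf k A"
  shows "snd (fM A a q p) > 0" "fval (fM A a q p) = wa_M A a q p"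
proof -
  let ?l = "map (\<lambda>e. snd (snd (snd e)))
     (filter (\<lambda>e. fst e = a \<and> fst (snd e) = q \<and> fst (snd (snd e)) = p) (fst (snd A)))"
  have *: "\<forall>f\<in>set ?l. snd f > 0" using assms by (auto simp: wa_wf_def wa_entries_def)
  then show "snd (fM A a q p) > 0" unfolding fM_def by (rule fsum)
  show "fval (fM A a q p) = wa_M A a q p"
    unfolding fM_def fsum(2)[OF *] wa_M_def wa_entries_def
    by (simp add: comp_def fval_def case_prod_unfold)
qed

lemma fM_pos_iff: "wa_wf k A \<Longrightarrow> fst (fM A a q p) > 0 \<longleftrightarrow> wa_M A a q p > 0"
  using fval_pos_iff[OF fM(1), where 'a=rat] by (simp add: fM(2))

text \<open>The table merely proposes factorisations: an entry counts only if its product is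
  \<open>n\<close>, with \<open>[n]\<close> as fallback. The logarithm is thus right for every
  table, and prime entries matter for completeness alone.\<close>

definition factors :: "nat list list \<Rightarrow> nat \<Rightarrow> nat list" where
  "factors tbl n = nth_or [n] (filter (\<lambda>fs. prod_list fs = n) tbl) 0"

definition lnf :: "nat list list \<Rightarrow> frac \<Rightarrow> elem" where
  "lnf tbl f = (map (\<lambda>b. [b]) (factors tbl (fst f)), map (\<lambda>b. [b]) (factors tbl (snd f)))"

lemma nth_or_0_cases: "nth_or d l 0 = d \<and> l = [] \<or> nth_or d l 0 \<in> set l"
  by (cases l) (auto simp: nth_or_def)

lemma prod_list_factors: "prod_list (factors tbl n) = n"
  using nth_or_0_cases[of "[n]" "filter (\<lambda>fs. prod_list fs = n) tbl"] by (auto simp: factors_def)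

lemma pval_singletons: "prod_list l > 0 \<Longrightarrow> pval (map (\<lambda>b. [b]) l) = ln (real (prod_list l))"
  by (induction l) (auto simp: ln_mult)

lemma eval_lnf: "fst f > 0 \<Longrightarrow> snd f > 0 \<Longrightarrow> eval (lnf tbl f) = ln (fval f)"
  by (simp add: eval_def lnf_def pval_singletons prod_list_factors fval_def ln_div)

text \<open>The current state of each tracked path of \<open>B\<close> with its weight, followed by
  the potential.\<close>

type_synonym token = "(nat \<times> elem) list \<times> elem"
text \<open>A factor table, a precision for the approximation of logarithms, and a list of states of
  \<open>A\<close>, each with its tokens.\<close>

type_synonym bigO_cert = "nat list list \<times> nat \<times> (nat \<times> token list) list"

definition edge_gain :: "wa \<Rightarrow> wa \<Rightarrow> nat list list \<Rightarrow> nat \<Rightarrow> nat \<Rightarrow> nat \<Rightarrow> nat \<Rightarrow> nat \<Rightarrow> elem" where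
  "edge_gain A B tbl a q q' p p' = eadd (lnf tbl (fM A a q q')) (eneg (lnf tbl (fM B a p p')))"

text \<open>The weights stay fixed along a run, while the accumulated weighted gain plus the
  potential may not increase.\<close>

definition token_step :: "wa \<Rightarrow> wa \<Rightarrow> nat list list \<Rightarrow> nat \<Rightarrow> nat \<Rightarrow> nat \<Rightarrow> nat \<Rightarrow> token \<Rightarrow> token \<Rightarrow> bool" where
  "token_step A B tbl n a q q' z z' \<longleftrightarrow>
     map snd (fst z) = map snd (fst z') \<and>
     (\<forall>x\<in>set (zip (fst z) (fst z')). fst (snd x) < fst B \<and> fst (fM B a (fst (fst x)) (fst (snd x))) > 0) \<and>
     ele_check n (eadd (eadd (snd z') (eneg (snd z))) (esum (map
       (\<lambda>x. emul (snd (fst x)) (edge_gain A B tbl a q q' (fst (fst x)) (fst (snd x)))) (zip (fst z) (fst z')))))"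

text \<open>The run of \<open>A\<close> is followed forwards and each token is traced backwards.
  Since any token may turn out to be the useful one, all tokens of the first entry must sit at the
  initial state of \<open>B\<close>, whereas acceptance asks for a single token.\<close>

definition bigO_cert :: "nat \<Rightarrow> wa \<Rightarrow> wa \<Rightarrow> bigO_cert \<Rightarrow> bool" where
  "bigO_cert k A B C \<longleftrightarrow> (case C of (tbl, n, Xs) \<Rightarrow> n > 0 \<and>
     (\<exists>X\<in>set Xs. fst X = 0 \<and> (\<forall>z\<in>set (snd X). \<forall>x\<in>set (fst z). fst x = 0)) \<and>
     (\<forall>X\<in>set Xs. \<forall>a<k. \<forall>q'<fst A. fst (fM A a (fst X) q') > 0 \<longrightarrow>
        (\<exists>X'\<in>set Xs. fst X' = q' \<and> (\<forall>z'\<in>set (snd X'). \<exists>z\<in>set (snd X). token_step A B tbl n a (fst X) q' z z'))) \<and>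
     (\<forall>X\<in>set Xs. fst X \<in> set (snd (snd A)) \<longrightarrow>
        (\<exists>z\<in>set (snd X). fst z \<noteq> [] \<and>
           (\<forall>x\<in>set (fst z). fst x \<in> set (snd (snd B)) \<and> eneg_check n (eneg (snd x))))))"

lemma token_step_sound:
  assumes A: "wa_wf k A" and B: "wa_wf k B" and n: "n > 0" and q: "wa_M A a q q' > 0"
    and st: "token_step A B tbl n a q q' z z'"
  defines "m \<equiv> length (fst z')"
  shows "length (fst z) = m" "\<And>i. i < m \<Longrightarrow> snd (fst z ! i) = snd (fst z' ! i)"
    "\<And>i. i < m \<Longrightarrow> fst (fst z' ! i) < wa_nst B \<and> wa_M B a (fst (fst z ! i)) (fst (fst z' ! i)) > 0"
    "(\<Sum>i<m. eval (snd (fst z' ! i)) * (ln (of_rat (wa_M A a q q')) - ln (of_rat (wa_M B a (fst (fst z ! i)) (fst (fst z' ! i))))))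
       + eval (snd z') - eval (snd z) \<le> 0"
proof -
  have eq: "map snd (fst z) = map snd (fst z')" using st by (simp add: token_step_def)
  from arg_cong[OF this, of length] show len: "length (fst z) = m" by (simp add: m_def)
  show y: "snd (fst z ! i) = snd (fst z' ! i)" if "i < m" for i
    using arg_cong[OF eq, of "\<lambda>l. l ! i"] that len by (simp add: m_def)
  have zip: "(fst z ! i, fst z' ! i) \<in> set (zip (fst z) (fst z'))" if "i < m" for i
    using that len by (auto simp: set_zip m_def)
  show M: "fst (fst z' ! i) < wa_nst B \<and> wa_M B a (fst (fst z ! i)) (fst (fst z' ! i)) > 0" if "i < m" for i
    using st zip[OF that] by (auto simp: token_step_def fM_pos_iff[OF B] wa_nst_def)
  have fv: "fval f = (of_rat (fval f) :: real)" for f by (simp add: fval_def of_rat_divide)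
  have g: "eval (edge_gain A B tbl a q q' p p') = ln (of_rat (wa_M A a q q')) - ln (of_rat (wa_M B a p p'))"
    if "wa_M B a p p' > 0" for p p'
    using that q fM_pos_iff[OF A, of a q q'] fM_pos_iff[OF B, of a p p'] fM[OF A, of a q q'] fM[OF B, of a p p']
    by (simp add: edge_gain_def eval_lnf fv[of "fM _ _ _ _"])
  let ?e = "eadd (eadd (snd z') (eneg (snd z))) (esum (map
       (\<lambda>x. emul (snd (fst x)) (edge_gain A B tbl a q q' (fst (fst x)) (fst (snd x)))) (zip (fst z) (fst z'))))"
  have "eval ?e \<le> 0" using st n by (intro ele_check_sound) (auto simp: token_step_def)
  also have "eval ?e = eval (snd z') - eval (snd z) +
     (\<Sum>i<m. eval (snd (fst z ! i)) * eval (edge_gain A B tbl a q q' (fst (fst z ! i)) (fst (fst z' ! i))))"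
    using len by (simp add: comp_def sum_list_sum_nth m_def atLeast0LessThan)
  also have "\<dots> = eval (snd z') - eval (snd z) +
     (\<Sum>i<m. eval (snd (fst z' ! i)) * (ln (of_rat (wa_M A a q q')) - ln (of_rat (wa_M B a (fst (fst z ! i)) (fst (fst z' ! i))))))"
    using M y by (simp add: g)
  finally show "(\<Sum>i<m. eval (snd (fst z' ! i)) * (ln (of_rat (wa_M A a q q')) - ln (of_rat (wa_M B a (fst (fst z ! i)) (fst (fst z' ! i))))))
       + eval (snd z') - eval (snd z) \<le> 0" by simp
qed

text \<open>The invariant: every token present is backed by paths of \<open>B\<close> on the prefix
  read, with weighted log ratio plus potential still at most \<open>H\<close>, which bounds the
  potentials at the start. The paths depend on the token, as different tokens have different
  histories.\<close>

lemma bigO_cert_run: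
  assumes A: "wa_wf k A" and B: "wa_wf k B" and C: "bigO_cert k A B (tbl, n, Xs)"
    and H: "\<forall>X\<in>set Xs. \<forall>z\<in>set (snd X). eval (snd z) \<le> H"
    and w: "set w \<subseteq> {..<k}" "path A 0 w qs"
  shows "\<exists>X\<in>set Xs. fst X = last (0 # qs) \<and> (\<forall>z\<in>set (snd X). \<exists>\<rho>.
     (\<forall>i<length (fst z). path B 0 w (\<rho> i) \<and> last (0 # \<rho> i) = fst (fst z ! i)) \<and>
     (\<Sum>i<length (fst z). eval (snd (fst z ! i)) *
        (ln (of_rat (pweight A 0 w qs)) - ln (of_rat (pweight B 0 w (\<rho> i))))) + eval (snd z) \<le> H)"
  using w
proof (induction w arbitrary: qs rule: rev_induct)
  case Nil
  obtain X where X: "X \<in> set Xs" "fst X = 0" "\<forall>z\<in>set (snd X). \<forall>x\<in>set (fst z). fst x = 0"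
    using C by (auto simp: bigO_cert_def)
  show ?case
  proof (intro bexI[of _ X] conjI ballI exI[of _ "\<lambda>_. []"] allI impI)
    fix z i assume "z \<in> set (snd X)" "i < length (fst z)"
    then show "last [0] = fst (fst z ! i)" using X(3) by auto
  qed (use Nil X H in auto)
next
  case (snoc a w)
  from snoc.prems(2) obtain ps rs where qs: "qs = ps @ rs" "path A 0 w ps" "path A (last (0 # ps)) [a] rs"
    by (rule path_appendE)
  then obtain q' where rs: "rs = [q']" "q' < wa_nst A" "wa_M A a (last (0 # ps)) q' > 0"
    by (cases rs) auto
  let ?q = "last (0 # ps)"
  obtain X where X: "X \<in> set Xs" "fst X = ?q" "\<forall>z\<in>set (snd X). \<exists>\<rho>.
     (\<forall>i<length (fst z). path B 0 w (\<rho> i) \<and> last (0 # \<rho> i) = fst (fst z ! i)) \<and>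
     (\<Sum>i<length (fst z). eval (snd (fst z ! i)) *
        (ln (of_rat (pweight A 0 w ps)) - ln (of_rat (pweight B 0 w (\<rho> i))))) + eval (snd z) \<le> H"
    using snoc.IH[OF _ qs(2)] snoc.prems(1) by auto
  have "a < k" using snoc.prems(1) by simp
  then obtain X' where X': "X' \<in> set Xs" "fst X' = q'"
    "\<forall>z'\<in>set (snd X'). \<exists>z\<in>set (snd X). token_step A B tbl n a ?q q' z z'"
  proof -
    have "q' < fst A" "fst (fM A a (fst X) q') > 0"
      using rs(2,3) X(2) fM_pos_iff[OF A, of a ?q q'] by (simp_all add: wa_nst_def)
    then have "\<exists>X'\<in>set Xs. fst X' = q' \<and> (\<forall>z'\<in>set (snd X'). \<exists>z\<in>set (snd X). token_step A B tbl n a (fst X) q' z z')"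
      using C X(1) \<open>a < k\<close> unfolding bigO_cert_def prod.case by blast
    then show ?thesis unfolding X(2) using that by blast
  qed
  have n: "n > 0" using C by (simp add: bigO_cert_def)
  show ?case
  proof (intro bexI[of _ X'] conjI ballI)
    show "fst X' = last (0 # qs)" using X'(2) qs(1) rs(1) by simp
    show "X' \<in> set Xs" by fact
    fix z' assume "z' \<in> set (snd X')"
    then obtain z where z: "z \<in> set (snd X)" and st: "token_step A B tbl n a ?q q' z z'" using X'(3) by blast
    note t = token_step_sound[OF A B n rs(3) st]
    let ?m = "length (fst z')"
    obtain \<rho> where \<rho>': "\<forall>i<?m. path B 0 w (\<rho> i) \<and> last (0 # \<rho> i) = fst (fst z ! i)"
      and \<rho>_gain:
      "(\<Sum>i<?m. eval (snd (fst z ! i)) *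
        (ln (of_rat (pweight A 0 w ps)) - ln (of_rat (pweight B 0 w (\<rho> i))))) + eval (snd z) \<le> H"
      using X(3)[rule_format, OF z] unfolding t(1) by (elim exE conjE) (rule that)
    have \<rho>: "\<And>i. i < ?m \<Longrightarrow> path B 0 w (\<rho> i)" "\<And>i. i < ?m \<Longrightarrow> last (0 # \<rho> i) = fst (fst z ! i)"
      using \<rho>' by (simp_all del: last.simps)
    let ?\<rho> = "\<lambda>i. \<rho> i @ [fst (fst z' ! i)]"
    have lnA: "ln (of_rat (pweight A 0 (w @ [a]) qs) :: real) = ln (of_rat (pweight A 0 w ps)) + ln (of_rat (wa_M A a ?q q'))"
      using path_length[OF qs(2)] rs pweight_pos[OF qs(2)]
      by (simp add: qs(1) pweight_append of_rat_mult ln_mult)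
    have lnB: "ln (of_rat (pweight B 0 (w @ [a]) (?\<rho> i)) :: real) =
       ln (of_rat (pweight B 0 w (\<rho> i))) + ln (of_rat (wa_M B a (fst (fst z ! i)) (fst (fst z' ! i))))" if "i < ?m" for i
      using path_length[OF \<rho>(1)[OF that]] pweight_pos[OF \<rho>(1)[OF that]] t(3)[OF that] \<rho>(2)[OF that]
      by (simp add: pweight_append of_rat_mult ln_mult)
    show "\<exists>\<rho>. (\<forall>i<?m. path B 0 (w @ [a]) (\<rho> i) \<and> last (0 # \<rho> i) = fst (fst z' ! i)) \<and>
     (\<Sum>i<?m. eval (snd (fst z' ! i)) *
        (ln (of_rat (pweight A 0 (w @ [a]) qs)) - ln (of_rat (pweight B 0 (w @ [a]) (\<rho> i))))) + eval (snd z') \<le> H"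
    proof (intro exI[of _ ?\<rho>] conjI allI impI)
      fix i assume i: "i < ?m"
      show "path B 0 (w @ [a]) (?\<rho> i)"
        using path_length[OF \<rho>(1)[OF i]] \<rho>(1,2)[OF i] t(3)[OF i] by (simp add: path_append)
      show "last (0 # ?\<rho> i) = fst (fst z' ! i)" by simp
    next
      have "(\<Sum>i<?m. eval (snd (fst z' ! i)) *
          (ln (of_rat (pweight A 0 (w @ [a]) qs)) - ln (of_rat (pweight B 0 (w @ [a]) (?\<rho> i))))) =
        (\<Sum>i<?m. eval (snd (fst z ! i)) * (ln (of_rat (pweight A 0 w ps)) - ln (of_rat (pweight B 0 w (\<rho> i))))) +
        (\<Sum>i<?m. eval (snd (fst z' ! i)) * (ln (of_rat (wa_M A a ?q q')) - ln (of_rat (wa_M B a (fst (fst z ! i)) (fst (fst z' ! i))))))"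
        unfolding sum.distrib[symmetric]
        by (rule sum.cong) (simp_all add: lnA lnB t(2) algebra_simps)
      then show "(\<Sum>i<?m. eval (snd (fst z' ! i)) *
          (ln (of_rat (pweight A 0 (w @ [a]) qs)) - ln (of_rat (pweight B 0 (w @ [a]) (?\<rho> i))))) + eval (snd z') \<le> H"
        using \<rho>_gain t(4) by linarith
    qed
  qed
qed

text \<open>At acceptance the weighted log ratios add up to at most \<open>2 * H\<close>. As
  \<open>H \<ge> 0\<close>, one summand is at most \<open>2 * H\<close>, and division by its
  positive weight bounds the path of \<open>A\<close> by a constant times one path of
  \<open>B\<close>. Finite ambiguity of \<open>A\<close> passes from single paths to their
  sum.\<close>

lemma bigO_cert_sound:
  assumes A: "wa_wf k A" and B: "wa_wf k B" and fa: "finitely_ambiguous k A" and C: "bigO_cert k A B C"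
  shows "big_O k A B"
proof -
  obtain tbl n Xs where Ceq: "C = (tbl, n, Xs)" by (cases C)
  note C = C[unfolded Ceq]
  have n: "n > 0" using C by (simp add: bigO_cert_def)
  define Z where "Z = (\<Union>X\<in>set Xs. set (snd X))"
  have finZ: "finite Z" by (simp add: Z_def)
  define H where "H = (\<Sum>z\<in>Z. \<bar>eval (snd z)\<bar>)"
  have H: "\<bar>eval (snd z)\<bar> \<le> H" if "z \<in> Z" for z
    unfolding H_def by (rule member_le_sum) (use that finZ in auto)
  have H0: "H \<ge> 0" unfolding H_def by (simp add: sum_nonneg)
  define Y where "Y = (\<Union>z\<in>Z. (eval \<circ> snd) ` set (fst z))"
  \<comment> \<open>A sum of absolute values as crude bound for all \<open>2 * H / y\<close>; it
    makes sense whatever the signs of the weights in the certificate.\<close>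
  define K where "K = (\<Sum>y\<in>Y. \<bar>2 * H / y\<bar>)"
  have K: "2 * H / y \<le> K" if "y \<in> Y" for y
  proof -
    have "\<bar>2 * H / y\<bar> \<le> K" unfolding K_def by (rule member_le_sum) (use that finZ in \<open>auto simp: Y_def\<close>)
    then show ?thesis by linarith
  qed
  obtain c where c: "\<And>w. set w \<subseteq> {..<k} \<Longrightarrow> card (wa_acc_paths A w) \<le> c"
    using fa by (auto simp: finitely_ambiguous_def)
  have main: "of_rat (pweight A 0 w qs) \<le> exp K * wa_fun B w"
    if w: "set w \<subseteq> {..<k}" and qs: "qs \<in> wa_acc_paths A w" for w qs
  proof -
    have p: "path A 0 w qs" "last (0 # qs) \<in> wa_final A" using qs by (auto simp: wa_acc_paths_eq)
    have "\<forall>X\<in>set Xs. \<forall>z\<in>set (snd X). eval (snd z) \<le> H"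
    proof (intro ballI)
      fix X z assume "X \<in> set Xs" "z \<in> set (snd X)"
      then have "z \<in> Z" by (auto simp: Z_def)
      then show "eval (snd z) \<le> H" using H[of z] by simp
    qed
    note run = bigO_cert_run[OF A B C this w p(1)]
    obtain X where X: "X \<in> set Xs" "fst X = last (0 # qs)"
      "\<forall>z\<in>set (snd X). \<exists>\<rho>.
       (\<forall>i<length (fst z). path B 0 w (\<rho> i) \<and> last (0 # \<rho> i) = fst (fst z ! i)) \<and>
       (\<Sum>i<length (fst z). eval (snd (fst z ! i)) *
          (ln (of_rat (pweight A 0 w qs)) - ln (of_rat (pweight B 0 w (\<rho> i))))) + eval (snd z) \<le> H"
      using run by (elim bexE conjE) (rule that)
    obtain z where z: "z \<in> set (snd X)" "fst z \<noteq> []"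
       "\<And>x. x \<in> set (fst z) \<Longrightarrow> fst x \<in> wa_final B \<and> eneg_check n (eneg (snd x))"
    proof -
      have "fst X \<in> set (snd (snd A))" using X(2) p(2) by (simp only: wa_final_def)
      then have "\<exists>z\<in>set (snd X). fst z \<noteq> [] \<and>
           (\<forall>x\<in>set (fst z). fst x \<in> set (snd (snd B)) \<and> eneg_check n (eneg (snd x)))"
        using C X(1) unfolding bigO_cert_def prod.case by blast
      then show ?thesis using that unfolding wa_final_def by blast
    qed
    let ?m = "length (fst z)"
    obtain \<rho> where \<rho>': "\<forall>i<?m. path B 0 w (\<rho> i) \<and> last (0 # \<rho> i) = fst (fst z ! i)"
      and \<rho>_gain:
      "(\<Sum>i<?m. eval (snd (fst z ! i)) *
        (ln (of_rat (pweight A 0 w qs)) - ln (of_rat (pweight B 0 w (\<rho> i))))) + eval (snd z) \<le> H"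
      using X(3)[rule_format, OF z(1)] by (elim exE conjE) (rule that)
    have \<rho>: "\<And>i. i < ?m \<Longrightarrow> path B 0 w (\<rho> i)" "\<And>i. i < ?m \<Longrightarrow> last (0 # \<rho> i) = fst (fst z ! i)"
      using \<rho>' by (simp_all del: last.simps)
    have zZ: "z \<in> Z" using X(1) z(1) by (auto simp: Z_def)
    define g where "g i = eval (snd (fst z ! i)) * (ln (of_rat (pweight A 0 w qs)) - ln (of_rat (pweight B 0 w (\<rho> i))))" for i
    have g: "(\<Sum>i<?m. g i) \<le> 2 * H" using \<rho>_gain H[OF zZ] by (simp add: g_def)
    have "\<exists>i<?m. g i \<le> 2 * H"
    proof (rule ccontr)
      assume "\<not> ?thesis"
      then have *: "\<forall>i\<in>{..<?m}. 2 * H < g i" by auto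
      have "g 0 > 2 * H" using * z(2) by auto
      moreover have "g 0 \<le> (\<Sum>i<?m. g i)"
      proof (rule member_le_sum)
        fix i assume "i \<in> {..<?m} - {0}"
        then have "2 * H < g i" using * by blast
        then show "0 \<le> g i" using H0 by linarith
      qed (use z(2) in auto)
      ultimately show False using g by simp
    qed
    then obtain i where i: "i < ?m" "g i \<le> 2 * H" by blast
    let ?y = "eval (snd (fst z ! i))"
    have y: "?y > 0" using eneg_check_sound[OF _ n, of "eneg (snd (fst z ! i))"] z(3)[of "fst z ! i"] i(1) by simp
    have "ln (of_rat (pweight A 0 w qs)) - ln (of_rat (pweight B 0 w (\<rho> i))) \<le> 2 * H / ?y"
      using i(2) y by (simp add: g_def field_simps)
    also have "\<dots> \<le> K" by (rule K) (use zZ i(1) in \<open>force simp: Y_def\<close>)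
    finally have "ln (of_rat (pweight A 0 w qs)) \<le> K + ln (of_rat (pweight B 0 w (\<rho> i)))" by simp
    then have "of_rat (pweight A 0 w qs) \<le> exp K * of_rat (pweight B 0 w (\<rho> i))"
      using pweight_pos[OF p(1)] pweight_pos[OF \<rho>(1)[OF i(1)]]
      by (metis exp_add exp_le_cancel_iff exp_ln zero_less_of_rat_iff)
    also have "\<dots> \<le> exp K * wa_fun B w"
      using \<rho>(1,2)[OF i(1)] z(3)[of "fst z ! i"] i(1)
      by (intro mult_left_mono acc_path_pweight_le) (auto simp: wa_acc_paths_eq)
    finally show ?thesis .
  qed
  show ?thesis unfolding big_O_def
  \<comment> \<open>\<open>c + 1\<close> in place of \<open>c\<close> makes the constant positive
    even if \<open>c = 0\<close>.\<close>
  proof (intro exI[of _ "(real c + 1) * exp K"] conjI allI impI)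
    fix w assume w: "set w \<subseteq> {..<k}"
    have nn: "wa_fun B w \<ge> 0" unfolding wa_fun_def by (simp add: sum_nonneg wa_mat_nonneg)
    have "wa_fun A w = (\<Sum>qs\<in>wa_acc_paths A w. of_rat (pweight A 0 w qs))"
      by (simp add: wa_fun_paths of_rat_sum)
    also have "\<dots> \<le> of_nat (card (wa_acc_paths A w)) * (exp K * wa_fun B w)"
      by (rule sum_bounded_above) (use main w in auto)
    also have "\<dots> \<le> (real c + 1) * (exp K * wa_fun B w)"
      using c[OF w] nn by (intro mult_right_mono) auto
    finally show "wa_fun A w \<le> (real c + 1) * exp K * wa_fun B w" by (simp add: mult.assoc)
  qed (simp add: add_nonneg_pos)
qed

section \<open>Certificates against big-O\<close>

text \<open>Only one column of the product matrix is maintained; processing the word from its last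
  letter multiplies the column by a matrix from the left.\<close>

definition fcol_step :: "wa \<Rightarrow> frac list \<Rightarrow> nat \<Rightarrow> frac list" where
  "fcol_step A col a = map (\<lambda>q. fsum (map (\<lambda>p. fmul (fM A a q p) (nth_or (0, 1) col p)) [0..<fst A])) [0..<fst A]"

definition fmat :: "wa \<Rightarrow> nat list \<Rightarrow> nat \<Rightarrow> nat \<Rightarrow> frac" where
  "fmat A w q t = nth_or (0, 1) (foldl (fcol_step A) (map (\<lambda>q. if q = t then (1, 1) else (0, 1)) [0..<fst A]) (rev w)) q"

lemma fmat:
  assumes A: "wa_wf k A" and q: "q < wa_nst A"
  shows "snd (fmat A w q t) > 0" "fval (fmat A w q t) = wa_mat A w q t"
proof -
  define col where "col w = foldl (fcol_step A) (map (\<lambda>q. if q = t then (1, 1) else (0, 1)) [0..<fst A]) (rev w)" for w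
  have "length (col w) = wa_nst A \<and> (\<forall>q<wa_nst A. snd (col w ! q) > 0 \<and> (fval (col w ! q) :: rat) = wa_mat A w q t)"
  proof (induction w)
    case Nil
    then show ?case by (simp add: col_def wa_nst_def fval_def)
  next
    case (Cons a w)
    have eq: "col (a # w) = fcol_step A (col w) a" by (simp add: col_def)
    have *: "\<forall>f\<in>set (map (\<lambda>p. fmul (fM A a q p) (nth_or (0, 1) (col w) p)) [0..<fst A]). snd f > 0" for q
      using Cons fM(1)[OF A] by (auto simp: fmul_def wa_nst_def)
    have "fval (fsum (map (\<lambda>p. fmul (fM A a q p) (nth_or (0, 1) (col w) p)) [0..<fst A])) = wa_mat A (a # w) q t" for q
      unfolding fsum(2)[OF *] using Cons fM(2)[OF A]
      by (simp add: wa_nst_def comp_def fval_fmul interv_sum_list_conv_sum_set_nat atLeast0LessThan)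
    then show ?case
      using fsum(1)[OF *] by (auto simp: eq fcol_step_def wa_nst_def)
  qed
  then show "snd (fmat A w q t) > 0" "fval (fmat A w q t) = wa_mat A w q t"
    using q by (simp_all add: fmat_def flip: col_def)
qed

lemma fmat_pos_iff: "wa_wf k A \<Longrightarrow> q < wa_nst A \<Longrightarrow> fst (fmat A w q t) > 0 \<longleftrightarrow> wa_mat A w q t > 0"
  using fval_pos_iff[OF fmat(1), where 'a=rat] by (simp add: fmat(2))

text \<open>An item \<open>(r, v, a, T)\<close> consists of a state of \<open>A\<close>, a loop word at it, the letter read after the
  loop and a table of potentials for the reachable states of \<open>B\<close>; a state of potential \<open>0\<close> cannot
  reach acceptance.\<close>
type_synonym item = "nat \<times> nat list \<times> nat \<times> (nat \<times> frac) list"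

abbreviation (input) "item_state it \<equiv> fst it"
abbreviation (input) "item_loop it \<equiv> fst (snd it)"
abbreviation (input) "item_letter it \<equiv> fst (snd (snd it))"
abbreviation (input) "item_table it \<equiv> snd (snd (snd it))"

text \<open>The loop of the first item is left out, because a potential speaks about a state after
  the loop of its own item; the induction over items then fits.\<close>

fun pumped_tail :: "nat \<Rightarrow> item list \<Rightarrow> nat list" where
  "pumped_tail n (it # it' # its) =
     item_letter it # concat (replicate n (item_loop it')) @ pumped_tail n (it' # its)"
| "pumped_tail n its = []"

definition pumped :: "nat \<Rightarrow> item list \<Rightarrow> nat list" where
  "pumped n its = concat (replicate n (item_loop (hd its))) @ pumped_tail n its"

lemma snd_fmul: "snd (fmul p q) = snd p * snd q"
  by (simp add: fmul_def)

definition loop_frac :: "wa \<Rightarrow> item \<Rightarrow> nat \<Rightarrow> frac" where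
  "loop_frac A it q = fmat A (item_loop it) q q"

text \<open>The table is closed under the loop, and the loop may lead to a different state only if
  that state has potential 0. On the states that count, powers of the loop matrix are hence powers
  of its diagonal entries.\<close>

definition item_ok :: "nat \<Rightarrow> wa \<Rightarrow> wa \<Rightarrow> item \<Rightarrow> bool" where
  "item_ok k A B it \<longleftrightarrow> item_state it < fst A \<and> (\<forall>c\<in>set (item_loop it). c < k) \<and>
     fst (loop_frac A it (item_state it)) > 0 \<and>
     (\<forall>x\<in>set (item_table it). fst x < fst B \<and> snd (snd x) > 0 \<and>
        (\<forall>s<fst B. fst (fmat B (item_loop it) (fst x) s) > 0 \<longrightarrow>
           (\<exists>y\<in>set (item_table it). fst y = s) \<and>
           (s \<noteq> fst x \<longrightarrow> (\<forall>y\<in>set (item_table it). fst y = s \<longrightarrow> fst (snd y) = 0))))"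

text \<open>Potentials bound, over all accepted continuations, the product of the ratios of
  \<open>B\<close>-loop to \<open>A\<close>-loop weight at the later items. This is the recursion
  for such a bound with the division cleared; \<open>last_ok\<close> starts it with 1.\<close>

definition link_ok :: "nat \<Rightarrow> wa \<Rightarrow> wa \<Rightarrow> item \<Rightarrow> item \<Rightarrow> bool" where
  "link_ok k A B it it' \<longleftrightarrow> item_letter it < k \<and>
     fst (fM A (item_letter it) (item_state it) (item_state it')) > 0 \<and>
     (\<forall>x\<in>set (item_table it). \<forall>s<fst B. fst (fM B (item_letter it) (fst x) s) > 0 \<longrightarrow>
        (\<exists>y\<in>set (item_table it'). fst y = s \<and>
           \<not> fless (fmul (snd x) (loop_frac A it' (item_state it'))) (fmul (loop_frac B it' s) (snd y))))"

definition last_ok :: "wa \<Rightarrow> wa \<Rightarrow> item \<Rightarrow> bool" where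
  "last_ok A B it \<longleftrightarrow> item_state it \<in> set (snd (snd A)) \<and>
     (\<forall>x\<in>set (item_table it). fst x \<in> set (snd (snd B)) \<longrightarrow> \<not> fless (snd x) (1, 1))"

text \<open>Including the first loop, the total ratio of \<open>B\<close> to \<open>A\<close> per
  round of pumping is below 1.\<close>

definition first_ok :: "wa \<Rightarrow> wa \<Rightarrow> item \<Rightarrow> bool" where
  "first_ok A B it \<longleftrightarrow> item_state it = 0 \<and>
     (\<exists>x\<in>set (item_table it). fst x = 0 \<and> fless (fmul (loop_frac B it 0) (snd x)) (loop_frac A it 0))"

definition pump_cert :: "nat \<Rightarrow> wa \<Rightarrow> wa \<Rightarrow> item list \<Rightarrow> bool" where
  "pump_cert k A B its \<longleftrightarrow> its \<noteq> [] \<and> (\<forall>it\<in>set its. item_ok k A B it) \<and>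
     (\<forall>p\<in>set (zip its (tl its)). link_ok k A B (fst p) (snd p)) \<and>
     first_ok A B (nth_or (0, [], 0, []) its 0) \<and> last_ok A B (nth_or (0, [], 0, []) (rev its) 0)"

definition value_from :: "wa \<Rightarrow> nat list \<Rightarrow> nat \<Rightarrow> rat" where
  "value_from B w s = (\<Sum>t\<in>wa_final B. wa_mat B w s t)"

lemma value_from_nonneg: "value_from B w s \<ge> 0"
  unfolding value_from_def by (intro sum_nonneg wa_mat_nonneg)

lemma value_from_append:
  "s < wa_nst B \<Longrightarrow> value_from B (u @ v) s = (\<Sum>p<wa_nst B. wa_mat B u s p * value_from B v p)"
  unfolding value_from_def by (simp add: wa_mat_append sum_distrib_left) (rule sum.swap)

lemma value_from_Cons: "value_from B (a # v) s = (\<Sum>p<wa_nst B. wa_M B a s p * value_from B v p)"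
  unfolding value_from_def by (simp add: sum_distrib_left) (rule sum.swap)

lemma wa_mat_mult_le:
  assumes "q < wa_nst A" "p < wa_nst A"
  shows "wa_mat A u q p * wa_mat A v p t \<le> wa_mat A (u @ v) q t"
  unfolding wa_mat_append[OF assms(1)]
  by (rule member_le_sum[where i=p]) (use assms in \<open>auto simp: wa_mat_nonneg\<close>)

lemma wa_mat_loop_power_le:
  "q < wa_nst A \<Longrightarrow> wa_mat A v q q ^ n \<le> wa_mat A (concat (replicate n v)) q q"
proof (induction n)
  case (Suc n)
  then have "wa_mat A v q q * wa_mat A v q q ^ n \<le> wa_mat A v q q * wa_mat A (concat (replicate n v)) q q"
    by (intro mult_left_mono) (auto simp: wa_mat_nonneg)
  also have "\<dots> \<le> wa_mat A (concat (replicate (Suc n) v)) q q"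
    using wa_mat_mult_le Suc.prems by simp
  finally show ?case by simp
qed simp

text \<open>States reachable from a table entry through the loop carry an entry; entering a state other
  than itself is only possible for states of potential \<open>0\<close>, which contribute nothing.\<close>
lemma loop_value_bound:
  fixes T :: "(nat \<times> rat) list"
  assumes keys: "\<And>s x. (s, x) \<in> set T \<Longrightarrow> s < wa_nst B"
    and closed: "\<And>s x s'. (s, x) \<in> set T \<Longrightarrow> s' < wa_nst B \<Longrightarrow> wa_mat B v s s' > 0 \<Longrightarrow> \<exists>x'. (s', x') \<in> set T"
    and diag: "\<And>s x s' x'. (s, x) \<in> set T \<Longrightarrow> (s', x') \<in> set T \<Longrightarrow> s' \<noteq> s \<Longrightarrow> wa_mat B v s s' > 0 \<Longrightarrow> x' = 0"
    and n: "n > 0" and R: "\<And>s x. (s, x) \<in> set T \<Longrightarrow> value_from B u s \<le> C * (x * P) ^ n"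
    and s: "(s, x) \<in> set T"
  shows "value_from B (concat (replicate n v) @ u) s \<le> C * (wa_mat B v s s * x * P) ^ n"
proof -
  have reach: "\<exists>x'. (p, x') \<in> set T" if "(s, x) \<in> set T" "p < wa_nst B" "wa_mat B (concat (replicate j v)) s p > 0" for s x p j
    using that
  proof (induction j arbitrary: s x)
    case (Suc j)
    then have sB: "s < wa_nst B" using keys by blast
    have "(\<Sum>t<wa_nst B. wa_mat B v s t * wa_mat B (concat (replicate j v)) t p) > 0"
      using Suc.prems(3) by (simp add: wa_mat_append[OF sB])
    then obtain t where t: "t < wa_nst B" "wa_mat B v s t * wa_mat B (concat (replicate j v)) t p > 0"
      by (meson lessThan_iff not_le sum_nonpos)
    then have "wa_mat B v s t > 0" "wa_mat B (concat (replicate j v)) t p > 0"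
      using wa_mat_nonneg[of B v s t] wa_mat_nonneg[of B "concat (replicate j v)" t p]
      by (auto simp: zero_less_mult_iff)
    then show ?case using Suc closed[OF Suc.prems(1) t(1)] by blast
  qed (auto split: if_splits)
  \<comment> \<open>For a target \<open>p\<close> from which \<open>u\<close> can be completed the
    loop power is diagonal, since entering \<open>p\<close> from another state would require
    potential 0.\<close>
  have diag': "wa_mat B (concat (replicate j v)) s p = (if s = p then wa_mat B v p p ^ j else 0)"
    if p: "p < wa_nst B" "value_from B u p > 0" "(p, y) \<in> set T" and s: "(s, x) \<in> set T" for s x p y j
    using s
  proof (induction j arbitrary: s x)
    case (Suc j)
    then have sB: "s < wa_nst B" using keys by blast
    \<comment> \<open>Potential 0 would make the bound in \<open>R\<close> vanish, because
      \<open>0 ^ n = 0\<close> for \<open>n > 0\<close>.\<close>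
    have y: "y \<noteq> 0" using R[OF p(3)] p(2) n by (auto simp: power_0_left)
    have "wa_mat B (concat (replicate (Suc j) v)) s p = (\<Sum>t<wa_nst B. wa_mat B v s t * wa_mat B (concat (replicate j v)) t p)"
      by (simp add: wa_mat_append[OF sB])
    also have "\<dots> = (\<Sum>t<wa_nst B. if t = p then wa_mat B v s p * wa_mat B v p p ^ j else 0)"
    proof (rule sum.cong)
      fix t assume "t \<in> {..<wa_nst B}"
      then have t: "t < wa_nst B" by simp
      show "wa_mat B v s t * wa_mat B (concat (replicate j v)) t p = (if t = p then wa_mat B v s p * wa_mat B v p p ^ j else 0)"
      proof (cases "wa_mat B v s t = 0")
        case False
        then have "wa_mat B v s t > 0" using wa_mat_nonneg[of B v s t] by linarith
        then obtain x' where "(t, x') \<in> set T" using closed[OF Suc.prems t] by blast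
        from Suc.IH[OF this] show ?thesis by simp
      qed auto
    qed simp
    also have "\<dots> = wa_mat B v s p * wa_mat B v p p ^ j" using p(1) by simp
    also have "\<dots> = (if s = p then wa_mat B v p p ^ Suc j else 0)"
    proof (cases "s = p")
      case False
      then have "\<not> wa_mat B v s p > 0" using diag[OF Suc.prems p(3)] y by blast
      then show ?thesis using False wa_mat_nonneg[of B v s p] by simp
    qed simp
    finally show ?case .
  qed auto
  have sB: "s < wa_nst B" using keys s by blast
  have "value_from B (concat (replicate n v) @ u) s = (\<Sum>p<wa_nst B. wa_mat B (concat (replicate n v)) s p * value_from B u p)"
    by (rule value_from_append[OF sB])
  also have "\<dots> = (\<Sum>p<wa_nst B. if p = s then wa_mat B v s s ^ n * value_from B u s else 0)"
  proof (rule sum.cong)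
    fix p assume "p \<in> {..<wa_nst B}"
    then have p: "p < wa_nst B" by simp
    show "wa_mat B (concat (replicate n v)) s p * value_from B u p = (if p = s then wa_mat B v s s ^ n * value_from B u s else 0)"
    proof (cases "value_from B u p = 0 \<or> wa_mat B (concat (replicate n v)) s p = 0")
      case True
      show ?thesis
      proof (cases "p = s \<and> value_from B u s \<noteq> 0")
        case a: True
        then have "value_from B u s > 0" using value_from_nonneg[of B u s] by linarith
        from diag'[OF sB this s s, of n] show ?thesis using a by simp
      qed (use True in auto)
    next
      case False
      then have v: "value_from B u p > 0" and m: "wa_mat B (concat (replicate n v)) s p > 0"
        using value_from_nonneg[of B u p] wa_mat_nonneg[of B "concat (replicate n v)" s p] by auto
      obtain y where "(p, y) \<in> set T" using reach[OF s p m] by blast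
      from diag'[OF p v this s, of n] show ?thesis by simp
    qed
  qed simp
  also have "\<dots> = wa_mat B v s s ^ n * value_from B u s" using sB by simp
  also have "\<dots> \<le> wa_mat B v s s ^ n * (C * (x * P) ^ n)"
    by (intro mult_left_mono R[OF s]) (simp add: wa_mat_nonneg)
  finally show ?thesis by (simp add: power_mult_distrib mult_ac)
qed

definition fval_table :: "item \<Rightarrow> (nat \<times> rat) list" where
  "fval_table it = map (\<lambda>x. (fst x, fval (snd x))) (item_table it)"

lemma item_loop_value_bound:
  assumes B: "wa_wf k B" and it: "item_ok k A B it" and n: "n > 0"
    and R: "\<And>x. x \<in> set (item_table it) \<Longrightarrow> value_from B u (fst x) \<le> C * (fval (snd x) * P) ^ n"
    and x: "x \<in> set (item_table it)"
  shows "value_from B (concat (replicate n (item_loop it)) @ u) (fst x)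
     \<le> C * (wa_mat B (item_loop it) (fst x) (fst x) * fval (snd x) * P) ^ n"
proof (rule loop_value_bound[where T="fval_table it", OF _ _ _ n])
  have tab: "(s, y) \<in> set (fval_table it) \<longleftrightarrow> (\<exists>x\<in>set (item_table it). fst x = s \<and> y = fval (snd x))" for s y
    by (auto simp: fval_table_def)
  have nst: "wa_nst B = fst B" by (simp add: wa_nst_def)
  have ok: "fst x < wa_nst B"
     "\<And>s. s < wa_nst B \<Longrightarrow> wa_mat B (item_loop it) (fst x) s > 0 \<Longrightarrow> \<exists>y\<in>set (item_table it). fst y = s"
     "\<And>s y. s < wa_nst B \<Longrightarrow> wa_mat B (item_loop it) (fst x) s > 0 \<Longrightarrow> s \<noteq> fst x \<Longrightarrow> y \<in> set (item_table it) \<Longrightarrow> fst y = s \<Longrightarrow> fst (snd y) = 0"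
    if "x \<in> set (item_table it)" for x
  proof -
    show *: "fst x < wa_nst B" using it that by (auto simp: item_ok_def nst)
    note pos = fmat_pos_iff[OF B *, symmetric]
    show "\<And>s. s < wa_nst B \<Longrightarrow> wa_mat B (item_loop it) (fst x) s > 0 \<Longrightarrow> \<exists>y\<in>set (item_table it). fst y = s"
     "\<And>s y. s < wa_nst B \<Longrightarrow> wa_mat B (item_loop it) (fst x) s > 0 \<Longrightarrow> s \<noteq> fst x \<Longrightarrow> y \<in> set (item_table it) \<Longrightarrow> fst y = s \<Longrightarrow> fst (snd y) = 0"
      using it that unfolding item_ok_def nst pos by blast+
  qed
  show "s < wa_nst B" if "(s, y) \<in> set (fval_table it)" for s y
    using that ok(1) unfolding tab by blast
  show "\<exists>x'. (s', x') \<in> set (fval_table it)"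
    if "(s, y) \<in> set (fval_table it)" "s' < wa_nst B" "wa_mat B (item_loop it) s s' > 0" for s y s'
    using that ok(2) unfolding tab by blast
  show "x' = 0" if st: "(s, y) \<in> set (fval_table it)" "(s', x') \<in> set (fval_table it)" "s' \<noteq> s"
    "wa_mat B (item_loop it) s s' > 0" for s y s' x'
  proof -
    obtain z where z: "z \<in> set (item_table it)" "fst z = s'" "x' = fval (snd z)" using st(2) unfolding tab by blast
    obtain z' where z': "z' \<in> set (item_table it)" "fst z' = s" using st(1) unfolding tab by blast
    have "fst (snd z) = 0" using ok(3)[OF z'(1) _ _ _ z(1,2)] ok(1)[OF z(1)] z z' st by auto
    then show ?thesis by (simp add: z(3) fval_def)
  qed
  show "value_from B u s \<le> C * (y * P) ^ n" if "(s, y) \<in> set (fval_table it)" for s y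
    using that R unfolding tab by blast
  show "(fst x, fval (snd x)) \<in> set (fval_table it)" using x unfolding tab by blast
qed

definition loop_gain :: "wa \<Rightarrow> item \<Rightarrow> rat" where
  "loop_gain A it = wa_mat A (item_loop it) (item_state it) (item_state it)"

text \<open>Induction from the last item. A letter costs a factor independent of \<open>n\<close>, a
  loop contributes an \<open>n\<close>-th power. For \<open>A\<close> it suffices to keep the
  diagonal entry of each loop, which gives \<open>P\<close>; for \<open>B\<close> the potential
  converts loop weights of \<open>B\<close> into those of \<open>A\<close>.\<close>

lemma pumped_tail_bounds:
  assumes A: "wa_wf k A" and B: "wa_wf k B"
    and "its \<noteq> []" "\<And>it. it \<in> set its \<Longrightarrow> item_ok k A B it"
    and "\<And>p. p \<in> set (zip its (tl its)) \<Longrightarrow> link_ok k A B (fst p) (snd p)"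
    and "last_ok A B (last its)"
  defines "P \<equiv> prod_list (map (loop_gain A) (tl its))"
  shows "\<exists>C\<ge>0. \<forall>n>0. \<forall>x\<in>set (item_table (hd its)). value_from B (pumped_tail n its) (fst x) \<le> C * (fval (snd x) * P) ^ n"
    and "\<exists>c>0. \<forall>n. c * P ^ n \<le> value_from A (pumped_tail n its) (item_state (hd its))"
    and "set (pumped_tail n its) \<subseteq> {..<k}" and "P > 0"
proof -
  have "(\<exists>C\<ge>0. \<forall>n>0. \<forall>x\<in>set (item_table (hd its)). value_from B (pumped_tail n its) (fst x) \<le> C * (fval (snd x) * P) ^ n)
    \<and> (\<exists>c>0. \<forall>n. c * P ^ n \<le> value_from A (pumped_tail n its) (item_state (hd its)))
    \<and> (\<forall>n. set (pumped_tail n its) \<subseteq> {..<k}) \<and> P > 0"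
    using assms(3-6) unfolding P_def
  proof (induction its rule: induct_list012)
    case 1
    then show ?case by simp
  next
    case (2 it)
    have "value_from B [] (fst x) \<le> 1 * (fval (snd x) * 1) ^ n" if "x \<in> set (item_table it)" for x n
    proof -
      have v: "value_from B [] (fst x) = (if fst x \<in> wa_final B then 1 else 0)"
        by (simp add: value_from_def wa_final_def)
      have "snd (snd x) > 0" using 2(2) that by (auto simp: item_ok_def)
      then have "fst x \<in> wa_final B \<Longrightarrow> 1 \<le> (fval (snd x) :: rat)"
        using 2(4) that fless_iff[of "snd x" "(1, 1)", where 'a=rat]
        by (auto simp: last_ok_def wa_final_def fval_def[of "(_, _)"])
      then show ?thesis unfolding v by simp
    qed
    moreover have "value_from A [] (item_state it) = 1"
      using 2(4) by (auto simp: value_from_def wa_final_def last_ok_def)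
    ultimately show ?case
      by (intro conjI exI[of _ 1] allI impI ballI) (simp_all)
  next
    case (3 it it' its)
    let ?its = "it' # its"
    let ?P = "prod_list (map (loop_gain A) its)"
    have nst: "wa_nst B = fst B" "wa_nst A = fst A" by (simp_all add: wa_nst_def)
    have ok: "item_ok k A B it" "item_ok k A B it'" using 3(4) by simp_all
    have link: "link_ok k A B it it'" using 3(5)[of "(it, it')"] by simp
    have IH: "(\<exists>C\<ge>0. \<forall>n>0. \<forall>x\<in>set (item_table it'). value_from B (pumped_tail n ?its) (fst x) \<le> C * (fval (snd x) * ?P) ^ n)
      \<and> (\<exists>c>0. \<forall>n. c * ?P ^ n \<le> value_from A (pumped_tail n ?its) (item_state it'))
      \<and> (\<forall>n. set (pumped_tail n ?its) \<subseteq> {..<k}) \<and> ?P > 0"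
      using 3(2) 3(4-6) by simp
    then obtain C c where C: "C \<ge> 0" "\<And>n x. n > 0 \<Longrightarrow> x \<in> set (item_table it') \<Longrightarrow> value_from B (pumped_tail n ?its) (fst x) \<le> C * (fval (snd x) * ?P) ^ n"
      and c: "c > 0" "\<And>n. c * ?P ^ n \<le> value_from A (pumped_tail n ?its) (item_state it')"
      and letters: "\<And>n. set (pumped_tail n ?its) \<subseteq> {..<k}" and P: "?P > 0" by auto
    have r': "item_state it' < wa_nst A" using ok(2) by (simp add: item_ok_def nst)
    have al: "loop_gain A it' > 0"
      using ok(2) fmat_pos_iff[OF A r', of "item_loop it'" "item_state it'"]
      by (simp add: item_ok_def loop_gain_def loop_frac_def)
    \<comment> \<open>The total weight of the letter over all pairs of states, so that one constant
      serves all entries \<open>x\<close>.\<close>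
    let ?D = "C * (\<Sum>s<wa_nst B. \<Sum>t<wa_nst B. wa_M B (item_letter it) s t)"
    have "value_from B (pumped_tail n (it # ?its)) (fst x) \<le> ?D * (fval (snd x) * (loop_gain A it' * ?P)) ^ n"
      if n: "n > 0" and x: "x \<in> set (item_table it)" for n x
    proof -
      let ?X = "C * (fval (snd x) * (loop_gain A it' * ?P)) ^ n"
      have X: "?X \<ge> 0" using C(1) al P by (simp add: zero_le_mult_iff)
      have xB: "fst x < wa_nst B" and xp: "snd (snd x) > 0" using ok(1) x by (auto simp: item_ok_def nst)
      have "wa_M B (item_letter it) (fst x) s * value_from B (concat (replicate n (item_loop it')) @ pumped_tail n ?its) s
          \<le> wa_M B (item_letter it) (fst x) s * ?X" if s: "s < wa_nst B" for s
      proof (cases "wa_M B (item_letter it) (fst x) s > 0")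
        case True
        then have "fst (fM B (item_letter it) (fst x) s) > 0" by (simp add: fM_pos_iff[OF B])
        then obtain y where y: "y \<in> set (item_table it')" "fst y = s"
          "\<not> fless (fmul (snd x) (loop_frac A it' (item_state it'))) (fmul (loop_frac B it' s) (snd y))"
          using link x s unfolding link_ok_def nst by blast
        have yp: "snd (snd y) > 0" using ok(2) y(1) by (auto simp: item_ok_def)
        have le: "wa_mat B (item_loop it') s s * fval (snd y) \<le> fval (snd x) * loop_gain A it'"
          using y(3) xp yp fmat[OF A r'] fmat[OF B s] r'
          by (subst (asm) fless_iff[where 'a=rat])
            (auto simp: fval_fmul loop_gain_def loop_frac_def snd_fmul)
        have "value_from B (concat (replicate n (item_loop it')) @ pumped_tail n ?its) (fst y)
          \<le> C * (wa_mat B (item_loop it') (fst y) (fst y) * fval (snd y) * ?P) ^ n"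
          by (rule item_loop_value_bound[OF B ok(2) n C(2)[OF n] y(1)])
        also have "\<dots> \<le> C * (fval (snd x) * loop_gain A it' * ?P) ^ n"
          unfolding y(2) using le P C(1)
          by (intro mult_left_mono power_mono mult_right_mono) (auto simp: wa_mat_nonneg)
        finally show ?thesis using True unfolding y(2) by (intro mult_left_mono) (auto simp: mult_ac)
      next
        case False
        then have "wa_M B (item_letter it) (fst x) s = 0" using wa_M_nonneg[of B "item_letter it" "fst x" s] by linarith
        then show ?thesis by simp
      qed
      then have "value_from B (pumped_tail n (it # ?its)) (fst x) \<le> (\<Sum>s<wa_nst B. wa_M B (item_letter it) (fst x) s * ?X)"
        unfolding pumped_tail.simps value_from_Cons by (intro sum_mono) (simp only: lessThan_iff)
      also have "\<dots> = (\<Sum>s<wa_nst B. wa_M B (item_letter it) (fst x) s) * ?X"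
        by (simp add: sum_distrib_right)
      also have "\<dots> \<le> (\<Sum>s<wa_nst B. \<Sum>t<wa_nst B. wa_M B (item_letter it) s t) * ?X"
        by (intro mult_right_mono X member_le_sum[of _ _ "\<lambda>s. \<Sum>t<wa_nst B. wa_M B (item_letter it) s t"])
          (use xB in \<open>auto intro!: sum_nonneg wa_M_nonneg\<close>)
      finally show ?thesis by (simp add: mult_ac)
    qed
    moreover have "?D \<ge> 0" using C(1) by (intro mult_nonneg_nonneg sum_nonneg wa_M_nonneg)
    moreover have "\<exists>c'>0. \<forall>n. c' * (loop_gain A it' * ?P) ^ n \<le> value_from A (pumped_tail n (it # ?its)) (item_state it)"
    proof (intro exI[of _ "wa_M A (item_letter it) (item_state it) (item_state it') * c"] conjI allI)
      have M: "wa_M A (item_letter it) (item_state it) (item_state it') > 0"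
        using link by (simp add: link_ok_def fM_pos_iff[OF A])
      then show "wa_M A (item_letter it) (item_state it) (item_state it') * c > 0" using c(1) by simp
      fix n
      have "loop_gain A it' ^ n * (c * ?P ^ n)
          \<le> wa_mat A (concat (replicate n (item_loop it'))) (item_state it') (item_state it') * value_from A (pumped_tail n ?its) (item_state it')"
        unfolding loop_gain_def[of A it']
        by (intro mult_mono c(2) wa_mat_loop_power_le r' wa_mat_nonneg) (use c(1) P in \<open>auto simp: loop_gain_def\<close>)
      also have "\<dots> \<le> value_from A (concat (replicate n (item_loop it')) @ pumped_tail n ?its) (item_state it')"
        unfolding value_from_append[OF r']
        by (rule member_le_sum[where i="item_state it'"]) (use r' in \<open>auto simp: wa_mat_nonneg value_from_nonneg\<close>)
      finally have "wa_M A (item_letter it) (item_state it) (item_state it') * (loop_gain A it' ^ n * (c * ?P ^ n))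
          \<le> wa_M A (item_letter it) (item_state it) (item_state it') * value_from A (concat (replicate n (item_loop it')) @ pumped_tail n ?its) (item_state it')"
        using M by (intro mult_left_mono) auto
      also have "\<dots> \<le> value_from A (pumped_tail n (it # ?its)) (item_state it)"
        unfolding pumped_tail.simps value_from_Cons
        by (rule member_le_sum[where i="item_state it'"]) (use r' in \<open>auto simp: wa_M_nonneg value_from_nonneg\<close>)
      finally show "wa_M A (item_letter it) (item_state it) (item_state it') * c * (loop_gain A it' * ?P) ^ n
          \<le> value_from A (pumped_tail n (it # ?its)) (item_state it)"
        by (simp add: power_mult_distrib mult_ac)
    qed
    moreover have "\<forall>n. set (pumped_tail n (it # ?its)) \<subseteq> {..<k}"
      using letters link ok(2) by (auto simp: link_ok_def item_ok_def split: if_splits)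
    moreover have "loop_gain A it' * ?P > 0" using al P by simp
    ultimately show ?case unfolding list.sel list.map prod_list.Cons by blast
  qed
  then show "\<exists>C\<ge>0. \<forall>n>0. \<forall>x\<in>set (item_table (hd its)). value_from B (pumped_tail n its) (fst x) \<le> C * (fval (snd x) * P) ^ n"
    and "\<exists>c>0. \<forall>n. c * P ^ n \<le> value_from A (pumped_tail n its) (item_state (hd its))"
    and "set (pumped_tail n its) \<subseteq> {..<k}" and "P > 0" by blast+
qed

text \<open>Inserting the two bounds on \<open>pumped n its\<close> into the big-O inequality and
  cancelling \<open>P ^ n\<close> leaves \<open>c * \<alpha> ^ n \<le> K * C * \<beta> ^ n\<close>
  with \<open>\<beta> < \<alpha>\<close>, which fails for large \<open>n\<close>.\<close>

lemma pump_cert_sound: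
  assumes A: "wa_wf k A" and B: "wa_wf k B" and cert: "pump_cert k A B its"
  shows "\<not> big_O k A B"
proof
  assume "big_O k A B"
  then obtain K where K: "K > 0" "\<And>w. set w \<subseteq> {..<k} \<Longrightarrow> wa_fun A w \<le> K * wa_fun B w" by (auto simp: big_O_def)
  let ?it = "hd its"
  have ne: "its \<noteq> []" using cert by (simp add: pump_cert_def)
  have hd: "nth_or d its 0 = hd its" and lst: "nth_or d (rev its) 0 = last its" for d
    using ne by (simp_all add: hd_conv_nth last_conv_nth rev_nth)
  have ok: "item_ok k A B ?it" and first: "first_ok A B ?it" using cert ne by (simp_all add: pump_cert_def hd)
  let ?P = "prod_list (map (loop_gain A) (tl its))"
  have items: "\<And>it. it \<in> set its \<Longrightarrow> item_ok k A B it" 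
    "\<And>p. p \<in> set (zip its (tl its)) \<Longrightarrow> link_ok k A B (fst p) (snd p)" "last_ok A B (last its)"
    using cert by (simp_all add: pump_cert_def lst)
  obtain C where C: "C \<ge> 0" "\<And>n x. n > 0 \<Longrightarrow> x \<in> set (item_table ?it) \<Longrightarrow> value_from B (pumped_tail n its) (fst x) \<le> C * (fval (snd x) * ?P) ^ n"
    using pumped_tail_bounds(1)[OF A B ne items] by blast
  obtain c where c: "c > 0" "\<And>n. c * ?P ^ n \<le> value_from A (pumped_tail n its) (item_state ?it)"
    using pumped_tail_bounds(2)[OF A B ne items] by blast
  have letters: "set (pumped_tail n its) \<subseteq> {..<k}" for n using pumped_tail_bounds(3)[OF A B ne items] by blast
  have P: "?P > 0" by (rule pumped_tail_bounds(4)[OF A B ne items])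
  have st: "item_state ?it = 0" using first by (simp add: first_ok_def)
  obtain x where x: "x \<in> set (item_table ?it)" "fst x = 0" "fless (fmul (loop_frac B ?it 0) (snd x)) (loop_frac A ?it 0)"
    using first by (auto simp: first_ok_def)
  have zA: "0 < wa_nst A" and zB: "0 < wa_nst B" using A B by (simp_all add: wa_wf_def)
  have xp: "snd (snd x) > 0" using ok x(1) by (auto simp: item_ok_def)
  define \<beta> where "\<beta> = wa_mat B (item_loop ?it) 0 0 * fval (snd x)"
  define \<alpha> where "\<alpha> = wa_mat A (item_loop ?it) 0 0"
  have \<beta>\<alpha>: "\<beta> < \<alpha>"
    using x(3) xp fmat[OF A zA] fmat[OF B zB]
    by (subst (asm) fless_iff[where 'a=rat]) (auto simp: fval_fmul \<alpha>_def \<beta>_def loop_frac_def snd_fmul)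
  have \<beta>0: "\<beta> \<ge> 0" by (simp add: \<beta>_def wa_mat_nonneg)
  have bound: "real_of_rat c * (of_rat \<alpha>) ^ n \<le> K * of_rat C * (of_rat \<beta>) ^ n" if n: "n > 0" for n
  proof -
    let ?w = "pumped n its"
    have w: "set ?w \<subseteq> {..<k}" using letters[of n] ok by (auto simp: pumped_def item_ok_def split: if_splits)
    have "value_from B ?w (fst x) \<le> C * (\<beta> * ?P) ^ n"
      using item_loop_value_bound[OF B ok n C(2)[OF n] x(1)] unfolding pumped_def \<beta>_def x(2) by simp
    then have upper: "wa_fun B ?w \<le> of_rat (C * (\<beta> * ?P) ^ n)"
      unfolding wa_fun_def value_from_def x(2) of_rat_less_eq .
    have "c * (\<alpha> * ?P) ^ n = \<alpha> ^ n * (c * ?P ^ n)" by (simp add: power_mult_distrib)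
    also have "\<dots> \<le> wa_mat A (concat (replicate n (item_loop ?it))) 0 0 * value_from A (pumped_tail n its) 0"
      unfolding \<alpha>_def using c P st by (intro mult_mono wa_mat_loop_power_le zA wa_mat_nonneg) auto
    also have "\<dots> \<le> value_from A ?w 0"
      unfolding pumped_def value_from_append[OF zA]
      by (rule member_le_sum[where i=0]) (use zA in \<open>auto simp: wa_mat_nonneg value_from_nonneg\<close>)
    finally have "of_rat (c * (\<alpha> * ?P) ^ n) \<le> wa_fun A ?w"
      unfolding wa_fun_def value_from_def of_rat_less_eq .
    also have "\<dots> \<le> K * wa_fun B ?w" by (rule K(2)[OF w])
    also have "\<dots> \<le> K * of_rat (C * (\<beta> * ?P) ^ n)" using K(1) upper by simp
    finally have "(of_rat c * of_rat \<alpha> ^ n) * real_of_rat ?P ^ n \<le> (K * of_rat C * of_rat \<beta> ^ n) * of_rat ?P ^ n"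
      by (simp add: of_rat_mult of_rat_power power_mult_distrib mult_ac)
    moreover have "real_of_rat ?P ^ n > 0" using P by simp
    ultimately show ?thesis by (simp only: mult_le_cancel_right_pos)
  qed
  have \<alpha>0: "\<alpha> > 0" using \<beta>\<alpha> \<beta>0 by simp
  define q where "q = real_of_rat \<beta> / of_rat \<alpha>"
  have q: "0 \<le> q" "q < 1" using \<beta>\<alpha> \<beta>0 \<alpha>0 by (simp_all add: q_def of_rat_less)
  have "(\<lambda>n. K * of_rat C * q ^ n) \<longlonglongrightarrow> K * of_rat C * 0"
    by (intro tendsto_intros LIMSEQ_power_zero) (use q in simp)
  then have "eventually (\<lambda>n. K * of_rat C * q ^ n < of_rat c) sequentially"
    by (rule order_tendstoD) (use c(1) in simp)
  with eventually_gt_at_top[of "0::nat"] have "eventually (\<lambda>n::nat. False) sequentially"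
  proof eventually_elim
    case (elim n)
    have "of_rat c * of_rat \<alpha> ^ n \<le> K * of_rat C * q ^ n * of_rat \<alpha> ^ n"
      using bound[OF elim(1)] \<alpha>0 by (simp add: q_def power_divide)
    then have "of_rat c \<le> K * of_rat C * q ^ n" using \<alpha>0 by simp
    then show False using elim(2) by simp
  qed
  then show False by simp
qed

section \<open>Walks and runs\<close>

fun walk :: "('v \<times> 'a \<times> 'v) set \<Rightarrow> 'v \<Rightarrow> ('a \<times> 'v) list \<Rightarrow> bool" where
  "walk E v [] \<longleftrightarrow> True"
| "walk E v (x # r) \<longleftrightarrow> (v, fst x, snd x) \<in> E \<and> walk E (snd x) r"

definition wend :: "'v \<Rightarrow> ('a \<times> 'v) list \<Rightarrow> 'v" where
  "wend v r = last (v # map snd r)"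

fun wsum :: "('v \<Rightarrow> 'a \<Rightarrow> 'v \<Rightarrow> real) \<Rightarrow> 'v \<Rightarrow> ('a \<times> 'v) list \<Rightarrow> real" where
  "wsum f v [] = 0"
| "wsum f v (x # r) = f v (fst x) (snd x) + wsum f (snd x) r"

lemma wend_simps [simp]: "wend v [] = v" "wend v (x # r) = wend (snd x) r" "wend v (r @ s) = wend (wend v r) s"
  by (simp_all add: wend_def)

lemma walk_append [simp]: "walk E v (r @ s) \<longleftrightarrow> walk E v r \<and> walk E (wend v r) s"
  by (induction r arbitrary: v) auto

lemma wsum_append [simp]: "wsum f v (r @ s) = wsum f v r + wsum f (wend v r) s"
  by (induction r arbitrary: v) auto

lemma walk_set: "walk E v r \<Longrightarrow> set r \<subseteq> (\<lambda>e. snd e) ` E"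
  by (induction r arbitrary: v) force+

lemma wend_in: "walk E v r \<Longrightarrow> v \<in> V \<Longrightarrow> (\<And>e. e \<in> E \<Longrightarrow> snd (snd e) \<in> V) \<Longrightarrow> wend v r \<in> V"
  by (induction r arbitrary: v) force+

text \<open>Two of the first \<open>card V + 1\<close> vertices of a long walk coincide, and the
  cycle between them has length at most \<open>card V\<close>; cutting it out does not lower the
  sum. Short cycles thus control walks of any length.\<close>

lemma walk_shorten:
  assumes V: "finite V" "v0 \<in> V" "\<forall>e\<in>E. snd (snd e) \<in> V"
    and neg: "\<forall>v\<in>V. \<forall>r. walk E v r \<longrightarrow> wend v r = v \<longrightarrow> length r \<le> card V \<longrightarrow> wsum f v r \<le> 0"
    and "walk E v0 r"
  shows "\<exists>r'. walk E v0 r' \<and> wend v0 r' = wend v0 r \<and> length r' \<le> card V \<and> wsum f v0 r \<le> wsum f v0 r'"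
  using assms(5)
proof (induction r rule: length_induct)
  case (1 r)
  show ?case
  proof (cases "length r \<le> card V")
    case False
    let ?N = "card V"
    have sub: "(\<lambda>i. wend v0 (take i r)) ` {..?N} \<subseteq> V"
    proof
      fix v assume "v \<in> (\<lambda>i. wend v0 (take i r)) ` {..?N}"
      then obtain i where i: "v = wend v0 (take i r)" by blast
      have "walk E v0 (take i r @ drop i r)" using 1(2) by simp
      then have "walk E v0 (take i r)" by (simp only: walk_append)
      then show "v \<in> V" unfolding i using V by (intro wend_in) auto
    qed
    have "\<not> inj_on (\<lambda>i. wend v0 (take i r)) {..?N}"
      using card_inj_on_le[OF _ sub V(1)] by auto
    then obtain i j where "i \<noteq> j" "i \<le> ?N" "j \<le> ?N" "wend v0 (take i r) = wend v0 (take j r)"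
      by (auto simp: inj_on_def)
    then obtain i j where ij: "i < j" "j \<le> ?N" "wend v0 (take i r) = wend v0 (take j r)"
      by (metis linorder_neqE_nat)
    define x where "x = take i r"
    define c where "c = take (j - i) (drop i r)"
    define z where "z = drop j r"
    have xc: "take j r = x @ c" using take_add[of i "j - i" r] ij(1) by (simp add: x_def c_def)
    have "take j r @ drop j r = r" by simp
    then have r: "r = x @ c @ z" unfolding xc z_def[symmetric] by simp
    have lc: "length c = j - i" using ij False by (simp add: c_def)
    have closed: "wend (wend v0 x) c = wend v0 x" using ij(3) xc by (simp add: x_def)
    have w: "walk E v0 x" "walk E (wend v0 x) c" "walk E (wend v0 x) z"
      using 1(2) closed by (simp_all add: r)
    have "wend v0 x \<in> V" using w(1) V by (intro wend_in) auto
    then have "wsum f (wend v0 x) c \<le> 0" using w(2) closed lc ij neg by auto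
    moreover have "length (x @ z) < length r" using lc ij(1) by (simp add: r)
    moreover have "walk E v0 (x @ z)" using w by simp
    ultimately obtain r' where "walk E v0 r'" "wend v0 r' = wend v0 (x @ z)" "length r' \<le> card V" "wsum f v0 (x @ z) \<le> wsum f v0 r'"
      using 1(1) by blast
    then show ?thesis using \<open>wsum f (wend v0 x) c \<le> 0\<close> closed
      by (intro exI[of _ r']) (auto simp: r)
  qed (use 1(2) in blast)
qed

text \<open>The potential is the largest sum of a walk from \<open>v0\<close>, which cannot be
  improved by cycles. That each value is the sum of an actual walk is recorded because it later
  places the potential in the ring of logarithms.\<close>

lemma potential_exists:
  assumes E: "finite E" and V: "finite V" "v0 \<in> V" "\<forall>e\<in>E. snd (snd e) \<in> V"
    and neg: "\<forall>v\<in>V. \<forall>r. walk E v r \<longrightarrow> wend v r = v \<longrightarrow> length r \<le> card V \<longrightarrow> wsum f v r \<le> 0"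
    and reach: "\<And>e. e \<in> E \<Longrightarrow> \<exists>r. walk E v0 r \<and> wend v0 r = fst e"
  shows "\<exists>h. (\<forall>v. \<exists>r. walk E v0 r \<and> h v = wsum f v0 r) \<and> (\<forall>(v, a, v')\<in>E. h v + f v a v' \<le> h v')"
proof -
  define S where "S v = wsum f v0 ` {r. walk E v0 r \<and> wend v0 r = v \<and> length r \<le> card V}" for v
  have fin: "finite (S v)" for v
  proof -
    have "{r. walk E v0 r \<and> wend v0 r = v \<and> length r \<le> card V} \<subseteq> {r. set r \<subseteq> snd ` E \<and> length r \<le> card V}"
      using walk_set[of E v0] by (auto simp del: image_subset_iff dest: subsetD)
    then have "finite {r. walk E v0 r \<and> wend v0 r = v \<and> length r \<le> card V}"
      by (rule finite_subset) (use E in \<open>auto intro: finite_lists_length_le\<close>)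
    then show ?thesis by (simp add: S_def)
  qed
  \<comment> \<open>The default 0 is the sum of the empty walk, so unreachable vertices satisfy the
    first claim too.\<close>
  define h where "h v = (if S v = {} then 0 else Max (S v))" for v
  have "\<exists>r. walk E v0 r \<and> h v = wsum f v0 r" for v
  proof (cases "S v = {}")
    case True
    then show ?thesis by (intro exI[of _ "[]"]) (simp add: h_def)
  next
    case False
    then have "h v \<in> S v" using Max_in[OF fin] by (simp add: h_def)
    then show ?thesis by (auto simp: S_def)
  qed
  moreover have "h v + f v a v' \<le> h v'" if e: "(v, a, v') \<in> E" for v a v'
  proof -
    obtain r0 where "walk E v0 r0" "wend v0 r0 = v" using reach[OF e] by auto
    with walk_shorten[OF V neg, of r0] obtain r' where "walk E v0 r'" "wend v0 r' = v" "length r' \<le> card V" by metis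
    then have "S v \<noteq> {}" unfolding S_def by blast
    then have "h v \<in> S v" using Max_in[OF fin] by (simp add: h_def)
    then obtain r where r: "walk E v0 r" "wend v0 r = v" "h v = wsum f v0 r" by (auto simp: S_def)
    have "walk E v0 (r @ [(a, v')])" using r e by simp
    from walk_shorten[OF V neg this] obtain r' where r': "walk E v0 r'" "wend v0 r' = v'" "length r' \<le> card V"
      "wsum f v0 (r @ [(a, v')]) \<le> wsum f v0 r'" by (auto simp del: walk_append wsum_append)
    have S': "wsum f v0 r' \<in> S v'" unfolding S_def using r' by blast
    have "h v + f v a v' = wsum f v0 (r @ [(a, v')])" using r by simp
    also have "\<dots> \<le> wsum f v0 r'" by (rule r'(4))
    also have "\<dots> \<le> h v'" using Max_ge[OF fin S'] S' by (auto simp: h_def)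
    finally show ?thesis .
  qed
  ultimately show ?thesis by blast
qed

section \<open>Consequences of finite ambiguity for loops\<close>

lemma path_power:
  assumes "path A s v \<alpha>" "last (s # \<alpha>) = s"
  shows "path A s (concat (replicate i v)) (concat (replicate i \<alpha>)) \<and> last (s # concat (replicate i \<alpha>)) = s"
proof (induction i)
  case (Suc i)
  have "last (s # \<alpha> @ concat (replicate i \<alpha>)) = s" using Suc assms by (cases \<alpha>) (auto simp: last_append)
  then show ?case using Suc assms path_length[OF assms(1)] by (simp add: path_append del: last.simps)
qed simp

text \<open>The paths \<open>\<alpha>\<^sup>i \<gamma> \<beta>\<^sup>N\<^sup>-\<^sup>1\<^sup>-\<^sup>i\<close> would otherwise be pairwise distinct accepting paths on one word.\<close>
lemma finitely_ambiguous_loop_unique: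
  assumes fa: "finitely_ambiguous k B" and letters: "set (u @ v @ u') \<subseteq> {..<k}"
    and x: "path B 0 u x" "last (0 # x) = s"
    and \<alpha>: "path B s v \<alpha>" "last (s # \<alpha>) = s"
    and \<gamma>: "path B s v \<gamma>" "last (s # \<gamma>) = s'"
    and \<beta>: "path B s' v \<beta>" "last (s' # \<beta>) = s'"
    and y: "path B s' u' y" "last (s' # y) \<in> wa_final B"
  shows "\<gamma> = \<alpha>"
proof (rule ccontr)
  assume ne: "\<gamma> \<noteq> \<alpha>"
  obtain c where c: "\<And>w. set w \<subseteq> {..<k} \<Longrightarrow> card (wa_acc_paths B w) \<le> c"
    using fa by (auto simp: finitely_ambiguous_def)
  \<comment> \<open>With \<open>c + 1\<close> copies of the loop there are \<open>c + 1\<close>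
    positions for \<open>\<gamma>\<close>, one more than the ambiguity bound allows.\<close>
  define W where "W = u @ concat (replicate (Suc c) v) @ u'"
  define P where "P i = x @ concat (replicate i \<alpha>) @ \<gamma> @ concat (replicate (c - i) \<beta>) @ y" for i
  note len = path_length[OF \<alpha>(1)] path_length[OF \<gamma>(1)] path_length[OF \<beta>(1)] path_length[OF x(1)]
  have P: "P i \<in> wa_acc_paths B W" if i: "i \<le> c" for i
  proof -
    have "replicate (Suc c) v = replicate i v @ [v] @ replicate (c - i) v"
      using i by (metis append_Cons append_Nil le_add_diff_inverse replicate_Suc replicate_add replicate_app_Cons_same)
    then have W: "W = u @ concat (replicate i v) @ v @ concat (replicate (c - i) v) @ u'"
      unfolding W_def by simp
    have lens: "length (concat (replicate i \<alpha>)) = length (concat (replicate i v))"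
      "length (concat (replicate (c - i) \<beta>)) = length (concat (replicate (c - i) v))"
      using len by (simp_all add: length_concat sum_list_replicate)
    have l: "last (p # xs @ ys) = last (last (p # xs) # ys)" for p :: nat and xs ys by (simp add: last_append)
    have "path B 0 W (P i) \<and> last (0 # P i) = last (s' # y)"
      unfolding W P_def l path_append[OF len(4)] path_append[OF lens(1)] path_append[OF len(2)] path_append[OF lens(2)]
        x(2) path_power[OF \<alpha>, THEN conjunct2] \<gamma>(2) path_power[OF \<beta>, THEN conjunct2]
      using x \<gamma> y path_power[OF \<alpha>] path_power[OF \<beta>] by (simp del: last.simps)
    then show ?thesis using y(2) by (simp add: wa_acc_paths_eq del: last.simps)
  qed
  have "P i \<noteq> P j" if ij: "i < j" for i j
  proof
    assume eq: "P i = P j"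
    have "concat (replicate j \<alpha>) = concat (replicate i \<alpha>) @ \<alpha> @ concat (replicate (j - Suc i) \<alpha>)"
      using ij by (metis Suc_leI concat_append concat.simps(2) le_add_diff_inverse replicate_Suc replicate_add add_Suc_shift)
    then have "\<gamma> @ concat (replicate (c - i) \<beta>) @ y = \<alpha> @ concat (replicate (j - Suc i) \<alpha>) @ \<gamma> @ concat (replicate (c - j) \<beta>) @ y"
      using eq by (simp add: P_def)
    \<comment> \<open>After the common prefix the two lists begin with \<open>\<gamma>\<close> and
      \<open>\<alpha>\<close>, which have equal length and differ.\<close>
    then show False using ne len by simp
  qed
  then have "inj_on P {..c}" by (metis inj_onI linorder_neqE_nat)
  then have "card (P ` {..c}) = Suc c" by (simp add: card_image)
  moreover have "card (P ` {..c}) \<le> card (wa_acc_paths B W)"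
    using P by (intro card_mono finite_acc_paths) auto
  moreover have "card (wa_acc_paths B W) \<le> c"
    using letters by (intro c) (auto simp: W_def split: if_splits)
  ultimately show False by simp
qed

lemma path_split:
  assumes "path A q w r" "i \<le> length w"
  shows "path A q (take i w) (take i r)" "last (q # take i r) = (q # r) ! i"
    "path A ((q # r) ! i) (drop i w) (drop i r)" "last ((q # r) ! i # drop i r) = last (q # r)"
proof -
  have len: "length r = length w" using path_length[OF assms(1)] .
  have l: "length (take i r) = length (take i w)" using len by simp
  show last: "last (q # take i r) = (q # r) ! i"
    using assms(2) len last_conv_nth[of "q # take i r"] by (cases i) auto
  have "path A q (take i w @ drop i w) (take i r @ drop i r)" using assms by simp
  then show "path A q (take i w) (take i r)" "path A ((q # r) ! i) (drop i w) (drop i r)"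
    unfolding path_append[OF l] last by simp_all
  have "last (q # take i r @ drop i r) = last (last (q # take i r) # drop i r)" by (simp add: last_append)
  then show "last ((q # r) ! i # drop i r) = last (q # r)" unfolding last by simp
qed

text \<open>A vertex records the state of \<open>A\<close>, the states of the tracked paths of \<open>B\<close>, and the states
  of \<open>B\<close> that are reachable by the prefix read and from which the rest of the word is accepted.\<close>
type_synonym vertex = "nat \<times> nat list \<times> nat set \<times> nat set"

abbreviation (input) "stateA v \<equiv> fst v"
abbreviation (input) "tracked v \<equiv> fst (snd v)"
abbreviation (input) "fwd v \<equiv> fst (snd (snd v))"
abbreviation (input) "bwd v \<equiv> snd (snd (snd v))"

definition gain :: "wa \<Rightarrow> wa \<Rightarrow> nat \<Rightarrow> vertex \<Rightarrow> nat \<Rightarrow> vertex \<Rightarrow> real" where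
  "gain A B j v a v' = ln (of_rat (wa_M A a (stateA v) (stateA v'))) -
     ln (of_rat (wa_M B a (tracked v ! j) (tracked v' ! j)))"

text \<open>\<open>fwd\<close> is closed along transitions of \<open>B\<close> and
  \<open>bwd\<close> against them. These inclusions suffice to push membership forwards and
  backwards along walks.\<close>

definition edge_ok :: "nat \<Rightarrow> wa \<Rightarrow> wa \<Rightarrow> nat \<Rightarrow> vertex \<times> nat \<times> vertex \<Rightarrow> bool" where
  "edge_ok k A B m e \<longleftrightarrow> (case e of (v, a, v') \<Rightarrow> a < k \<and>
     wa_M A a (stateA v) (stateA v') > 0 \<and> stateA v' < wa_nst A \<and>
     length (tracked v) = m \<and> length (tracked v') = m \<and>
     (\<forall>j<m. wa_M B a (tracked v ! j) (tracked v' ! j) > 0 \<and> tracked v' ! j < wa_nst B) \<and>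
     (\<forall>s s'. s \<in> fwd v \<longrightarrow> s' < wa_nst B \<longrightarrow> wa_M B a s s' > 0 \<longrightarrow> s' \<in> fwd v') \<and>
     (\<forall>s s'. s < wa_nst B \<longrightarrow> s' \<in> bwd v' \<longrightarrow> wa_M B a s s' > 0 \<longrightarrow> s \<in> bwd v))"

text \<open>Translates walks back into runs. Only \<open>edge_ok\<close> is used, so this also
  covers walks that combine edges from different positions of a word, as cycles do.\<close>

lemma walk_paths:
  assumes "\<forall>e\<in>E. edge_ok k A B m e" and "walk E v r"
  shows "path A (stateA v) (map fst r) (map (\<lambda>x. stateA (snd x)) r)"
    and "last (stateA v # map (\<lambda>x. stateA (snd x)) r) = stateA (wend v r)"
    and "j < m \<Longrightarrow> path B (tracked v ! j) (map fst r) (map (\<lambda>x. tracked (snd x) ! j) r)"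
    and "last (tracked v ! j # map (\<lambda>x. tracked (snd x) ! j) r) = tracked (wend v r) ! j"
    and "j < m \<Longrightarrow> wsum (gain A B j) v r = ln (of_rat (pweight A (stateA v) (map fst r) (map (\<lambda>x. stateA (snd x)) r)))
       - ln (of_rat (pweight B (tracked v ! j) (map fst r) (map (\<lambda>x. tracked (snd x) ! j) r)))"
    and "s \<in> fwd v \<Longrightarrow> path B s (map fst r) ss \<Longrightarrow> last (s # ss) \<in> fwd (wend v r)"
    and "s < wa_nst B \<Longrightarrow> path B s (map fst r) ss \<Longrightarrow> last (s # ss) \<in> bwd (wend v r) \<Longrightarrow> s \<in> bwd v"
    and "set (map fst r) \<subseteq> {..<k}"
proof -
  have E: "\<And>e. e \<in> E \<Longrightarrow> edge_ok k A B m e" using assms(1) by blast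
  have pA: "path A (stateA v) (map fst r) (map (\<lambda>x. stateA (snd x)) r)" if "walk E v r" for v r
    using that by (induction r arbitrary: v) (auto simp: edge_ok_def dest!: E)
  have pB: "path B (tracked v ! j) (map fst r) (map (\<lambda>x. tracked (snd x) ! j) r)" if "j < m" "walk E v r" for v r j
    using that by (induction r arbitrary: v) (auto simp: edge_ok_def dest!: E)
  show "path A (stateA v) (map fst r) (map (\<lambda>x. stateA (snd x)) r)"
    "j < m \<Longrightarrow> path B (tracked v ! j) (map fst r) (map (\<lambda>x. tracked (snd x) ! j) r)"
    using pA pB assms(2) by blast+
  show "last (stateA v # map (\<lambda>x. stateA (snd x)) r) = stateA (wend v r)"
    "last (tracked v ! j # map (\<lambda>x. tracked (snd x) ! j) r) = tracked (wend v r) ! j"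
    by (induction r arbitrary: v) auto
  show "wsum (gain A B j) v r = ln (of_rat (pweight A (stateA v) (map fst r) (map (\<lambda>x. stateA (snd x)) r)))
       - ln (of_rat (pweight B (tracked v ! j) (map fst r) (map (\<lambda>x. tracked (snd x) ! j) r)))" if j: "j < m"
    using assms(2)
  proof (induction r arbitrary: v)
    case (Cons x r)
    then have e: "edge_ok k A B m (v, fst x, snd x)" and w: "walk E (snd x) r" using E by auto
    have "pweight A (stateA (snd x)) (map fst r) (map (\<lambda>x. stateA (snd x)) r) > 0"
      "pweight B (tracked (snd x) ! j) (map fst r) (map (\<lambda>x. tracked (snd x) ! j) r) > 0"
      using pA[OF w] pB[OF j w] by (auto intro: pweight_pos)
    moreover have "wa_M A (fst x) (stateA v) (stateA (snd x)) > 0" "wa_M B (fst x) (tracked v ! j) (tracked (snd x) ! j) > 0"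
      using e j by (auto simp: edge_ok_def)
    ultimately show ?case using Cons.IH[OF w]
      by (simp add: gain_def of_rat_mult ln_mult)
  qed simp
  show "s \<in> fwd v \<Longrightarrow> path B s (map fst r) ss \<Longrightarrow> last (s # ss) \<in> fwd (wend v r)"
    using assms(2)
  proof (induction r arbitrary: v s ss)
    case (Cons x r)
    then obtain p ps where ss: "ss = p # ps" by (cases ss) auto
    have "edge_ok k A B m (v, fst x, snd x)" using Cons.prems E[of "(v, fst x, snd x)"] by simp
    then have "p \<in> fwd (snd x)" using Cons.prems ss unfolding edge_ok_def prod.case by simp
    from Cons.IH[OF this] Cons.prems ss show ?case by simp
  qed simp
  show "s < wa_nst B \<Longrightarrow> path B s (map fst r) ss \<Longrightarrow> last (s # ss) \<in> bwd (wend v r) \<Longrightarrow> s \<in> bwd v"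
    using assms(2)
  proof (induction r arbitrary: v s ss)
    case (Cons x r)
    then obtain p ps where ss: "ss = p # ps" by (cases ss) auto
    have e: "edge_ok k A B m (v, fst x, snd x)" using Cons.prems E[of "(v, fst x, snd x)"] by simp
    have "p \<in> bwd (snd x)" using Cons.IH[of p ps "snd x"] Cons.prems ss by simp
    then show ?case using e Cons.prems ss unfolding edge_ok_def prod.case by (simp del: last.simps)
  qed simp
  have "\<forall>x\<in>set r. fst x < k"
    using assms(2)
  proof (induction r arbitrary: v)
    case (Cons x r)
    then have "edge_ok k A B m (v, fst x, snd x)" using E[of "(v, fst x, snd x)"] by simp
    then have "fst x < k" unfolding edge_ok_def prod.case by blast
    moreover have "\<forall>x\<in>set r. fst x < k" using Cons.IH[of "snd x"] Cons.prems by simp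
    ultimately show ?case by simp
  qed simp
  then show "set (map fst r) \<subseteq> {..<k}" by auto
qed

text \<open>One accepting run of \<open>A\<close> against all accepting runs of \<open>B\<close> on
  the same word. The list \<open>\<rho>s\<close> fixes the order of the coordinates of gain
  vectors.\<close>

locale accepted_run =
  fixes k :: nat and A B :: wa and w qs :: "nat list" and \<rho>s :: "nat list list"
  assumes wfA: "wa_wf k A" and wfB: "wa_wf k B" and w: "set w \<subseteq> {..<k}"
    and qs: "qs \<in> wa_acc_paths A w" and \<rho>s: "set \<rho>s = wa_acc_paths B w"
begin

definition vert :: "nat \<Rightarrow> vertex" where
  "vert i = ((0 # qs) ! i, map (\<lambda>\<rho>. (0 # \<rho>) ! i) \<rho>s,
     {s. \<exists>r. path B 0 (take i w) r \<and> last (0 # r) = s},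
     {s. s < wa_nst B \<and> (\<exists>r. path B s (drop i w) r \<and> last (s # r) \<in> wa_final B)})"

text \<open>The positions form a line, but positions with equal vertices are identified; this is
  what creates cycles.\<close>

definition edges :: "(vertex \<times> nat \<times> vertex) set" where
  "edges = (\<lambda>i. (vert i, w ! i, vert (Suc i))) ` {..<length w}"

lemma pathA: "path A 0 w qs" and lastA: "last (0 # qs) \<in> wa_final A"
  using qs by (simp_all add: wa_acc_paths_eq)

lemma pathB: "\<rho> \<in> set \<rho>s \<Longrightarrow> path B 0 w \<rho>" and lastB: "\<rho> \<in> set \<rho>s \<Longrightarrow> last (0 # \<rho>) \<in> wa_final B"
  using \<rho>s by (simp_all add: wa_acc_paths_eq)

lemma zero_states: "0 < wa_nst A" "0 < wa_nst B"
  using wfA wfB by (simp_all add: wa_wf_def)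

lemma fwd_lt: "s \<in> fwd (vert i) \<Longrightarrow> s < wa_nst B"
  using path_last[OF _ zero_states(2)] by (auto simp: vert_def simp del: last.simps)

lemma bwd_lt: "s \<in> bwd (vert i) \<Longrightarrow> s < wa_nst B"
  by (auto simp: vert_def)

text \<open>A state that is reachable and co-reachable at position \<open>i\<close> lies on an
  accepting path, and every accepting path is tracked.\<close>

lemma tracked_eq:
  assumes "i \<le> length w" shows "set (tracked (vert i)) = fwd (vert i) \<inter> bwd (vert i)"
proof (intro equalityI subsetI)
  fix s assume "s \<in> set (tracked (vert i))"
  then obtain \<rho> where \<rho>: "\<rho> \<in> set \<rho>s" "s = (0 # \<rho>) ! i" by (auto simp: vert_def)
  note sp = path_split[OF pathB[OF \<rho>(1)] assms, folded \<rho>(2)]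
  have "s < wa_nst B" using path_last[OF sp(1) zero_states(2)] sp(2) by simp
  then show "s \<in> fwd (vert i) \<inter> bwd (vert i)"
    using sp lastB[OF \<rho>(1)] unfolding vert_def by (auto simp del: last.simps)
next
  fix s assume "s \<in> fwd (vert i) \<inter> bwd (vert i)"
  then obtain x y where x: "path B 0 (take i w) x" "last (0 # x) = s"
    and y: "path B s (drop i w) y" "last (s # y) \<in> wa_final B" by (auto simp: vert_def simp del: last.simps)
  have lx: "length x = length (take i w)" using path_length[OF x(1)] .
  have "path B 0 (take i w @ drop i w) (x @ y)" unfolding path_append[OF lx] using x y by simp
  moreover have "last (0 # x @ y) = last (s # y)" using x(2) by (auto simp: last_append)
  ultimately have "x @ y \<in> set \<rho>s" using y(2) by (simp add: \<rho>s wa_acc_paths_eq del: last.simps)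
  moreover have "(0 # x @ y) ! i = s"
    using x(2) lx assms last_conv_nth[of "0 # x"] nth_append[of "0 # x" y i] by (auto simp: min_def)
  ultimately show "s \<in> set (tracked (vert i))" by (force simp: vert_def)
qed

lemma edges_ok: "\<forall>e\<in>edges. edge_ok k A B (length \<rho>s) e"
proof
  fix e assume "e \<in> edges"
  then obtain i where i: "i < length w" and e: "e = (vert i, w ! i, vert (Suc i))" by (auto simp: edges_def)
  have drop: "drop i w = w ! i # drop (Suc i) w" using i by (simp add: Cons_nth_drop_Suc)
  have take: "take (Suc i) w = take i w @ [w ! i]" using i by (simp add: take_Suc_conv_app_nth)
  have step: "M a ((0 # r) ! i) ((0 # r) ! Suc i) > 0 \<and> (0 # r) ! Suc i < wa_nst C"
    if "path C 0 w r" "M = wa_M C" "a = w ! i" for C r M a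
    using that i path_iff_nth[of C 0 w r] by (auto simp: subset_iff)
  have "w ! i < k" using w nth_mem[OF i] by blast
  moreover have "\<forall>j<length \<rho>s. wa_M B (w ! i) (tracked (vert i) ! j) (tracked (vert (Suc i)) ! j) > 0 \<and> tracked (vert (Suc i)) ! j < wa_nst B"
    using step[OF pathB] by (simp add: vert_def)
  moreover have "wa_M A (w ! i) (stateA (vert i)) (stateA (vert (Suc i))) > 0 \<and> stateA (vert (Suc i)) < wa_nst A"
    using step[OF pathA] by (simp add: vert_def)
  moreover have "s' \<in> fwd (vert (Suc i))" if s: "s \<in> fwd (vert i)" "s' < wa_nst B" "wa_M B (w ! i) s s' > 0" for s s'
  proof -
    obtain r where r: "path B 0 (take i w) r" "last (0 # r) = s" using s(1) by (auto simp: vert_def simp del: last.simps)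
    have "path B 0 (take (Suc i) w) (r @ [s'])"
      unfolding take path_append[OF path_length[OF r(1)]] using r s by simp
    then show ?thesis unfolding vert_def by (auto intro!: exI[of _ "r @ [s']"])
  qed
  moreover have "s \<in> bwd (vert i)" if s: "s < wa_nst B" "s' \<in> bwd (vert (Suc i))" "wa_M B (w ! i) s s' > 0" for s s'
  proof -
    obtain r where r: "path B s' (drop (Suc i) w) r" "last (s' # r) \<in> wa_final B" "s' < wa_nst B"
      using s(2) by (auto simp: vert_def simp del: last.simps)
    then have "path B s (drop i w) (s' # r)" "last (s # s' # r) \<in> wa_final B" using s by (simp_all add: drop)
    then show ?thesis using s(1) unfolding vert_def by (auto simp del: last.simps)
  qed
  moreover have "length (tracked (vert i)) = length \<rho>s" for i by (simp add: vert_def)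
  ultimately show "edge_ok k A B (length \<rho>s) e" unfolding edge_ok_def e prod.case by blast
qed

text \<open>Transport of \<open>fwd\<close> and \<open>bwd\<close> along the loop shows that both
  end states of \<open>\<gamma>\<close> are tracked, so each has its own tracked loop on this word.
  A path joining the two is then the tracked loop at \<open>s\<close>, by finite ambiguity.\<close>

lemma loop_unique:
  assumes fa: "finitely_ambiguous k B" and i: "i \<le> length w"
    and r: "walk edges (vert i) r" "wend (vert i) r = vert i"
    and s: "s \<in> fwd (vert i)" "s' \<in> bwd (vert i)" and \<gamma>: "path B s (map fst r) \<gamma>" "last (s # \<gamma>) = s'"
  shows "s' = s" and "j < length \<rho>s \<Longrightarrow> s = tracked (vert i) ! j \<Longrightarrow> \<gamma> = map (\<lambda>x. tracked (snd x) ! j) r"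
proof -
  note wp = walk_paths[OF edges_ok r(1)]
  have "s' \<in> fwd (vert i)" using wp(6)[OF s(1) \<gamma>(1)] \<gamma>(2) r(2) by simp
  then have "s' \<in> set (tracked (vert i))" using s tracked_eq[OF i] by blast
  then obtain j' where j': "j' < length \<rho>s" "s' = tracked (vert i) ! j'" by (auto simp: vert_def in_set_conv_nth)
  have "s \<in> bwd (vert i)" using wp(7)[OF fwd_lt[OF s(1)] \<gamma>(1)] \<gamma>(2) s(2) r(2) by simp
  then have "s \<in> set (tracked (vert i))" using s tracked_eq[OF i] by blast
  then obtain j0 where j0: "j0 < length \<rho>s" "s = tracked (vert i) ! j0" by (auto simp: vert_def in_set_conv_nth)
  obtain x where x: "path B 0 (take i w) x" "last (0 # x) = s" using s(1) by (auto simp: vert_def simp del: last.simps)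
  obtain y where y: "path B s' (drop i w) y" "last (s' # y) \<in> wa_final B" using s(2) by (auto simp: vert_def simp del: last.simps)
  have letters: "set (take i w @ map fst r @ drop i w) \<subseteq> {..<k}"
    using w wp(8) set_take_subset[of i w] set_drop_subset[of i w] by auto
  have loop: "path B (tracked (vert i) ! j) (map fst r) (map (\<lambda>x. tracked (snd x) ! j) r)"
    "last (tracked (vert i) ! j # map (\<lambda>x. tracked (snd x) ! j) r) = tracked (vert i) ! j" if "j < length \<rho>s" for j
    using wp(3)[OF that] wp(4)[of j] r(2) by simp_all
  have eq: "\<gamma> = map (\<lambda>x. tracked (snd x) ! j) r" if "j < length \<rho>s" "s = tracked (vert i) ! j" for j
    by (rule finitely_ambiguous_loop_unique[OF fa letters x _ _ \<gamma> loop[OF j'(1), folded j'(2)] y])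
      (use loop[OF that(1)] that(2) in simp_all)
  then show "j < length \<rho>s \<Longrightarrow> s = tracked (vert i) ! j \<Longrightarrow> \<gamma> = map (\<lambda>x. tracked (snd x) ! j) r" by blast
  show "s' = s" using \<gamma>(2) eq[OF j0] loop(2)[OF j0(1)] j0(2) by simp
qed

end

section \<open>Completeness of the certificates\<close>

text \<open>The factor at position \<open>i\<close> itself is missing on purpose: the value refers
  to a state reached after the loop inserted at \<open>i\<close>.\<close>

fun pathval :: "(nat \<Rightarrow> nat \<Rightarrow> rat) \<Rightarrow> nat \<Rightarrow> nat list \<Rightarrow> rat" where
  "pathval g i [] = 1"
| "pathval g i (p # r) = g (Suc i) p * pathval g (Suc i) r"

lemma pathval_prod: "pathval g i r = (\<Prod>t<length r. g (Suc (i + t)) (r ! t))"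
proof (induction r arbitrary: i)
  case (Cons p r)
  show ?case by (simp add: Cons prod.lessThan_Suc_shift del: prod.lessThan_Suc)
qed simp

lemma frac_of_nonneg_rat: "\<exists>f. \<forall>x\<ge>0. snd (f x) > 0 \<and> fval (f x) = (x :: rat)"
proof -
  have "\<exists>p. x \<ge> 0 \<longrightarrow> snd p > 0 \<and> fval p = x" for x :: rat
  proof -
    obtain a b where ab: "quotient_of x = (a, b)" by fastforce
    have b: "b > 0" "x = of_int a / of_int b"
      using quotient_of_denom_pos[OF ab] quotient_of_div[OF ab] by simp_all
    show ?thesis
    proof (intro exI[of _ "(nat a, nat b)"] impI)
      assume "x \<ge> 0"
      then have "a \<ge> 0" using b by (simp add: zero_le_divide_iff)
      then show "snd (nat a, nat b) > 0 \<and> fval (nat a, nat b) = x" using b by (simp add: fval_def)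
    qed
  qed
  then show ?thesis by metis
qed

context accepted_run
begin

lemma tracked_nth: "j < length \<rho>s \<Longrightarrow> tracked (vert i) ! j = (0 # \<rho>s ! j) ! i"
  by (simp add: vert_def)

text \<open>By uniqueness of the tracked loop, the diagonal entry is a sum with one term.\<close>

lemma wa_mat_loop_tracked:
  assumes fa: "finitely_ambiguous k B" and i: "i \<le> length w"
    and r: "walk edges (vert i) r" "wend (vert i) r = vert i" and j: "j < length \<rho>s"
  defines "s \<equiv> tracked (vert i) ! j"
  shows "wa_mat B (map fst r) s s = pweight B s (map fst r) (map (\<lambda>x. tracked (snd x) ! j) r)"
proof -
  note wp = walk_paths[OF edges_ok r(1)]
  have "s \<in> set (tracked (vert i))" using j by (simp add: s_def vert_def)
  then have sfb: "s \<in> fwd (vert i)" "s \<in> bwd (vert i)" using tracked_eq[OF i] by auto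
  have "{\<gamma>. path B s (map fst r) \<gamma> \<and> last (s # \<gamma>) = s} = {map (\<lambda>x. tracked (snd x) ! j) r}"
  proof (intro equalityI subsetI)
    fix \<gamma> assume "\<gamma> \<in> {\<gamma>. path B s (map fst r) \<gamma> \<and> last (s # \<gamma>) = s}"
    then show "\<gamma> \<in> {map (\<lambda>x. tracked (snd x) ! j) r}"
      using loop_unique(2)[OF fa i r sfb _ _ j] by (auto simp: s_def simp del: last.simps)
  next
    fix \<gamma> assume "\<gamma> \<in> {map (\<lambda>x. tracked (snd x) ! j) r}"
    then show "\<gamma> \<in> {\<gamma>. path B s (map fst r) \<gamma> \<and> last (s # \<gamma>) = s}"
      using wp(3)[OF j] wp(4)[of j] r(2) by (simp add: s_def del: last.simps)
  qed
  then show ?thesis by (simp add: wa_mat_paths del: last.simps)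
qed

text \<open>\<open>C i\<close> is the loop inserted at position \<open>i\<close>. Potentials are
  maximal products of loop ratios over accepted suffixes; if the maximum at the start is not 0, it
  is attained by one of the \<open>\<rho>s\<close>, whose total gain is positive. If
  \<open>\<rho>s\<close> is empty, the first potential is 0 and the strict inequality at the start
  is immediate.\<close>

lemma pump_cert_exists:
  assumes fa: "finitely_ambiguous k B"
    and C: "\<And>i. i \<le> length w \<Longrightarrow> walk edges (vert i) (C i)" "\<And>i. i \<le> length w \<Longrightarrow> wend (vert i) (C i) = vert i"
    and pos: "\<And>j. j < length \<rho>s \<Longrightarrow> (\<Sum>i\<le>length w. wsum (gain A B j) (vert i) (C i)) > 0"
  shows "\<exists>its. pump_cert k A B its"
proof -
  let ?L = "length w"
  define v where "v i = map fst (C i)" for i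
  define q where "q i = (0 # qs) ! i" for i
  define al where "al i = wa_mat A (v i) (q i) (q i)" for i
  define d where "d i s = wa_mat B (v i) s s" for i s
  define g where "g i s = d i s / al i" for i s
  define Ps where "Ps i s = {r. path B s (drop i w) r \<and> last (s # r) \<in> wa_final B}" for i s
  \<comment> \<open>The inserted 0 is the potential of states without accepted suffix, exactly those
    that a loop may enter from elsewhere.\<close>
  define psi where "psi i s = Max (insert 0 (pathval g i ` Ps i s))" for i s
  have finP: "finite (Ps i s)" for i s unfolding Ps_def by (rule finite_subset[OF _ finite_paths[of B s "drop i w"]]) auto
  have psi0: "psi i s \<ge> 0" for i s unfolding psi_def by (rule Max_ge) (use finP in auto)
  have psi_ge: "pathval g i r \<le> psi i s" if "r \<in> Ps i s" for i s r
    unfolding psi_def by (rule Max_ge) (use finP that in auto)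
  have psi_cases: "psi i s = 0 \<or> (\<exists>r\<in>Ps i s. psi i s = pathval g i r)" for i s
    using Max_in[of "insert 0 (pathval g i ` Ps i s)"] finP unfolding psi_def by auto
  have wp: "path A (q i) (v i) (map (\<lambda>x. stateA (snd x)) (C i))" "last (q i # map (\<lambda>x. stateA (snd x)) (C i)) = q i"
    "set (v i) \<subseteq> {..<k}" if i: "i \<le> ?L" for i
    using walk_paths(1,2,8)[OF edges_ok C(1)[OF i]] C(2)[OF i] by (simp_all add: v_def q_def vert_def)
  \<comment> \<open>\<open>A\<close> may have further loops on the same word; they only enlarge
    \<open>al\<close>, which works in favour of the certificate.\<close>
  have al: "al i > 0" "al i \<ge> pweight A (q i) (v i) (map (\<lambda>x. stateA (snd x)) (C i))" if "i \<le> ?L" for i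
  proof -
    show "al i > 0" unfolding al_def wa_mat_pos_iff using wp(1,2)[OF that] by blast
    show "al i \<ge> pweight A (q i) (v i) (map (\<lambda>x. stateA (snd x)) (C i))"
      using pweight_le_wa_mat[OF wp(1)[OF that]] unfolding wp(2)[OF that] al_def .
  qed
  have qA: "q i < wa_nst A" if "i \<le> ?L" for i
    using path_last[OF path_split(1)[OF pathA that] zero_states(1)]
    unfolding path_split(2)[OF pathA that] q_def .
  obtain fr where fr: "\<And>x::rat. x \<ge> 0 \<Longrightarrow> snd (fr x) > 0 \<and> fval (fr x) = x" using frac_of_nonneg_rat by blast
  define F where "F i = sorted_list_of_set (fwd (vert i))" for i
  have "finite (fwd (vert i))" for i
  proof (rule finite_subset)
    show "fwd (vert i) \<subseteq> {..<wa_nst B}" using fwd_lt[of _ i] by blast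
  qed simp
  then have F: "set (F i) = fwd (vert i)" for i by (simp add: F_def)
  define T where "T i = map (\<lambda>s. (s, fr (psi i s))) (F i)" for i
  define item where "item i = (q i, v i, if i < ?L then w ! i else 0, T i)" for i
  define its where "its = map item [0..<Suc ?L]"
  have nst: "wa_nst B = fst B" "wa_nst A = fst A" by (simp_all add: wa_nst_def)
  have lfA: "snd (loop_frac A (item i) (q i)) > 0" "fval (loop_frac A (item i) (q i)) = al i" if "i \<le> ?L" for i
    using fmat[OF wfA qA[OF that]] by (simp_all add: loop_frac_def item_def al_def)
  have lfB: "snd (loop_frac B (item i) s) > 0" "fval (loop_frac B (item i) s) = d i s" if "s < wa_nst B" for i s
    using fmat[OF wfB that] by (simp_all add: loop_frac_def item_def d_def)
  \<comment> \<open>A positive potential provides an accepted suffix, so \<open>s'\<close> lies in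
    \<open>bwd\<close> and \<open>loop_unique\<close> applies.\<close>
  have path_loop: "s' \<in> fwd (vert i)" "psi i s' > 0 \<Longrightarrow> s' = s"
    if i: "i \<le> ?L" and s: "s \<in> fwd (vert i)" and m: "wa_mat B (v i) s s' > 0" for i s s'
  proof -
    obtain \<gamma> where \<gamma>: "path B s (v i) \<gamma>" "last (s # \<gamma>) = s'" using m unfolding wa_mat_pos_iff by blast
    show s': "s' \<in> fwd (vert i)"
      using walk_paths(6)[OF edges_ok C(1)[OF i] s, of \<gamma>] \<gamma> C(2)[OF i] by (simp add: v_def del: last.simps)
    assume "psi i s' > 0"
    then obtain r where "r \<in> Ps i s'" using psi_cases[of i s'] by auto
    then have "path B s' (drop i w) r" "last (s' # r) \<in> wa_final B" by (simp_all add: Ps_def del: last.simps)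
    moreover have "s' < wa_nst B" by (rule fwd_lt[OF s'])
    ultimately have "s' \<in> bwd (vert i)" unfolding vert_def snd_conv by blast
    then show "s' = s" using loop_unique(1)[OF fa i C(1)[OF i] C(2)[OF i] s] \<gamma> by (simp add: v_def)
  qed
  have items: "item_ok k A B (item i)" if i: "i \<le> ?L" for i
    unfolding item_ok_def
  proof (intro conjI ballI allI impI)
    show "item_state (item i) < fst A" using qA[OF i] by (simp add: item_def nst)
    show "c < k" if "c \<in> set (item_loop (item i))" for c using wp(3)[OF i] that by (auto simp: item_def)
    show "0 < fst (loop_frac A (item i) (item_state (item i)))"
      using fval_pos_iff[OF lfA(1)[OF i], where 'a=rat] lfA(2)[OF i] al(1)[OF i] by (simp add: item_def)
    fix x assume "x \<in> set (item_table (item i))"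
    then obtain s where s: "s \<in> fwd (vert i)" "x = (s, fr (psi i s))" by (auto simp: item_def T_def F)
    show xB: "fst x < fst B" using fwd_lt[OF s(1)] s(2) by (simp add: nst)
    show "0 < snd (snd x)" using fr[OF psi0] s(2) by simp
    fix s' assume s': "s' < fst B" and m: "0 < fst (fmat B (item_loop (item i)) (fst x) s')"
    have m': "wa_mat B (v i) s s' > 0" using m fmat_pos_iff[OF wfB fwd_lt[OF s(1)]] s(2) by (simp add: item_def)
    show "\<exists>y\<in>set (item_table (item i)). fst y = s'"
      using path_loop(1)[OF i s(1) m'] by (auto simp: item_def T_def F)
    fix y assume ne: "s' \<noteq> fst x" and y: "y \<in> set (item_table (item i))" "fst y = s'"
    have "psi i s' = 0" using path_loop(2)[OF i s(1) m'] psi0[of i s'] ne s(2) by force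
    then have "fval (snd y) = (0 :: rat) \<and> snd (snd y) > 0" using y fr[OF psi0[of i s']] by (auto simp: item_def T_def F)
    then show "fst (snd y) = 0" by (auto simp: fval_def)
  qed
  have links: "link_ok k A B (item i) (item (Suc i))" if i: "i < ?L" for i
    unfolding link_ok_def
  proof (intro conjI ballI allI impI)
    have e: "edge_ok k A B (length \<rho>s) (vert i, w ! i, vert (Suc i))" using edges_ok i by (auto simp: edges_def)
    show "item_letter (item i) < k" using e i by (simp add: edge_ok_def item_def)
    show "0 < fst (fM A (item_letter (item i)) (item_state (item i)) (item_state (item (Suc i))))"
      using e i by (simp add: edge_ok_def item_def fM_pos_iff[OF wfA] q_def vert_def)
    fix x s' assume "x \<in> set (item_table (item i))" and s': "s' < fst B" and m: "0 < fst (fM B (item_letter (item i)) (fst x) s')"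
    then obtain s where s: "s \<in> fwd (vert i)" "x = (s, fr (psi i s))" by (auto simp: item_def T_def F)
    have m': "wa_M B (w ! i) s s' > 0" using m s(2) i by (simp add: item_def fM_pos_iff[OF wfB])
    have s'f: "s' \<in> fwd (vert (Suc i))" using e s(1) s' m' unfolding edge_ok_def prod.case nst by blast
    \<comment> \<open>Prefixing the best suffix by the present transition gives a competitor for the
      maximum at position \<open>i\<close>.\<close>
    have le: "d (Suc i) s' * psi (Suc i) s' \<le> psi i s * al (Suc i)"
    proof (cases "psi (Suc i) s' = 0")
      case True
      then show ?thesis using psi0[of i s] al(1)[of "Suc i"] i by simp
    next
      case False
      then obtain r where r: "r \<in> Ps (Suc i) s'" "psi (Suc i) s' = pathval g (Suc i) r" using psi_cases by blast
      have "drop i w = w ! i # drop (Suc i) w" using i by (simp add: Cons_nth_drop_Suc)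
      then have "s' # r \<in> Ps i s" using r(1) m' s' by (simp add: Ps_def nst)
      from psi_ge[OF this] have "g (Suc i) s' * psi (Suc i) s' \<le> psi i s" by (simp add: r(2))
      then show ?thesis using al(1)[of "Suc i"] i by (simp add: g_def field_simps)
    qed
    show "\<exists>y\<in>set (item_table (item (Suc i))). fst y = s' \<and>
       \<not> fless (fmul (snd x) (loop_frac A (item (Suc i)) (item_state (item (Suc i))))) (fmul (loop_frac B (item (Suc i)) s') (snd y))"
    proof (intro bexI[of _ "(s', fr (psi (Suc i) s'))"] conjI)
      show "(s', fr (psi (Suc i) s')) \<in> set (item_table (item (Suc i)))" using s'f by (simp add: item_def T_def F)
      have st: "item_state (item (Suc i)) = q (Suc i)" by (simp add: item_def)
      have i': "Suc i \<le> ?L" using i by simp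
      show "\<not> fless (fmul (snd x) (loop_frac A (item (Suc i)) (item_state (item (Suc i)))))
         (fmul (loop_frac B (item (Suc i)) s') (snd (s', fr (psi (Suc i) s'))))"
        using le lfA[OF i'] lfB[of s' "Suc i"] s' fr[OF psi0[of i s]] fr[OF psi0[of "Suc i" s']] s(2)
        unfolding st by (subst fless_iff[where 'a=rat]) (auto simp: snd_fmul fval_fmul nst not_less)
    qed simp
  qed
  have first: "first_ok A B (item 0)"
    unfolding first_ok_def
  proof (intro conjI bexI[of _ "(0, fr (psi 0 0))"])
    show "item_state (item 0) = 0" by (simp add: item_def q_def)
    have "path B 0 (take 0 w) [] \<and> last [0] = 0" by simp
    then have "0 \<in> fwd (vert 0)" unfolding vert_def fst_conv snd_conv by blast
    then show "(0, fr (psi 0 0)) \<in> set (item_table (item 0))" by (simp add: item_def T_def F)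
    \<comment> \<open>A nonzero maximum belongs to some \<open>\<rho>s ! j\<close>. The logarithm of
      its full product, first loop included, is at most minus the total gain in coordinate
      \<open>j\<close>, hence negative.\<close>
    have "d 0 0 * psi 0 0 < al 0"
    proof (cases "psi 0 0 = 0")
      case True
      then show ?thesis using al(1)[of 0] by simp
    next
      case False
      then obtain r where r: "r \<in> Ps 0 0" "psi 0 0 = pathval g 0 r" using psi_cases by blast
      then have "r \<in> set \<rho>s" by (simp add: \<rho>s Ps_def wa_acc_paths_eq)
      then obtain j where j: "j < length \<rho>s" "r = \<rho>s ! j" by (metis in_set_conv_nth)
      have lr: "length r = ?L" using path_length[OF pathB[OF \<open>r \<in> set \<rho>s\<close>]] .
      have prod: "g 0 0 * pathval g 0 r = (\<Prod>i\<le>?L. g i ((0 # r) ! i))"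
        unfolding pathval_prod lr lessThan_Suc_atMost[symmetric] prod.lessThan_Suc_shift by simp
      have gi: "g i ((0 # r) ! i) > 0 \<and> ln (of_rat (g i ((0 # r) ! i))) \<le> - wsum (gain A B j) (vert i) (C i)" if "i \<le> ?L" for i
      proof -
        let ?s = "tracked (vert i) ! j"
        let ?p = "map (\<lambda>x. tracked (snd x) ! j) (C i)"
        note wp' = walk_paths[OF edges_ok C(1)[OF that]]
        have s: "(0 # r) ! i = ?s" using j by (simp add: tracked_nth)
        have d: "d i ?s = pweight B ?s (v i) ?p"
          unfolding d_def v_def by (rule wa_mat_loop_tracked[OF fa that C(1)[OF that] C(2)[OF that] j(1)])
        then have d0: "d i ?s > 0" using wp'(3)[OF j(1)] by (simp add: pweight_pos v_def)
        have pA: "pweight A (q i) (v i) (map (\<lambda>x. stateA (snd x)) (C i)) > 0" using wp(1)[OF that] by (rule pweight_pos)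
        have "ln (of_rat (d i ?s / al i)) = ln (of_rat (d i ?s)) - (ln (of_rat (al i)) :: real)"
          using d0 al(1)[OF that] by (simp add: of_rat_divide ln_div)
        also have "\<dots> \<le> ln (of_rat (d i ?s)) - ln (of_rat (pweight A (q i) (v i) (map (\<lambda>x. stateA (snd x)) (C i))))"
          using pA al[OF that] by (simp add: of_rat_less_eq)
        also have "\<dots> = - wsum (gain A B j) (vert i) (C i)"
          using wp'(5)[OF j(1)] d by (simp add: v_def q_def vert_def)
        finally show ?thesis using d0 al(1)[OF that] by (simp add: s g_def)
      qed
      have "ln (real_of_rat (\<Prod>i\<le>?L. g i ((0 # r) ! i))) = (\<Sum>i\<le>?L. ln (of_rat (g i ((0 # r) ! i))))"
        unfolding of_rat_prod
      proof (rule ln_prod)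
        fix i assume "i \<in> {..?L}"
        then have "g i ((0 # r) ! i) > 0" using gi[of i] by simp
        then show "real_of_rat (g i ((0 # r) ! i)) \<noteq> 0" by simp
      qed simp
      also have "\<dots> \<le> (\<Sum>i\<le>?L. - wsum (gain A B j) (vert i) (C i))" using gi by (intro sum_mono) auto
      also have "\<dots> < 0" using pos[OF j(1)] by (simp add: sum_negf)
      finally have "ln (real_of_rat (\<Prod>i\<le>?L. g i ((0 # r) ! i))) < 0" .
      moreover have "(\<Prod>i\<le>?L. g i ((0 # r) ! i)) > 0" using gi by (intro prod_pos) auto
      ultimately have "real_of_rat (\<Prod>i\<le>?L. g i ((0 # r) ! i)) < 1" using ln_less_zero_iff zero_less_of_rat_iff by blast
      then have "g 0 0 * pathval g 0 r < 1" unfolding prod by simp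
      then show ?thesis using al(1)[of 0] by (simp add: r(2) g_def field_simps)
    qed
    then show "fless (fmul (loop_frac B (item 0) 0) (snd (0, fr (psi 0 0)))) (loop_frac A (item 0) 0)"
      using lfA[of 0] lfB[OF zero_states(2), of 0] fr[OF psi0[of 0 0]]
      by (subst fless_iff[where 'a=rat]) (auto simp: snd_fmul fval_fmul q_def)
  qed simp
  have last: "last_ok A B (item ?L)"
    unfolding last_ok_def
  proof (intro conjI ballI impI)
    show "item_state (item ?L) \<in> set (snd (snd A))"
      using lastA path_split(2)[OF pathA, of ?L] path_length[OF pathA] by (simp add: item_def q_def wa_final_def)
    fix x assume "x \<in> set (item_table (item ?L))" and f: "fst x \<in> set (snd (snd B))"
    then obtain s where s: "s \<in> fwd (vert ?L)" "x = (s, fr (psi ?L s))" by (auto simp: item_def T_def F)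
    then have "[] \<in> Ps ?L s" using f by (simp add: Ps_def wa_final_def)
    from psi_ge[OF this] have "1 \<le> psi ?L s" by simp
    then show "\<not> fless (snd x) (1, 1)"
      using fr[OF psi0[of ?L s]] s(2) by (subst fless_iff[where 'a=rat]) (auto simp: fval_def[of "(_, _)"])
  qed
  have "pump_cert k A B its"
    unfolding pump_cert_def
  proof (intro conjI ballI)
    show "its \<noteq> []" by (simp add: its_def)
    show "item_ok k A B it" if "it \<in> set its" for it
      using that items by (auto simp: its_def less_Suc_eq_le simp del: upt_Suc)
    show "link_ok k A B (fst p) (snd p)" if p: "p \<in> set (zip its (tl its))" for p
    proof -
      obtain i where "i < ?L" "p = (its ! i, tl its ! i)"
        using p by (auto simp: set_zip its_def)
      then have "p = (item i, item (Suc i))" by (simp add: its_def nth_tl del: upt_Suc)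
      then show ?thesis using links[OF \<open>i < ?L\<close>] by simp
    qed
    have "nth_or x its 0 = item 0" for x by (simp add: its_def del: upt_Suc)
    then show "first_ok A B (nth_or (0, [], 0, []) its 0)" using first by simp
    have "nth_or x (rev its) 0 = item ?L" for x by (simp add: its_def rev_nth)
    then show "last_ok A B (nth_or (0, [], 0, []) (rev its) 0)" using last by simp
  qed
  then show ?thesis by blast
qed

end

section \<open>Weights and potentials in the ring of logarithms\<close>

lemma prime_factor_list: "n > 0 \<Longrightarrow> \<exists>fs. (\<forall>p\<in>set fs. prime p) \<and> prod_list fs = (n :: nat)"
proof -
  assume n: "n > 0"
  obtain fs where fs: "mset fs = prime_factorization n" using ex_mset by blast
  have "prod_list fs = n" using prod_mset_prod_list[of fs] fs n by (simp add: prod_mset_prime_factorization_nat)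
  moreover have "\<forall>p\<in>set fs. prime p" using fs by (metis in_prime_factors_imp_prime set_mset_mset)
  ultimately show ?thesis by blast
qed

lemma ln_nat_in_ln_ring: "n > 0 \<Longrightarrow> ln (real n) \<in> ln_ring"
proof -
  assume "n > 0"
  then obtain fs where fs: "\<forall>p\<in>set fs. prime p" "prod_list fs = n" using prime_factor_list by blast
  then have "eval (map (\<lambda>b. [b]) fs, []) = ln (real n)"
    using pval_singletons[of fs] \<open>n > 0\<close> by (simp add: eval_def)
  moreover have "elem_over_primes (map (\<lambda>b. [b]) fs, [])"
    using fs by (auto simp: elem_over_primes_def poly_over_primes_def)
  ultimately show ?thesis unfolding ln_ring_def by (metis (mono_tags) mem_Collect_eq)
qed

lemma ln_ring_diff: "x \<in> ln_ring \<Longrightarrow> y \<in> ln_ring \<Longrightarrow> x - y \<in> ln_ring"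
  using ln_ring_closed(3)[OF _ ln_ring_closed(4)] by fastforce

lemma ln_ring_sum: "(\<And>i. i \<in> I \<Longrightarrow> f i \<in> ln_ring) \<Longrightarrow> sum f I \<in> ln_ring"
  by (induction I rule: infinite_finite_induct) (auto intro: ln_ring_closed)

lemma ln_rat_in_ln_ring: "x > 0 \<Longrightarrow> ln (of_rat x) \<in> ln_ring"
proof -
  assume x: "x > 0"
  obtain f where f: "snd f > 0" "fval f = x" using frac_of_nonneg_rat x by (metis less_imp_le)
  then have "fst f > 0" using fval_pos_iff[OF f(1), where 'a=rat] x by simp
  moreover have "of_rat x = real (fst f) / real (snd f)" using f(2) by (auto simp: fval_def of_rat_divide)
  ultimately show ?thesis using f(1) by (simp add: ln_div ln_ring_diff ln_nat_in_ln_ring)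
qed

lemma wsum_linear: "wsum (\<lambda>v a v'. \<Sum>j<m. y j * f j v a v') v r = (\<Sum>j<m. y j * wsum (f j) v r)"
  by (induction r arbitrary: v) (simp_all add: sum.distrib distrib_left)

context accepted_run
begin

lemma gain_in_ln_ring: "e \<in> edges \<Longrightarrow> j < length \<rho>s \<Longrightarrow> gain A B j (fst e) (fst (snd e)) (snd (snd e)) \<in> ln_ring"
  using edges_ok by (auto simp: edge_ok_def gain_def intro!: ln_ring_diff ln_rat_in_ln_ring)

lemma wsum_gain_in_ln_ring: "walk edges v r \<Longrightarrow> j < length \<rho>s \<Longrightarrow> wsum (gain A B j) v r \<in> ln_ring"
proof (induction r arbitrary: v)
  case (Cons x r)
  then have "gain A B j v (fst x) (snd x) \<in> ln_ring" using gain_in_ln_ring[of "(v, fst x, snd x)" j] by simp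
  moreover have "wsum (gain A B j) (snd x) r \<in> ln_ring" using Cons by simp
  ultimately show ?case by (simp add: ln_ring_closed(3))
qed (simp add: ln_ring_closed)

lemma run_walk:
  assumes "i \<le> length w"
  shows "walk edges (vert 0) (map (\<lambda>t. (w ! t, vert (Suc t))) [0..<i])"
    "wend (vert 0) (map (\<lambda>t. (w ! t, vert (Suc t))) [0..<i]) = vert i"
proof -
  have "walk edges (vert 0) (map (\<lambda>t. (w ! t, vert (Suc t))) [0..<i]) \<and>
    wend (vert 0) (map (\<lambda>t. (w ! t, vert (Suc t))) [0..<i]) = vert i"
    using assms by (induction i) (auto simp: edges_def)
  then show "walk edges (vert 0) (map (\<lambda>t. (w ! t, vert (Suc t))) [0..<i])"
    "wend (vert 0) (map (\<lambda>t. (w ! t, vert (Suc t))) [0..<i]) = vert i" by blast+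
qed

definition loops :: "(nat \<times> (nat \<times> vertex) list) set" where
  "loops = {(i, r). i \<le> length w \<and> walk edges (vert i) r \<and> wend (vert i) r = vert i}"

text \<open>Loops at the same position can be concatenated, so a combination of loops with natural
  coefficients is realised by a single loop at every position.\<close>
lemma loop_combination:
  assumes "finite I" "I \<subseteq> loops"
  shows "\<exists>C. (\<forall>i\<le>length w. (i, C i) \<in> loops) \<and>
    (\<forall>j. (\<Sum>i\<le>length w. wsum (gain A B j) (vert i) (C i)) = (\<Sum>x\<in>I. real (n x) * wsum (gain A B j) (vert (fst x)) (snd x)))"
  using assms
proof (induction I)
  case empty
  show ?case by (intro exI[of _ "\<lambda>_. []"]) (simp add: loops_def)
next
  case (insert x I)
  obtain i0 r where x: "x = (i0, r)" "i0 \<le> length w" "walk edges (vert i0) r" "wend (vert i0) r = vert i0"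
    using insert.prems by (auto simp: loops_def)
  have "\<exists>C. (\<forall>i\<le>length w. (i, C i) \<in> loops) \<and>
    (\<forall>j. (\<Sum>i\<le>length w. wsum (gain A B j) (vert i) (C i)) = real N * wsum (gain A B j) (vert i0) r +
       (\<Sum>x\<in>I. real (n x) * wsum (gain A B j) (vert (fst x)) (snd x)))" for N
  proof (induction N)
    case 0
    then show ?case using insert.IH insert.prems by simp
  next
    case (Suc N)
    then obtain C where C: "\<forall>i\<le>length w. (i, C i) \<in> loops"
      "\<forall>j. (\<Sum>i\<le>length w. wsum (gain A B j) (vert i) (C i)) = real N * wsum (gain A B j) (vert i0) r +
       (\<Sum>x\<in>I. real (n x) * wsum (gain A B j) (vert (fst x)) (snd x))" by blast
    \<comment> \<open>One more copy of \<open>r\<close> at position \<open>i0\<close> adds its gain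
      there and leaves the other positions alone.\<close>
    let ?C = "C(i0 := C i0 @ r)"
    have l: "(i, ?C i) \<in> loops" if "i \<le> length w" for i
      using C(1) that x by (auto simp: loops_def)
    have "(\<Sum>i\<le>length w. wsum (gain A B j) (vert i) (?C i)) =
       (\<Sum>i\<le>length w. wsum (gain A B j) (vert i) (C i)) + wsum (gain A B j) (vert i0) r" for j
    proof -
      have "wend (vert i0) (C i0) = vert i0" using C(1) x(2) by (auto simp: loops_def)
      then have "(\<Sum>i\<le>length w. wsum (gain A B j) (vert i) (?C i)) =
        (\<Sum>i\<le>length w. wsum (gain A B j) (vert i) (C i) + (if i = i0 then wsum (gain A B j) (vert i0) r else 0))"
        by (intro sum.cong) auto
      then show ?thesis using x(2) by (simp add: sum.distrib)
    qed
    then show ?case using C(2) l by (intro exI[of _ ?C]) (simp add: algebra_simps)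
  qed
  from this[of "n x"] show ?case using insert.hyps x(1) by simp
qed

text \<open>Gordan's alternative for the gain vectors of short loops. A positive combination is
  merged into one loop per position and pumped; a functional makes the weighted gain nonpositive on
  every short cycle, and a potential follows.\<close>

lemma pump_cert_or_potential:
  assumes fa: "finitely_ambiguous k B" and no_cert: "\<not> (\<exists>its. pump_cert k A B its)"
  obtains y h where "\<And>j. j < length \<rho>s \<Longrightarrow> y j \<in> ln_ring" "\<And>j. j < length \<rho>s \<Longrightarrow> y j \<ge> 0"
    "\<exists>j<length \<rho>s. y j > 0" "\<And>v. h v \<in> ln_ring"
    "\<And>v a v'. (v, a, v') \<in> edges \<Longrightarrow> (\<Sum>j<length \<rho>s. y j * gain A B j v a v') + h v' - h v \<le> 0"
proof -
  let ?m = "length \<rho>s"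
  define V where "V = vert ` {..length w}"
  have finE: "finite edges" by (simp add: edges_def)
  have V: "finite V" "vert 0 \<in> V" "\<forall>e\<in>edges. snd (snd e) \<in> V" by (auto simp: V_def edges_def)
  \<comment> \<open>The length bound makes \<open>I\<close> finite and is exactly the one that
    \<open>potential_exists\<close> asks for.\<close>
  define I where "I = {(i, r). (i, r) \<in> loops \<and> length r \<le> card V}"
  have finI: "finite I"
  proof (rule finite_subset)
    show "I \<subseteq> {..length w} \<times> {r. set r \<subseteq> snd ` edges \<and> length r \<le> card V}"
      unfolding I_def loops_def by (auto dest!: walk_set dest: subsetD simp del: image_subset_iff)
    show "finite ({..length w} \<times> {r. set r \<subseteq> snd ` edges \<and> length r \<le> card V})"
      using finE by (auto intro: finite_lists_length_le)
  qed
  define G where "G x j = wsum (gain A B j) (vert (fst x)) (snd x)" for x j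
  have GK: "G x j \<in> ln_field" if "x \<in> I" "j < ?m" for x j
    using that unfolding G_def I_def loops_def by (auto intro!: ln_ring_subset_ln_field wsum_gain_in_ln_ring)
  show ?thesis
  proof (rule gordan[where V=G and I=I and m="?m", OF subfield_ln_field finI GK])
    fix n assume n: "\<And>j. j < ?m \<Longrightarrow> (\<Sum>x\<in>I. real (n x) * G x j) > 0"
    have "I \<subseteq> loops" by (auto simp: I_def)
    from loop_combination[OF finI this, of n] obtain C where C: "\<forall>i\<le>length w. (i, C i) \<in> loops"
      "\<forall>j. (\<Sum>i\<le>length w. wsum (gain A B j) (vert i) (C i)) = (\<Sum>x\<in>I. real (n x) * G x j)"
      unfolding G_def by blast
    have "\<exists>its. pump_cert k A B its"
      by (rule pump_cert_exists[OF fa, of C]) (use C n in \<open>auto simp: loops_def\<close>)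
    then show thesis using no_cert by blast
  next
    fix y0 assume y0: "\<And>j. j < ?m \<Longrightarrow> y0 j \<in> ln_field" "\<And>j. j < ?m \<Longrightarrow> y0 j \<ge> 0" "\<exists>j<?m. y0 j > 0"
      "\<And>x. x \<in> I \<Longrightarrow> (\<Sum>j<?m. G x j * y0 j) \<le> 0"
    \<comment> \<open>Scaling by a positive common denominator preserves all conditions on the
      weights and moves them from the field into the ring.\<close>
    obtain D where D: "D \<in> ln_ring" "D > 0" "\<And>j. j < ?m \<Longrightarrow> D * y0 j \<in> ln_ring"
      using ln_field_common_denominator[of "y0 ` {..<?m}"] y0(1) by auto
    define y where "y j = D * y0 j" for j
    define f where "f v a v' = (\<Sum>j<?m. y j * gain A B j v a v')" for v a v'
    have wf: "wsum f v r = (\<Sum>j<?m. y j * wsum (gain A B j) v r)" for v r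
      unfolding f_def by (rule wsum_linear)
    have neg: "\<forall>v\<in>V. \<forall>r. walk edges v r \<longrightarrow> wend v r = v \<longrightarrow> length r \<le> card V \<longrightarrow> wsum f v r \<le> 0"
    proof (intro ballI allI impI)
      fix v r assume v: "v \<in> V" "walk edges v r" "wend v r = v" "length r \<le> card V"
      then obtain i where i: "i \<le> length w" "v = vert i" by (auto simp: V_def)
      then have "(i, r) \<in> I" using v by (simp add: I_def loops_def)
      from y0(4)[OF this] have "D * (\<Sum>j<?m. G (i, r) j * y0 j) \<le> 0" using D(2) by (simp add: mult_le_0_iff)
      then show "wsum f v r \<le> 0" unfolding wf y_def G_def i(2) by (simp add: sum_distrib_left mult_ac)
    qed
    have reach: "\<exists>r. walk edges (vert 0) r \<and> wend (vert 0) r = fst e" if e: "e \<in> edges" for e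
    proof -
      obtain i where "i < length w" "fst e = vert i" using e by (auto simp: edges_def)
      then show ?thesis using run_walk[of i] by auto
    qed
    from potential_exists[OF finE V neg reach] obtain h where h: "\<forall>v. \<exists>r. walk edges (vert 0) r \<and> h v = wsum f (vert 0) r"
      "\<forall>(v, a, v')\<in>edges. h v + f v a v' \<le> h v'" by blast
    have hr: "- h v \<in> ln_ring" for v
    proof -
      obtain r where "walk edges (vert 0) r" "h v = wsum f (vert 0) r" using h(1) by blast
      then show ?thesis unfolding wf
        by (simp only:) (intro ln_ring_closed(4) ln_ring_sum ln_ring_closed(5) wsum_gain_in_ln_ring; simp add: y_def D(3))
    qed
    show thesis
    \<comment> \<open>The sign of the potential is reversed to fit the inequality in
      \<open>token_step\<close>.\<close>
    proof (rule that[of y "\<lambda>v. - h v"])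
      show "(\<Sum>j<?m. y j * gain A B j v a v') + - h v' - - h v \<le> 0" if "(v, a, v') \<in> edges" for v a v'
        using bspec[OF h(2) that] by (simp add: f_def)
      show "y j \<in> ln_ring" "y j \<ge> 0" if "j < ?m" for j
        using D(2,3) y0(2) that by (simp_all add: y_def)
      show "\<exists>j<?m. y j > 0" using y0(3) D(2) by (auto simp: y_def)
    qed (rule hr)
  qed
qed

end

section \<open>From solutions to tokens and a finite certificate\<close>

lemma elem_over_primes_lnf:
  assumes "\<forall>p\<in>set (factors tbl (fst f)). prime p" "\<forall>p\<in>set (factors tbl (snd f)). prime p"
  shows "elem_over_primes (lnf tbl f)"
  using assms by (auto simp: elem_over_primes_def poly_over_primes_def lnf_def)

lemma elem_over_primes_esum: "(\<And>e. e \<in> set l \<Longrightarrow> elem_over_primes e) \<Longrightarrow> elem_over_primes (esum l)"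
proof -
  have "elem_over_primes e \<Longrightarrow> (\<And>e. e \<in> set l \<Longrightarrow> elem_over_primes e) \<Longrightarrow> elem_over_primes (foldl eadd e l)" for e
  proof (induction l arbitrary: e)
    case (Cons x l)
    have "elem_over_primes (eadd e x)" using Cons.prems by (intro elem_over_primes_ops) auto
    from Cons.IH[OF this] Cons.prems show ?case by simp
  qed simp
  moreover have "elem_over_primes ([], [])" by (simp add: elem_over_primes_def poly_over_primes_def)
  ultimately show "(\<And>e. e \<in> set l \<Longrightarrow> elem_over_primes e) \<Longrightarrow> elem_over_primes (esum l)"
    by (simp add: esum_def)
qed

text \<open>Coordinates of weight 0 are dropped: they add nothing to the weighted gain, and
  acceptance checks every remaining weight to be strictly positive.\<close>

definition token :: "nat \<Rightarrow> (nat \<Rightarrow> elem) \<Rightarrow> (vertex \<Rightarrow> elem) \<Rightarrow> vertex \<Rightarrow> token" where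
  "token m Y h v = (map (\<lambda>j. (tracked v ! j, Y j)) (filter (\<lambda>j. eval (Y j) > 0) [0..<m]), h v)"

text \<open>If the table factors the weights of the edge into primes, the element tested lies over
  primes, and \<open>ele_check_complete\<close> applies to it.\<close>

lemma token_step_eventually:
  assumes sch: "schanuel_conjecture" and A: "wa_wf k A" and B: "wa_wf k B"
    and e: "edge_ok k A B m (v, a, v')"
    and Y: "\<And>j. j < m \<Longrightarrow> elem_over_primes (Y j)" "\<And>j. j < m \<Longrightarrow> eval (Y j) \<ge> 0"
    and h: "elem_over_primes (h v)" "elem_over_primes (h v')"
    and le: "(\<Sum>j<m. eval (Y j) * gain A B j v a v') + eval (h v') - eval (h v) \<le> 0"
    and tblA: "elem_over_primes (lnf tbl (fM A a (stateA v) (stateA v')))"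
    and tblB: "\<And>j. j < m \<Longrightarrow> elem_over_primes (lnf tbl (fM B a (tracked v ! j) (tracked v' ! j)))"
  shows "eventually (\<lambda>n. token_step A B tbl n a (stateA v) (stateA v') (token m Y h v) (token m Y h v')) sequentially"
proof -
  let ?J = "filter (\<lambda>j. eval (Y j) > 0) [0..<m]"
  let ?l = "map (\<lambda>j. emul (Y j) (edge_gain A B tbl a (stateA v) (stateA v') (tracked v ! j) (tracked v' ! j))) ?J"
  define ex where "ex = eadd (eadd (h v') (eneg (h v))) (esum ?l)"
  have zip: "zip (fst (token m Y h v)) (fst (token m Y h v')) = map (\<lambda>j. ((tracked v ! j, Y j), (tracked v' ! j, Y j))) ?J"
    by (simp add: token_def zip_map_map zip_same_conv_map)
  have M: "wa_M A a (stateA v) (stateA v') > 0" "\<And>j. j < m \<Longrightarrow> wa_M B a (tracked v ! j) (tracked v' ! j) > 0 \<and> tracked v' ! j < wa_nst B"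
    using e by (auto simp: edge_ok_def)
  have fv: "fval f = (of_rat (fval f) :: real)" for f by (simp add: fval_def of_rat_divide)
  have g: "eval (edge_gain A B tbl a (stateA v) (stateA v') (tracked v ! j) (tracked v' ! j)) = gain A B j v a v'" if "j < m" for j
    using M(1) M(2)[OF that] fM_pos_iff[OF A, of a "stateA v" "stateA v'"] fM_pos_iff[OF B, of a "tracked v ! j" "tracked v' ! j"]
      fM[OF A, of a "stateA v" "stateA v'"] fM[OF B, of a "tracked v ! j" "tracked v' ! j"]
    by (simp add: edge_gain_def eval_lnf fv[of "fM _ _ _ _"] gain_def)
  have "sum_list (map eval ?l) = (\<Sum>j\<in>set ?J. eval (Y j) * gain A B j v a v')"
    using g by (subst sum_list_distinct_conv_sum_set[symmetric]) (auto simp: comp_def intro!: arg_cong[of _ _ sum_list])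
  also have "\<dots> = (\<Sum>j<m. eval (Y j) * gain A B j v a v')"
    using Y(2) by (intro sum.mono_neutral_left) (auto simp: order_less_le)
  finally have "eval ex \<le> 0" using le by (simp add: ex_def)
  moreover have "elem_over_primes ex"
    unfolding ex_def using Y(1) h tblA tblB
    by (auto intro!: elem_over_primes_ops elem_over_primes_esum simp: edge_gain_def)
  ultimately have "eventually (\<lambda>n. ele_check n ex) sequentially" using ele_check_complete[OF sch] by blast
  then show ?thesis
  proof (rule eventually_mono)
    fix n assume n: "ele_check n ex"
    show "token_step A B tbl n a (stateA v) (stateA v') (token m Y h v) (token m Y h v')"
      unfolding token_step_def zip
    proof (intro conjI ballI)
      show "map snd (fst (token m Y h v)) = map snd (fst (token m Y h v'))" by (simp add: token_def comp_def)
      fix x assume "x \<in> set (map (\<lambda>j. ((tracked v ! j, Y j), (tracked v' ! j, Y j))) ?J)"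
      then obtain j where "j < m" "x = ((tracked v ! j, Y j), (tracked v' ! j, Y j))" by auto
      then show "fst (snd x) < fst B" "0 < fst (fM B a (fst (fst x)) (fst (snd x)))"
        using M(2)[of j] fM_pos_iff[OF B] by (auto simp: wa_nst_def)
    next
      show "ele_check n (eadd (eadd (snd (token m Y h v')) (eneg (snd (token m Y h v))))
        (esum (map (\<lambda>x. emul (snd (fst x)) (edge_gain A B tbl a (stateA v) (stateA v') (fst (fst x)) (fst (snd x))))
           (map (\<lambda>j. ((tracked v ! j, Y j), (tracked v' ! j, Y j))) ?J))))"
        using n by (simp add: ex_def token_def comp_def)
    qed
  qed
qed

text \<open>A finite range for the vertices of all runs with at most \<open>c\<close> tracked paths,
  uniform in the word.\<close>

definition vertices :: "wa \<Rightarrow> wa \<Rightarrow> nat \<Rightarrow> vertex set" where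
  "vertices A B c = {..<wa_nst A} \<times> {ps. set ps \<subseteq> {..<wa_nst B} \<and> length ps \<le> c} \<times> Pow {..<wa_nst B} \<times> Pow {..<wa_nst B}"

lemma finite_vertices: "finite (vertices A B c)"
  by (auto simp: vertices_def intro!: finite_cartesian_product finite_lists_length_le)

context accepted_run
begin

lemma vert_in_vertices:
  assumes "length \<rho>s \<le> c" "i \<le> length w" shows "vert i \<in> vertices A B c"
proof -
  have "(0 # qs) ! i < wa_nst A"
    using path_last[OF path_split(1)[OF pathA assms(2)] zero_states(1)] unfolding path_split(2)[OF pathA assms(2)] .
  then have "stateA (vert i) < wa_nst A" by (simp add: vert_def)
  moreover have "set (tracked (vert i)) \<subseteq> {..<wa_nst B}" using tracked_eq[OF assms(2)] fwd_lt by blast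
  moreover have "length (tracked (vert i)) \<le> c" using assms(1) by (simp add: vert_def)
  moreover have "fwd (vert i) \<subseteq> {..<wa_nst B}" "bwd (vert i) \<subseteq> {..<wa_nst B}" using fwd_lt bwd_lt by blast+
  ultimately show ?thesis unfolding vertices_def by (cases "vert i") auto
qed

end

lemma key_facts:
  fixes A B :: wa
  assumes "accepted_run k A B w qs \<rho>s" "length \<rho>s \<le> c"
  defines "v0 \<equiv> accepted_run.vert B w qs \<rho>s 0" and "E \<equiv> accepted_run.edges B w qs \<rho>s"
  shows "\<forall>e\<in>E. edge_ok k A B (length \<rho>s) e" "finite E" "stateA v0 = 0" "\<forall>p\<in>set (tracked v0). p = 0"
    "v0 \<in> vertices A B c" "E \<subseteq> vertices A B c \<times> {..<k} \<times> vertices A B c"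
    "\<exists>r. walk E v0 r \<and> map fst r = w \<and> map (\<lambda>x. stateA (snd x)) r = qs \<and>
       set (tracked (wend v0 r)) \<subseteq> wa_final B \<and> length (tracked (wend v0 r)) = length \<rho>s"
proof -
  interpret accepted_run k A B w qs \<rho>s by fact
  show ok: "\<forall>e\<in>E. edge_ok k A B (length \<rho>s) e" unfolding E_def by (rule edges_ok)
  show "finite E" by (simp add: E_def edges_def)
  show "stateA v0 = 0" "\<forall>p\<in>set (tracked v0). p = 0" by (auto simp: v0_def vert_def)
  show "v0 \<in> vertices A B c" unfolding v0_def by (rule vert_in_vertices[OF assms(2)]) simp
  show "E \<subseteq> vertices A B c \<times> {..<k} \<times> vertices A B c"
  proof
    fix e assume "e \<in> E"
    then obtain i where i: "i < length w" "e = (vert i, w ! i, vert (Suc i))" by (auto simp: E_def edges_def)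
    moreover from i(1) have "w ! i < k" using w nth_mem[OF i(1)] by blast
    ultimately show "e \<in> vertices A B c \<times> {..<k} \<times> vertices A B c"
      using vert_in_vertices[OF assms(2)] by auto
  qed
  let ?r = "map (\<lambda>t. (w ! t, vert (Suc t))) [0..<length w]"
  have rw: "walk edges (vert 0) ?r" "wend (vert 0) ?r = vert (length w)" using run_walk[of "length w"] by simp_all
  have "map fst ?r = w" by (simp add: comp_def map_nth)
  moreover have "map (\<lambda>x. stateA (snd x)) ?r = qs"
    using path_length[OF pathA] by (auto intro: nth_equalityI simp: vert_def)
  moreover have "set (tracked (vert (length w))) \<subseteq> wa_final B"
  proof
    fix s assume "s \<in> set (tracked (vert (length w)))"
    then obtain \<rho> where "\<rho> \<in> set \<rho>s" "s = (0 # \<rho>) ! length w" by (auto simp: vert_def)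
    then show "s \<in> wa_final B" using path_split(2)[OF pathB, of \<rho> "length w"] lastB[of \<rho>] path_length[OF pathB, of \<rho>] by simp
  qed
  moreover have "length (tracked (vert (length w))) = length \<rho>s" by (simp add: vert_def)
  ultimately show "\<exists>r. walk E v0 r \<and> map fst r = w \<and> map (\<lambda>x. stateA (snd x)) r = qs \<and>
       set (tracked (wend v0 r)) \<subseteq> wa_final B \<and> length (tracked (wend v0 r)) = length \<rho>s"
    using rw unfolding E_def v0_def by (intro exI[of _ ?r]) simp
qed

text \<open>The number of tracked paths, the initial vertex and the edges: a solution depends on
  nothing else of a run, so infinitely many words share finitely many keys.\<close>

type_synonym key = "nat \<times> vertex \<times> (vertex \<times> nat \<times> vertex) set"

definition key_solution :: "wa \<Rightarrow> wa \<Rightarrow> key \<Rightarrow> (nat \<Rightarrow> elem) \<Rightarrow> (vertex \<Rightarrow> elem) \<Rightarrow> bool" where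
  "key_solution A B \<kappa> Y h \<longleftrightarrow>
     (\<forall>j<fst \<kappa>. elem_over_primes (Y j) \<and> eval (Y j) \<ge> 0) \<and> (\<exists>j<fst \<kappa>. eval (Y j) > 0) \<and>
     (\<forall>v. elem_over_primes (h v)) \<and>
     (\<forall>(v, a, v')\<in>snd (snd \<kappa>). (\<Sum>j<fst \<kappa>. eval (Y j) * gain A B j v a v') + eval (h v') - eval (h v) \<le> 0)"

lemma key_solution_exists:
  assumes "accepted_run k A B w qs \<rho>s" and fa: "finitely_ambiguous k B" and no: "\<not> (\<exists>its. pump_cert k A B its)"
  shows "\<exists>Y h. key_solution A B (length \<rho>s, v0, accepted_run.edges B w qs \<rho>s) Y h"
proof -
  interpret accepted_run k A B w qs \<rho>s by fact
  obtain y h where y: "\<And>j. j < length \<rho>s \<Longrightarrow> y j \<in> ln_ring" "\<And>j. j < length \<rho>s \<Longrightarrow> y j \<ge> 0"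
    "\<exists>j<length \<rho>s. y j > 0" "\<And>v. h v \<in> ln_ring"
    "\<And>v a v'. (v, a, v') \<in> edges \<Longrightarrow> (\<Sum>j<length \<rho>s. y j * gain A B j v a v') + h v' - h v \<le> 0"
    by (rule pump_cert_or_potential[OF fa no]) (rule that)
  have rep: "\<exists>e. elem_over_primes e \<and> eval e = x" if "x \<in> ln_ring" for x
    using that unfolding ln_ring_def by auto
  have "\<forall>j. \<exists>e. j < length \<rho>s \<longrightarrow> elem_over_primes e \<and> eval e = y j"
    using rep y(1) by blast
  then obtain Y where Y: "\<And>j. j < length \<rho>s \<Longrightarrow> elem_over_primes (Y j) \<and> eval (Y j) = y j" by metis
  have "\<forall>v. \<exists>e. elem_over_primes e \<and> eval e = h v" using rep y(4) by blast
  then obtain H where H: "\<And>v. elem_over_primes (H v) \<and> eval (H v) = h v" by metis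
  have "key_solution A B (length \<rho>s, v0, edges) Y H"
    unfolding key_solution_def using Y H y by auto
  then show ?thesis by blast
qed

lemma factors_prime_table:
  "\<exists>tbl. \<forall>x. 0 < x \<and> x < b \<longrightarrow> (\<forall>p\<in>set (factors tbl x). prime p)"
proof -
  obtain T where T: "\<And>n::nat. n > 0 \<Longrightarrow> (\<forall>p\<in>set (T n). prime p) \<and> prod_list (T n) = n"
    using prime_factor_list by metis
  let ?tbl = "map T [1..<b]"
  have "\<forall>p\<in>set (factors ?tbl x). prime p" if x: "0 < x" "x < b" for x
  proof -
    let ?l = "filter (\<lambda>fs. prod_list fs = x) ?tbl"
    have "T x \<in> set ?l" using x T[OF x(1)] by auto
    then have "?l \<noteq> []" by (metis empty_iff empty_set)
    then have "factors ?tbl x \<in> set ?l" using nth_or_0_cases[of "[x]" ?l] by (auto simp: factors_def)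
    then obtain n where "n \<ge> 1" "factors ?tbl x = T n" by auto
    then show ?thesis using T[of n] by simp
  qed
  then show ?thesis by blast
qed

lemma image_Collect_pairs: "f ` {g u \<pi> |u \<pi>. P u \<pi>} = {f (g u \<pi>) |u \<pi>. P u \<pi>}"
  by blast

text \<open>A subset construction. To each word \<open>u\<close> and run \<open>\<pi>\<close> of
  \<open>A\<close> on it belongs the set of keys together with a vertex reached in them by a walk
  labelled in this way; finitely many sets arise. Cutting off the last step of a walk yields the
  predecessor token, and when \<open>\<pi>\<close> accepts, the key of this very run supplies the
  good token.\<close>

lemma cert_exists:
  assumes sch: "schanuel_conjecture" and A: "wa_wf k A" and B: "wa_wf k B" and fa: "finitely_ambiguous k B"
    and no: "\<not> (\<exists>its. pump_cert k A B its)"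
  shows "\<exists>C. bigO_cert k A B C"
proof -
  obtain c where c: "\<And>w. set w \<subseteq> {..<k} \<Longrightarrow> card (wa_acc_paths B w) \<le> c"
    using fa by (auto simp: finitely_ambiguous_def)
  define K where "K = {(length \<rho>s, accepted_run.vert B w qs \<rho>s 0, accepted_run.edges B w qs \<rho>s) |w qs \<rho>s.
     accepted_run k A B w qs \<rho>s \<and> length \<rho>s \<le> c}"
  let ?U = "vertices A B c"
  have Kok: "\<forall>e\<in>E. edge_ok k A B m e" "finite E" "stateA v0 = 0" "\<forall>p\<in>set (tracked v0). p = 0"
    "v0 \<in> ?U" "E \<subseteq> ?U \<times> {..<k} \<times> ?U" "\<exists>Yh. key_solution A B (m, v0, E) (fst Yh) (snd Yh)"
    if K: "(m, v0, E) \<in> K" for m v0 E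
  proof -
    obtain w qs \<rho>s where *: "accepted_run k A B w qs \<rho>s" "length \<rho>s \<le> c" "m = length \<rho>s"
      "v0 = accepted_run.vert B w qs \<rho>s 0" "E = accepted_run.edges B w qs \<rho>s" using K by (auto simp: K_def)
    show "\<forall>e\<in>E. edge_ok k A B m e" "finite E" "stateA v0 = 0" "\<forall>p\<in>set (tracked v0). p = 0"
      "v0 \<in> ?U" "E \<subseteq> ?U \<times> {..<k} \<times> ?U"
      using key_facts[OF *(1,2)] unfolding *(3-5) by blast+
    show "\<exists>Yh. key_solution A B (m, v0, E) (fst Yh) (snd Yh)"
      using key_solution_exists[OF *(1) fa no] unfolding *(3-5) by simp
  qed
  have finK: "finite K"
  proof (rule finite_subset)
    show "K \<subseteq> {..c} \<times> ?U \<times> Pow (?U \<times> {..<k} \<times> ?U)"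
    proof
      fix \<kappa> assume \<kappa>: "\<kappa> \<in> K"
      obtain m v0 E where eq: "\<kappa> = (m, v0, E)" by (cases \<kappa>)
      have "m \<le> c" using \<kappa> by (auto simp: eq K_def)
      then show "\<kappa> \<in> {..c} \<times> ?U \<times> Pow (?U \<times> {..<k} \<times> ?U)" using Kok(5,6)[of m v0 E] \<kappa> by (simp add: eq)
    qed
  qed (simp add: finite_vertices)
  have "\<forall>\<kappa>\<in>K. \<exists>Yh. key_solution A B \<kappa> (fst Yh) (snd Yh)" using Kok(7) by auto
  then obtain Yh where Yh: "\<And>\<kappa>. \<kappa> \<in> K \<Longrightarrow> key_solution A B \<kappa> (fst (Yh \<kappa>)) (snd (Yh \<kappa>))" by metis
  define Y where "Y \<kappa> = fst (Yh \<kappa>)" for \<kappa>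
  define h where "h \<kappa> = snd (Yh \<kappa>)" for \<kappa>
  have sol: "key_solution A B \<kappa> (Y \<kappa>) (h \<kappa>)" if "\<kappa> \<in> K" for \<kappa> using Yh[OF that] by (simp add: Y_def h_def)
  define tok where "tok x = token (fst (fst x)) (Y (fst x)) (h (fst x)) (snd x)" for x :: "key \<times> vertex"
  \<comment> \<open>The transition weights that occur; their numerators and denominators are to be
    covered by the factor table.\<close>
  define fracs :: "frac set" where "fracs = (\<Union>\<kappa>\<in>K. \<Union>e\<in>snd (snd \<kappa>).
     insert (fM A (fst (snd e)) (stateA (fst e)) (stateA (snd (snd e))))
       ((\<lambda>j. fM B (fst (snd e)) (tracked (fst e) ! j) (tracked (snd (snd e)) ! j)) ` {..<fst \<kappa>}))"
  have "finite fracs" unfolding fracs_def using finK Kok(2) by auto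
  then have "finite (fst ` fracs \<union> snd ` fracs)" by simp
  then obtain b where "\<forall>x\<in>fst ` fracs \<union> snd ` fracs. x < b" unfolding finite_nat_set_iff_bounded ..
  then have b: "\<And>x. x \<in> fst ` fracs \<union> snd ` fracs \<Longrightarrow> x < b" by blast
  obtain tbl where tbl: "\<And>x. 0 < x \<Longrightarrow> x < b \<Longrightarrow> \<forall>p\<in>set (factors tbl x). prime p" using factors_prime_table[of b] by blast
  have lnf: "elem_over_primes (lnf tbl f)" if "f \<in> fracs" "fst f > 0" "snd f > 0" for f
    using that b tbl by (intro elem_over_primes_lnf) auto
  have step: "eventually (\<lambda>n. token_step A B tbl n (fst (snd e)) (stateA (fst e)) (stateA (snd (snd e))) (tok (\<kappa>, fst e)) (tok (\<kappa>, snd (snd e)))) sequentially"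
    if \<kappa>: "\<kappa> \<in> K" and e: "e \<in> snd (snd \<kappa>)" for \<kappa> e
  proof -
    obtain m v0 E where eq: "\<kappa> = (m, v0, E)" by (cases \<kappa>)
    obtain v a v' where ev: "e = (v, a, v')" by (cases e)
    have ok: "edge_ok k A B m (v, a, v')" using Kok(1) \<kappa> e eq ev by auto
    have s: "key_solution A B (m, v0, E) (Y \<kappa>) (h \<kappa>)" using sol[OF \<kappa>] eq by simp
    have "eventually (\<lambda>n. token_step A B tbl n a (stateA v) (stateA v') (token m (Y \<kappa>) (h \<kappa>) v) (token m (Y \<kappa>) (h \<kappa>) v')) sequentially"
    proof (rule token_step_eventually[OF sch A B ok])
      show "(\<Sum>j<m. eval (Y \<kappa> j) * gain A B j v a v') + eval (h \<kappa> v') - eval (h \<kappa> v) \<le> 0"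
        using s e by (auto simp: key_solution_def eq ev)
      have fr: "insert (fM A a (stateA v) (stateA v')) ((\<lambda>j. fM B a (tracked v ! j) (tracked v' ! j)) ` {..<m}) \<subseteq> fracs"
        unfolding fracs_def using \<kappa> e[unfolded ev] by (force simp: eq)
      show "elem_over_primes (lnf tbl (fM A a (stateA v) (stateA v')))"
      proof (rule lnf)
        show "fst (fM A a (stateA v) (stateA v')) > 0" using ok by (simp add: edge_ok_def fM_pos_iff[OF A])
      qed (use fr fM(1)[OF A] in auto)
      show "elem_over_primes (lnf tbl (fM B a (tracked v ! j) (tracked v' ! j)))" if "j < m" for j
      proof (rule lnf)
        show "fst (fM B a (tracked v ! j) (tracked v' ! j)) > 0" using ok that by (simp add: edge_ok_def fM_pos_iff[OF B])
      qed (use fr fM(1)[OF B] that in auto)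
      show "elem_over_primes (h \<kappa> v)" "elem_over_primes (h \<kappa> v')" using s unfolding key_solution_def by blast+
    qed (use s in \<open>auto simp: key_solution_def\<close>)
    then show ?thesis by (simp add: tok_def ev eq)
  qed
  \<comment> \<open>Finitely many conditions, each true from some precision on, hold at a common
    \<open>n\<close>.\<close>
  have "eventually (\<lambda>n. (\<forall>\<kappa>\<in>K. \<forall>e\<in>snd (snd \<kappa>). token_step A B tbl n (fst (snd e)) (stateA (fst e)) (stateA (snd (snd e))) (tok (\<kappa>, fst e)) (tok (\<kappa>, snd (snd e))))
     \<and> (\<forall>\<kappa>\<in>K. \<forall>j\<in>{j. j < fst \<kappa> \<and> eval (Y \<kappa> j) > 0}. eneg_check n (eneg (Y \<kappa> j))) \<and> n > 0) sequentially"
    using finK Kok(2) step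
    by (intro eventually_conj eventually_ball_finite ballI eventually_gt_at_top)
      (auto intro!: eneg_check_complete)
  then obtain n where n: "\<And>\<kappa> e. \<kappa> \<in> K \<Longrightarrow> e \<in> snd (snd \<kappa>) \<Longrightarrow>
      token_step A B tbl n (fst (snd e)) (stateA (fst e)) (stateA (snd (snd e))) (tok (\<kappa>, fst e)) (tok (\<kappa>, snd (snd e)))"
    "\<And>\<kappa> j. \<kappa> \<in> K \<Longrightarrow> j < fst \<kappa> \<Longrightarrow> eval (Y \<kappa> j) > 0 \<Longrightarrow> eneg_check n (eneg (Y \<kappa> j))" "n > 0"
    using eventually_happens'[OF sequentially_bot] by fast
  \<comment> \<open>A key is a guess about the whole word, made at its beginning; walks that cannot
    be continued by the next letter disappear.\<close>
  define Reach where "Reach u \<pi> = {(\<kappa>, v). \<kappa> \<in> K \<and> (\<exists>r. walk (snd (snd \<kappa>)) (fst (snd \<kappa>)) r \<and>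
     map fst r = u \<and> map (\<lambda>x. stateA (snd x)) r = \<pi> \<and> wend (fst (snd \<kappa>)) r = v)}" for u \<pi>
  have ReachU: "Reach u \<pi> \<subseteq> K \<times> ?U" for u \<pi>
  proof
    fix x assume "x \<in> Reach u \<pi>"
    then obtain \<kappa> r where x: "\<kappa> \<in> K" "walk (snd (snd \<kappa>)) (fst (snd \<kappa>)) r" "x = (\<kappa>, wend (fst (snd \<kappa>)) r)"
      unfolding Reach_def by blast
    have \<kappa>: "(fst \<kappa>, fst (snd \<kappa>), snd (snd \<kappa>)) \<in> K" using x(1) by simp
    have "wend (fst (snd \<kappa>)) r \<in> ?U"
    proof (rule wend_in[OF x(2) Kok(5)[OF \<kappa>]])
      show "snd (snd e) \<in> ?U" if "e \<in> snd (snd \<kappa>)" for e using Kok(6)[OF \<kappa>] that by auto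
    qed
    then show "x \<in> K \<times> ?U" using x by simp
  qed
  have finR: "finite (Reach u \<pi>)" for u \<pi>
    by (rule finite_subset[OF ReachU]) (simp add: finK finite_vertices)
  define XX where "XX = {(last (0 # \<pi>), Reach u \<pi>) |u \<pi>. set u \<subseteq> {..<k} \<and> path A 0 u \<pi>}"
  have A0: "0 < wa_nst A" using A by (simp add: wa_wf_def)
  have "XX \<subseteq> {..<wa_nst A} \<times> Pow (K \<times> ?U)" unfolding XX_def using ReachU path_last[OF _ A0] by blast
  then have "finite XX" by (rule finite_subset) (simp add: finK finite_vertices)
  then obtain Ls where Ls: "set Ls = XX" using finite_list by blast
  obtain lst where lst: "\<And>R :: (key \<times> vertex) set. finite R \<Longrightarrow> set (lst R) = R" using finite_list by metis
  define Xs where "Xs = map (\<lambda>x. (fst x, map tok (lst (snd x)))) Ls"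
  have Xs: "set Xs = {(last (0 # \<pi>), map tok (lst (Reach u \<pi>))) |u \<pi>. set u \<subseteq> {..<k} \<and> path A 0 u \<pi>}"
    unfolding Xs_def set_map Ls XX_def image_Collect_pairs fst_conv snd_conv ..
  have toks: "set (map tok (lst (Reach u \<pi>))) = tok ` Reach u \<pi>" for u \<pi> using lst[OF finR] by simp
  have "bigO_cert k A B (tbl, n, Xs)"
    unfolding bigO_cert_def prod.case
  proof (intro conjI)
    show "n > 0" by fact
    have "(last [0], map tok (lst (Reach [] []))) \<in> set Xs"
      unfolding Xs by (rule CollectI, rule exI[of _ "[]"], rule exI[of _ "[]"]) simp
    then show "\<exists>X\<in>set Xs. fst X = 0 \<and> (\<forall>z\<in>set (snd X). \<forall>x\<in>set (fst z). fst x = 0)"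
    proof (rule bexI[rotated], intro conjI ballI)
      fix z x assume z: "z \<in> set (snd (last [0], map tok (lst (Reach [] []))))" and x: "x \<in> set (fst z)"
      then obtain \<kappa> r where \<kappa>: "\<kappa> \<in> K" "map fst r = ([] :: nat list)" "z = tok (\<kappa>, wend (fst (snd \<kappa>)) r)"
        unfolding snd_conv toks unfolding Reach_def by blast
      obtain w qs \<rho>s where "fst \<kappa> = length \<rho>s" "fst (snd \<kappa>) = accepted_run.vert B w qs \<rho>s 0" "accepted_run k A B w qs \<rho>s"
        using \<kappa>(1) unfolding K_def by auto
      then have len: "length (tracked (fst (snd \<kappa>))) = fst \<kappa>" using accepted_run.vert_def[of k A B w qs \<rho>s 0] by simp
      obtain j where "j < fst \<kappa>" "fst x = tracked (fst (snd \<kappa>)) ! j" using x \<kappa>(2,3) by (auto simp: tok_def token_def)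
      then have "fst x \<in> set (tracked (fst (snd \<kappa>)))" using len by simp
      then show "fst x = 0" using Kok(4)[of "fst \<kappa>" "fst (snd \<kappa>)" "snd (snd \<kappa>)"] \<kappa>(1) by simp
    qed simp
    show "\<forall>X\<in>set Xs. \<forall>a<k. \<forall>q'<fst A. fst (fM A a (fst X) q') > 0 \<longrightarrow>
        (\<exists>X'\<in>set Xs. fst X' = q' \<and> (\<forall>z'\<in>set (snd X'). \<exists>z\<in>set (snd X). token_step A B tbl n a (fst X) q' z z'))"
    proof (intro ballI allI impI)
      fix X a q' assume X: "X \<in> set Xs" and a: "a < k" and q': "q' < fst A" and m: "fst (fM A a (fst X) q') > 0"
      obtain u \<pi> where u: "X = (last (0 # \<pi>), map tok (lst (Reach u \<pi>)))" "set u \<subseteq> {..<k}" "path A 0 u \<pi>"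
        using X unfolding Xs by blast
      have p: "path A 0 (u @ [a]) (\<pi> @ [q'])"
        unfolding path_append[OF path_length[OF u(3)]] using u m q' fM_pos_iff[OF A] by (simp add: wa_nst_def del: last.simps)
      have l: "set (u @ [a]) \<subseteq> {..<k}" using u(2) a by simp
      have X': "(last (0 # \<pi> @ [q']), map tok (lst (Reach (u @ [a]) (\<pi> @ [q'])))) \<in> set Xs"
        unfolding Xs by (intro CollectI exI conjI) (rule refl, rule l, rule p)
      show "\<exists>X'\<in>set Xs. fst X' = q' \<and> (\<forall>z'\<in>set (snd X'). \<exists>z\<in>set (snd X). token_step A B tbl n a (fst X) q' z z')"
      proof (rule bexI[OF _ X'], intro conjI ballI)
        fix z' assume "z' \<in> set (snd (last (0 # \<pi> @ [q']), map tok (lst (Reach (u @ [a]) (\<pi> @ [q'])))))"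
        then obtain \<kappa> r' where \<kappa>: "\<kappa> \<in> K" "walk (snd (snd \<kappa>)) (fst (snd \<kappa>)) r'"
          "map fst r' = u @ [a]" "map (\<lambda>x. stateA (snd x)) r' = \<pi> @ [q']" "z' = tok (\<kappa>, wend (fst (snd \<kappa>)) r')"
          unfolding snd_conv toks unfolding Reach_def by blast
        have "r' \<noteq> []" using \<kappa>(3) by auto
        then obtain r x where r': "r' = r @ [x]" by (metis rev_exhaust)
        have r: "map fst r = u" "fst x = a" "map (\<lambda>x. stateA (snd x)) r = \<pi>" "stateA (snd x) = q'" using \<kappa>(3,4) by (simp_all add: r')
        let ?v0 = "fst (snd \<kappa>)" and ?E = "snd (snd \<kappa>)"
        have w: "walk ?E ?v0 r" "(wend ?v0 r, a, snd x) \<in> ?E" using \<kappa>(2) r(2) by (simp_all add: r')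
        have "(\<kappa>, wend ?v0 r) \<in> Reach u \<pi>" unfolding Reach_def using \<kappa>(1) w(1) r by blast
        then have z: "tok (\<kappa>, wend ?v0 r) \<in> set (snd X)" unfolding u(1) snd_conv toks by blast
        have "stateA (wend ?v0 r) = last (stateA ?v0 # map (\<lambda>x. stateA (snd x)) r)" by (induction r rule: rev_induct) auto
        then have "stateA (wend ?v0 r) = fst X" using Kok(3)[of "fst \<kappa>" ?v0 ?E] \<kappa>(1) r(3) u(1) by simp
        then have "token_step A B tbl n a (fst X) q' (tok (\<kappa>, wend ?v0 r)) z'"
          using n(1)[OF \<kappa>(1) w(2)] r(4) by (simp add: \<kappa>(5) r')
        then show "\<exists>z\<in>set (snd X). token_step A B tbl n a (fst X) q' z z'" using z by blast
      qed simp
    qed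
    show "\<forall>X\<in>set Xs. fst X \<in> set (snd (snd A)) \<longrightarrow> (\<exists>z\<in>set (snd X). fst z \<noteq> [] \<and>
           (\<forall>x\<in>set (fst z). fst x \<in> set (snd (snd B)) \<and> eneg_check n (eneg (snd x))))"
    proof (intro ballI impI)
      fix X assume X: "X \<in> set Xs" and f: "fst X \<in> set (snd (snd A))"
      obtain u \<pi> where u: "X = (last (0 # \<pi>), map tok (lst (Reach u \<pi>)))" "set u \<subseteq> {..<k}" "path A 0 u \<pi>"
        using X unfolding Xs by blast
      have acc: "\<pi> \<in> wa_acc_paths A u" using u f by (simp add: wa_acc_paths_eq wa_final_def del: last.simps)
      \<comment> \<open>Free of repetitions, so that its length is the number of accepting paths and
        at most \<open>c\<close>.\<close>
      obtain \<rho>s where \<rho>s: "set \<rho>s = wa_acc_paths B u" "distinct \<rho>s" using finite_distinct_list[OF finite_acc_paths] by blast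
      have len: "length \<rho>s \<le> c" using c[OF u(2)] \<rho>s distinct_card by metis
      have run: "accepted_run k A B u \<pi> \<rho>s" by standard (use A B u(2) acc \<rho>s in auto)
      define \<kappa> where "\<kappa> = (length \<rho>s, accepted_run.vert B u \<pi> \<rho>s 0, accepted_run.edges B u \<pi> \<rho>s)"
      have \<kappa>: "\<kappa> \<in> K" unfolding K_def \<kappa>_def using run len by blast
      obtain r where r: "walk (snd (snd \<kappa>)) (fst (snd \<kappa>)) r" "map fst r = u" "map (\<lambda>x. stateA (snd x)) r = \<pi>"
        "set (tracked (wend (fst (snd \<kappa>)) r)) \<subseteq> wa_final B" "length (tracked (wend (fst (snd \<kappa>)) r)) = fst \<kappa>"
        using key_facts(7)[OF run len] unfolding \<kappa>_def fst_conv snd_conv by blast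
      let ?v = "wend (fst (snd \<kappa>)) r"
      have "(\<kappa>, ?v) \<in> Reach u \<pi>" unfolding Reach_def using \<kappa> r by blast
      then have z: "tok (\<kappa>, ?v) \<in> set (snd X)" unfolding u(1) snd_conv toks by blast
      obtain j where j: "j < fst \<kappa>" "eval (Y \<kappa> j) > 0" using sol[OF \<kappa>] by (auto simp: key_solution_def)
      show "\<exists>z\<in>set (snd X). fst z \<noteq> [] \<and> (\<forall>x\<in>set (fst z). fst x \<in> set (snd (snd B)) \<and> eneg_check n (eneg (snd x)))"
      proof (intro bexI[OF _ z] conjI ballI)
        show "fst (tok (\<kappa>, ?v)) \<noteq> []" using j by (auto simp: tok_def token_def filter_empty_conv)
        fix x assume "x \<in> set (fst (tok (\<kappa>, ?v)))"
        then obtain i where i: "i < fst \<kappa>" "eval (Y \<kappa> i) > 0" "x = (tracked ?v ! i, Y \<kappa> i)" by (auto simp: tok_def token_def)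
        show "fst x \<in> set (snd (snd B))" using r(4,5) i by (auto simp: wa_final_def)
        show "eneg_check n (eneg (snd x))" using n(2)[OF \<kappa> i(1,2)] i(3) by simp
      qed
    qed
  qed
  then show ?thesis by blast
qed

section \<open>The decision procedure\<close>

text \<open>Each function is treated once on projections of a tuple, where the basic rules also work
  under binders; these composition lemmas transfer the result to arbitrary arguments.\<close>

lemma computable_comp2:
  assumes "computable (\<lambda>p. F (fst p) (snd p))" "computable a" "computable b"
  shows "computable (\<lambda>x. F (a x) (b x))"
  using computable_comp[OF assms(1) computable_Pair[OF assms(2,3)]] by simp

lemma computable_comp3:
  assumes "computable (\<lambda>p. F (fst p) (fst (snd p)) (snd (snd p)))" "computable a" "computable b" "computable c"
  shows "computable (\<lambda>x. F (a x) (b x) (c x))"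
  using computable_comp[OF assms(1) computable_Pair[OF assms(2) computable_Pair[OF assms(3,4)]]] by simp

lemma computable_comp4:
  assumes "computable (\<lambda>p. F (fst p) (fst (snd p)) (fst (snd (snd p))) (snd (snd (snd p))))"
    "computable a" "computable b" "computable c" "computable d"
  shows "computable (\<lambda>x. F (a x) (b x) (c x) (d x))"
  using computable_comp3[where F="\<lambda>a b cd. F a b (fst cd) (snd cd)", OF assms(1-3) computable_Pair[OF assms(4,5)]] by simp

lemma decidable_comp2:
  assumes "decidable (\<lambda>p. F (fst p) (snd p))" "computable a" "computable b"
  shows "decidable (\<lambda>x. F (a x) (b x))"
  using assms unfolding decidable_def by (rule computable_comp2)

lemma decidable_comp3:
  assumes "decidable (\<lambda>p. F (fst p) (fst (snd p)) (snd (snd p)))" "computable a" "computable b" "computable c"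
  shows "decidable (\<lambda>x. F (a x) (b x) (c x))"
  using assms unfolding decidable_def by (rule computable_comp3)

lemma decidable_comp4:
  assumes "decidable (\<lambda>p. F (fst p) (fst (snd p)) (fst (snd (snd p))) (snd (snd (snd p))))"
    "computable a" "computable b" "computable c" "computable d"
  shows "decidable (\<lambda>x. F (a x) (b x) (c x) (d x))"
  using assms unfolding decidable_def by (rule computable_comp4)

lemma decidable_comp5:
  assumes "decidable (\<lambda>p. F (fst p) (fst (snd p)) (fst (snd (snd p))) (fst (snd (snd (snd p)))) (snd (snd (snd (snd p)))))"
    "computable a" "computable b" "computable c" "computable d" "computable e"
  shows "decidable (\<lambda>x. F (a x) (b x) (c x) (d x) (e x))"
  using decidable_comp4[where F="\<lambda>a b c de. F a b c (fst de) (snd de)", OF assms(1-4) computable_Pair[OF assms(5,6)]] by simp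

lemma decidable_member: "computable f \<Longrightarrow> computable l \<Longrightarrow> decidable (\<lambda>x. f x \<in> set (l x))"
proof -
  assume f: "computable f" and l: "computable l"
  have "decidable (\<lambda>x. \<exists>y\<in>set (l x). f x = y)"
    by (intro decidable_bex decidable_eq l comp_basic computable_comp[OF f])
  then show ?thesis by simp
qed

named_theorems comp_rules

lemmas [comp_rules] = comp_intros decidable_member

section \<open>Computability of the certificate checkers\<close>

lemma computable_fadd [comp_rules]:
  "computable a \<Longrightarrow> computable b \<Longrightarrow> computable (\<lambda>x. fadd (a x) (b x))"
proof (rule computable_comp2[where F=fadd])
  show "computable (\<lambda>p. fadd (fst p) (snd p))" unfolding fadd_def by (intro comp_rules)
qed

lemma computable_fmul [comp_rules]:
  "computable a \<Longrightarrow> computable b \<Longrightarrow> computable (\<lambda>x. fmul (a x) (b x))"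
proof (rule computable_comp2[where F=fmul])
  show "computable (\<lambda>p. fmul (fst p) (snd p))" unfolding fmul_def by (intro comp_rules)
qed

lemma decidable_fless [comp_rules]:
  "computable a \<Longrightarrow> computable b \<Longrightarrow> decidable (\<lambda>x. fless (a x) (b x))"
proof (rule decidable_comp2[where F=fless])
  show "decidable (\<lambda>p. fless (fst p) (snd p))" unfolding fless_def by (intro comp_rules)
qed

lemma computable_fsum [comp_rules]: "computable a \<Longrightarrow> computable (\<lambda>x. fsum (a x))"
proof -
  have "computable (\<lambda>p. fsum p)" unfolding fsum_def by (intro comp_rules)
  then show "computable a \<Longrightarrow> computable (\<lambda>x. fsum (a x))" by (rule computable_comp[where f=fsum])
qed

lemma computable_fprod [comp_rules]: "computable a \<Longrightarrow> computable (\<lambda>x. fprod (a x))"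
proof -
  have "computable (\<lambda>p. fprod p)" unfolding fprod_def by (intro comp_rules)
  then show "computable a \<Longrightarrow> computable (\<lambda>x. fprod (a x))" by (rule computable_comp[where f=fprod])
qed

lemma computable_ln_lo [comp_rules]:
  "computable a \<Longrightarrow> computable b \<Longrightarrow> computable (\<lambda>x. ln_lo (a x) (b x))"
proof (rule computable_comp2[where F=ln_lo])
  show "computable (\<lambda>p. ln_lo (fst p) (snd p))" unfolding ln_lo_def by (intro comp_rules)
qed

lemma computable_ln_hi [comp_rules]:
  "computable a \<Longrightarrow> computable b \<Longrightarrow> computable (\<lambda>x. ln_hi (a x) (b x))"
proof (rule computable_comp2[where F=ln_hi])
  show "computable (\<lambda>p. ln_hi (fst p) (snd p))" unfolding ln_hi_def by (intro comp_rules)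
qed

lemma computable_pmul [comp_rules]:
  "computable a \<Longrightarrow> computable b \<Longrightarrow> computable (\<lambda>x. pmul (a x) (b x))"
proof (rule computable_comp2[where F=pmul])
  show "computable (\<lambda>p. pmul (fst p) (snd p))" unfolding pmul_def by (intro comp_rules)
qed

lemma computable_eadd [comp_rules]:
  "computable a \<Longrightarrow> computable b \<Longrightarrow> computable (\<lambda>x. eadd (a x) (b x))"
proof (rule computable_comp2[where F=eadd])
  show "computable (\<lambda>p. eadd (fst p) (snd p))" unfolding eadd_def by (intro comp_rules)
qed

lemma computable_eneg [comp_rules]: "computable a \<Longrightarrow> computable (\<lambda>x. eneg (a x))"
proof -
  have "computable (\<lambda>p. eneg p)" unfolding eneg_def by (intro comp_rules)
  then show "computable a \<Longrightarrow> computable (\<lambda>x. eneg (a x))" by (rule computable_comp[where f=eneg])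
qed

lemma computable_emul [comp_rules]:
  "computable a \<Longrightarrow> computable b \<Longrightarrow> computable (\<lambda>x. emul (a x) (b x))"
proof (rule computable_comp2[where F=emul])
  show "computable (\<lambda>p. emul (fst p) (snd p))" unfolding emul_def by (intro comp_rules)
qed

lemma computable_esum [comp_rules]: "computable a \<Longrightarrow> computable (\<lambda>x. esum (a x))"
proof -
  have "computable (\<lambda>p. esum p)" unfolding esum_def by (intro comp_rules)
  then show "computable a \<Longrightarrow> computable (\<lambda>x. esum (a x))" by (rule computable_comp[where f=esum])
qed

text \<open>\<open>peval\<close> has a function as argument, which carries no code; therefore only
  its two instances are treated.\<close>

lemma computable_peval_hi [comp_rules]:
  "computable a \<Longrightarrow> computable b \<Longrightarrow> computable (\<lambda>x. peval (ln_hi (a x)) (b x))"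
proof (rule computable_comp2[where F="\<lambda>a b. peval (ln_hi a) b"])
  show "computable (\<lambda>p. peval (ln_hi (fst p)) (snd p))" unfolding peval_def by (intro comp_rules)
qed

lemma computable_peval_lo [comp_rules]:
  "computable a \<Longrightarrow> computable b \<Longrightarrow> computable (\<lambda>x. peval (ln_lo (a x)) (b x))"
proof (rule computable_comp2[where F="\<lambda>a b. peval (ln_lo a) b"])
  show "computable (\<lambda>p. peval (ln_lo (fst p)) (snd p))" unfolding peval_def by (intro comp_rules)
qed

lemma decidable_eneg_check [comp_rules]:
  "computable a \<Longrightarrow> computable b \<Longrightarrow> decidable (\<lambda>x. eneg_check (a x) (b x))"
proof (rule decidable_comp2[where F=eneg_check])
  show "decidable (\<lambda>p. eneg_check (fst p) (snd p))" unfolding eneg_check_def by (intro comp_rules)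
qed

lemma computable_cnt [comp_rules]:
  "computable a \<Longrightarrow> computable b \<Longrightarrow> computable (\<lambda>x. cnt (a x) (b x))"
proof (rule computable_comp2[where F=cnt])
  show "computable (\<lambda>p. cnt (fst p) (snd p))" unfolding cnt_def by (intro comp_rules)
qed

lemma decidable_meq [comp_rules]:
  "computable a \<Longrightarrow> computable b \<Longrightarrow> decidable (\<lambda>x. meq (a x) (b x))"
proof (rule decidable_comp2[where F=meq])
  show "decidable (\<lambda>p. meq (fst p) (snd p))" unfolding meq_def by (intro comp_rules)
qed

lemma computable_pcnt [comp_rules]:
  "computable a \<Longrightarrow> computable b \<Longrightarrow> computable (\<lambda>x. pcnt (a x) (b x))"
proof (rule computable_comp2[where F=pcnt])
  show "computable (\<lambda>p. pcnt (fst p) (snd p))" unfolding pcnt_def by (intro comp_rules)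
qed

lemma decidable_peq [comp_rules]:
  "computable a \<Longrightarrow> computable b \<Longrightarrow> decidable (\<lambda>x. peq (a x) (b x))"
proof (rule decidable_comp2[where F=peq])
  show "decidable (\<lambda>p. peq (fst p) (snd p))" unfolding peq_def by (intro comp_rules)
qed

lemma decidable_ele_check [comp_rules]:
  "computable a \<Longrightarrow> computable b \<Longrightarrow> decidable (\<lambda>x. ele_check (a x) (b x))"
proof (rule decidable_comp2[where F=ele_check])
  show "decidable (\<lambda>p. ele_check (fst p) (snd p))" unfolding ele_check_def by (intro comp_rules)
qed

lemma computable_fM [comp_rules]:
  "computable a \<Longrightarrow> computable b \<Longrightarrow> computable c \<Longrightarrow> computable d \<Longrightarrow> computable (\<lambda>x. fM (a x) (b x) (c x) (d x))"
proof (rule computable_comp4[where F=fM])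
  show "computable (\<lambda>p. fM (fst p) (fst (snd p)) (fst (snd (snd p))) (snd (snd (snd p))))" unfolding fM_def by (intro comp_rules)
qed

lemma computable_factors [comp_rules]:
  "computable a \<Longrightarrow> computable b \<Longrightarrow> computable (\<lambda>x. factors (a x) (b x))"
proof (rule computable_comp2[where F=factors])
  show "computable (\<lambda>p. factors (fst p) (snd p))" unfolding factors_def by (intro comp_rules)
qed

lemma computable_lnf [comp_rules]:
  "computable a \<Longrightarrow> computable b \<Longrightarrow> computable (\<lambda>x. lnf (a x) (b x))"
proof (rule computable_comp2[where F=lnf])
  show "computable (\<lambda>p. lnf (fst p) (snd p))" unfolding lnf_def by (intro comp_rules)
qed

lemma computable_fcol_step [comp_rules]:
  "computable a \<Longrightarrow> computable b \<Longrightarrow> computable c \<Longrightarrow> computable (\<lambda>x. fcol_step (a x) (b x) (c x))"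
proof (rule computable_comp3[where F=fcol_step])
  show "computable (\<lambda>p. fcol_step (fst p) (fst (snd p)) (snd (snd p)))" unfolding fcol_step_def by (intro comp_rules)
qed

lemma computable_fmat [comp_rules]:
  "computable a \<Longrightarrow> computable b \<Longrightarrow> computable c \<Longrightarrow> computable d \<Longrightarrow> computable (\<lambda>x. fmat (a x) (b x) (c x) (d x))"
proof (rule computable_comp4[where F=fmat])
  show "computable (\<lambda>p. fmat (fst p) (fst (snd p)) (fst (snd (snd p))) (snd (snd (snd p))))" unfolding fmat_def by (intro comp_rules)
qed

lemma computable_loop_frac [comp_rules]:
  "computable a \<Longrightarrow> computable b \<Longrightarrow> computable c \<Longrightarrow> computable (\<lambda>x. loop_frac (a x) (b x) (c x))"
proof (rule computable_comp3[where F=loop_frac])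
  show "computable (\<lambda>p. loop_frac (fst p) (fst (snd p)) (snd (snd p)))" unfolding loop_frac_def by (intro comp_rules)
qed

lemma decidable_item_ok [comp_rules]:
  "computable a \<Longrightarrow> computable b \<Longrightarrow> computable c \<Longrightarrow> computable d \<Longrightarrow> decidable (\<lambda>x. item_ok (a x) (b x) (c x) (d x))"
proof (rule decidable_comp4[where F=item_ok])
  show "decidable (\<lambda>p. item_ok (fst p) (fst (snd p)) (fst (snd (snd p))) (snd (snd (snd p))))" unfolding item_ok_def by (intro comp_rules)
qed

lemma decidable_link_ok [comp_rules]:
  "computable a \<Longrightarrow> computable b \<Longrightarrow> computable c \<Longrightarrow> computable d \<Longrightarrow> computable e \<Longrightarrow> decidable (\<lambda>x. link_ok (a x) (b x) (c x) (d x) (e x))"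
proof (rule decidable_comp5[where F=link_ok])
  show "decidable (\<lambda>p. link_ok (fst p) (fst (snd p)) (fst (snd (snd p))) (fst (snd (snd (snd p)))) (snd (snd (snd (snd p)))))" unfolding link_ok_def by (intro comp_rules)
qed

lemma decidable_last_ok [comp_rules]:
  "computable a \<Longrightarrow> computable b \<Longrightarrow> computable c \<Longrightarrow> decidable (\<lambda>x. last_ok (a x) (b x) (c x))"
proof (rule decidable_comp3[where F=last_ok])
  show "decidable (\<lambda>p. last_ok (fst p) (fst (snd p)) (snd (snd p)))" unfolding last_ok_def by (intro comp_rules)
qed

lemma decidable_first_ok [comp_rules]:
  "computable a \<Longrightarrow> computable b \<Longrightarrow> computable c \<Longrightarrow> decidable (\<lambda>x. first_ok (a x) (b x) (c x))"
proof (rule decidable_comp3[where F=first_ok])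
  show "decidable (\<lambda>p. first_ok (fst p) (fst (snd p)) (snd (snd p)))" unfolding first_ok_def by (intro comp_rules)
qed

lemma decidable_pump_cert [comp_rules]:
  "computable a \<Longrightarrow> computable b \<Longrightarrow> computable c \<Longrightarrow> computable d \<Longrightarrow> decidable (\<lambda>x. pump_cert (a x) (b x) (c x) (d x))"
proof (rule decidable_comp4[where F=pump_cert])
  show "decidable (\<lambda>p. pump_cert (fst p) (fst (snd p)) (fst (snd (snd p))) (snd (snd (snd p))))" unfolding pump_cert_def by (intro comp_rules)
qed

lemma computable_edge_gain:
  assumes "computable A" "computable B" "computable tbl" "computable a" "computable q" "computable q'" "computable p" "computable p'"
  shows "computable (\<lambda>x. edge_gain (A x) (B x) (tbl x) (a x) (q x) (q' x) (p x) (p' x))"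
  unfolding edge_gain_def by (intro comp_rules assms)

lemma decidable_token_step:
  assumes "computable A" "computable B" "computable tbl" "computable n" "computable a" "computable q" "computable q'" "computable z" "computable z'"
  shows "decidable (\<lambda>x. token_step (A x) (B x) (tbl x) (n x) (a x) (q x) (q' x) (z x) (z' x))"
  unfolding token_step_def
  \<comment> \<open>The parameters also occur below bounded quantifiers, where they appear composed
    with projections.\<close>
  by (intro comp_rules computable_edge_gain assms assms[THEN computable_comp])

lemma decidable_bigO_cert:
  "computable a \<Longrightarrow> computable b \<Longrightarrow> computable c \<Longrightarrow> computable d \<Longrightarrow> decidable (\<lambda>x. bigO_cert (a x) (b x) (c x) (d x))"
proof (rule decidable_comp4)
  show "decidable (\<lambda>p. bigO_cert (fst p) (fst (snd p)) (fst (snd (snd p))) (snd (snd (snd p))))"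
    unfolding bigO_cert_def case_prod_unfold by (intro comp_rules decidable_token_step)
qed

text \<open>The default 0 makes decoding total on all numbers; on codes of entries all five indices
  are in range.\<close>

definition decode_entry :: "nat \<Rightarrow> nat \<times> nat \<times> nat \<times> nat \<times> nat" where
  "decode_entry e = (nth_or 0 (list_decode e) 0, nth_or 0 (list_decode e) 1, nth_or 0 (list_decode e) 2,
     nth_or 0 (list_decode e) 3, nth_or 0 (list_decode e) 4)"

definition decode_wa :: "nat \<Rightarrow> wa" where
  "decode_wa e = (nth_or 0 (list_decode e) 0, map decode_entry (list_decode (nth_or 0 (list_decode e) 1)),
     list_decode (nth_or 0 (list_decode e) 2))"

lemma decode_enc_entry: "decode_entry (enc_entry e) = e"
  by (cases e) (simp add: decode_entry_def enc_entry_def nth_or_def)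

lemma decode_enc_wa: "decode_wa (enc_wa A) = A"
  by (cases A) (simp add: decode_wa_def enc_wa_def nth_or_def wa_nst_def wa_entries_def comp_def decode_enc_entry)

lemma computable_decode_entry: "computable f \<Longrightarrow> computable (\<lambda>x. decode_entry (f x))"
  unfolding decode_entry_def by (intro comp_rules computable_list_decode)

lemma computable_decode_wa: "computable f \<Longrightarrow> computable (\<lambda>x. decode_wa (f x))"
  unfolding decode_wa_def by (intro comp_rules computable_list_decode computable_decode_entry)

lemma instance_components:
  "nth_or 0 (list_decode (enc_instance k A B)) 0 = k"
  "decode_wa (nth_or 0 (list_decode (enc_instance k A B)) 1) = A"
  "decode_wa (nth_or 0 (list_decode (enc_instance k A B)) 2) = B"
  by (simp_all add: enc_instance_def nth_or_def decode_enc_wa)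

theorem theorem9p2:
  assumes "schanuel_conjecture"
  shows "\<exists>prog :: instr list. \<forall>k A B.
           wa_wf k A \<and> wa_wf k B \<and> finitely_ambiguous k A \<and> finitely_ambiguous k B \<longrightarrow>
           cm_computes prog (enc_instance k A B) (if big_O k A B then 1 else 0)"
proof -
  define K where "K x = nth_or 0 (list_decode x) 0" for x
  define LA where "LA x = decode_wa (nth_or 0 (list_decode x) 1)" for x
  define LB where "LB x = decode_wa (nth_or 0 (list_decode x) 2)" for x
  \<comment> \<open>The same number \<open>t\<close> is tried as a certificate of either kind, which
    runs both enumerations in parallel.\<close>
  define yes where "yes x t \<longleftrightarrow> bigO_cert (K x) (LA x) (LB x) (inv enc t)" for x t
  define no where "no x t \<longleftrightarrow> pump_cert (K x) (LA x) (LB x) (inv enc t)" for x t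
  have yes: "decidable (\<lambda>p. yes (fst p) (snd p))" and no: "decidable (\<lambda>p. no (fst p) (snd p))"
    unfolding yes_def no_def K_def LA_def LB_def
    by (intro decidable_bigO_cert decidable_pump_cert comp_rules computable_decode_wa computable_list_decode computable_inv_enc)+
  have "computable (\<lambda>p. if yes (fst p) (snd p) \<or> no (fst p) (snd p) then 0 else 1 :: nat)"
    by (intro comp_rules yes no)
  then obtain g where g: "cfun g" "\<And>x t. (if yes x t \<or> no x t then 0 else 1) = g (prod_encode (x, t))"
    by (rule computableE) force
  have "computable (\<lambda>p. if yes (fst p) (snd p) then 1 else 0 :: nat)"
    by (intro comp_rules yes)
  then obtain f where f: "cfun f" "\<And>x t. (if yes x t then 1 else 0) = f (prod_encode (x, t))"
    by (rule computableE) force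
  obtain P where P: "\<And>x t. g (prod_encode (x, t)) = 0 \<Longrightarrow> (\<And>s. s < t \<Longrightarrow> g (prod_encode (x, s)) \<noteq> 0)
      \<Longrightarrow> cm_computes P x (f (prod_encode (x, t)))"
    using cfun_search[OF g(1) f(1)] by blast
  show ?thesis
  proof (intro exI[of _ P] allI impI, elim conjE)
    fix k A B
    assume A: "wa_wf k A" and B: "wa_wf k B" and fA: "finitely_ambiguous k A" and fB: "finitely_ambiguous k B"
    let ?x = "enc_instance k A B"
    have yes: "yes ?x t \<longleftrightarrow> bigO_cert k A B (inv enc t)" and no: "no ?x t \<longleftrightarrow> pump_cert k A B (inv enc t)" for t
      by (simp_all only: yes_def no_def K_def LA_def LB_def instance_components)
    have "\<exists>t. g (prod_encode (?x, t)) = 0"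
    proof (cases "\<exists>its. pump_cert k A B its")
      case True
      then obtain its where "pump_cert k A B its" by blast
      then have "no ?x (enc its)" by (simp only: no inv_enc_enc)
      then show ?thesis using g(2)[of ?x "enc its"] by (metis (full_types))
    next
      \<comment> \<open>The conjecture and the finite ambiguity of \<open>B\<close> guarantee here
        that the search stops.\<close>
      case False
      then obtain C where "bigO_cert k A B C" using cert_exists[OF assms A B fB] by blast
      then have "yes ?x (enc C)" by (simp only: yes inv_enc_enc)
      then show ?thesis using g(2)[of ?x "enc C"] by (metis (full_types))
    qed
    then obtain t where t: "g (prod_encode (?x, t)) = 0" "\<And>s. s < t \<Longrightarrow> g (prod_encode (?x, s)) \<noteq> 0"
      unfolding exists_least_iff[where P="\<lambda>t. g (prod_encode (?x, t)) = 0"] by blast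
    then have "yes ?x t \<or> no ?x t" using g(2)[of ?x t] by (auto split: if_splits)
    \<comment> \<open>Soundness of both kinds makes them exclude each other, so the kind found first
      is the verdict.\<close>
    then have "f (prod_encode (?x, t)) = (if big_O k A B then 1 else 0)"
      using bigO_cert_sound[OF A B fA] pump_cert_sound[OF A B] f(2)[of ?x t, symmetric] by (auto simp: yes no)
    then show "cm_computes P ?x (if big_O k A B then 1 else 0)" using P[OF t] by simp
  qed
qed

end
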